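(* It is undecidable whether a finite partial deterministic inverse transducer has a nontrivial fixed point. That is, there is no algorithm which, given a finite alphabet $A$ and a finite partial deterministic inverse $\widetilde A$-transducer $\mathcal T$, decides whether $\operatorname{Fix}(\widetilde{\mathcal T})\neq\{1\}$.
   Context: For a finite alphabet $A$, let $\widetilde A=A\cup A^{-1}$ ($A^{-1}$ the set of formal inverses), let $F_A$ be the free group on $A$, and for $g\in F_A$ let $\overline g$ be its freely reduced representative word over $\widetilde A$. Maps are written on the right. A finite partial deterministic $\widetilde A$-transducer is $\mathcal T=(Q,q_0,\delta,\lambda)$ with $Q$ a finite set of states, $q_0\in Q$ the initial state, and partial functions $\delta:Q\times\widetilde A\rightharpoonup Q$, $\lambda:Q\times\widetilde A\rightharpoonup\widetilde A^*$ with the same domain. If $(q,a)\delta=r$ and $(q,a)\lambda=U$, we say $q\xrightarrow{a\mid U}r$ is an edge. Both are extended to words in the usual way: reading a word follows edges consecutively and concatenates outputs; a word $u$ is readable from $q$ if $(q,u)\delta$ is defined. The transducer is inverse if $p\xrightarrow{a\mid w}q$ is an edge if and only if $q\xrightarrow{a^{-1}\mid w^{-1}}p$ is an edge ($w^{-1}$ being the formal inverse word). An inverse transducer $\mathcal T$ defines a partial map $\widetilde{\mathcal T}:F_A\rightharpoonup F_A$: $g\widetilde{\mathcal T}$ is defined if and only if $\overline g$ is readable from $q_0$, and then it is the element of $F_A$ represented by $(q_0,\overline g)\lambda$. Put $\operatorname{Fix}(\widetilde{\mathcal T})=\{w\in F_A\mid w\widetilde{\mathcal T}\text{ is defined and }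 w\widetilde{\mathcal T}=w\}$. *)

theory Defs
  imports "HOL-Algebra.Group" "HOL-Library.Nat_Bijection"
begin

section \<open>Words and the free group\<close>

text \<open>The alphabet with formal inverses is the disjoint sum \<open>A <+> A\<close>: \<open>Inl a\<close> is the letter
  \<open>a\<close> and \<open>Inr a\<close> its formal inverse.\<close>

type_synonym 'a letter = "'a + 'a"
type_synonym 'a word = "'a letter list"

definition inv_letter :: "'a letter \<Rightarrow> 'a letter" where
  "inv_letter = case_sum Inr Inl"

definition inv_word :: "'a word \<Rightarrow> 'a word" where
  "inv_word w = rev (map inv_letter w)"

definition words :: "'a set \<Rightarrow> 'a word set" where
  "words A = lists (A <+> A)"

definition free_step :: "'a set \<Rightarrow> ('a word \<times> 'a word) set" where
  "free_step A = {(u @ [x, inv_letter x] @ v, u @ v) | u x v.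
     u \<in> words A \<and> x \<in> A <+> A \<and> v \<in> words A}"

definition free_eq :: "'a set \<Rightarrow> ('a word \<times> 'a word) set" where
  "free_eq A = Restr ((free_step A \<union> (free_step A)\<inverse>)\<^sup>*) (words A)"

definition free_class :: "'a set \<Rightarrow> 'a word \<Rightarrow> 'a word set" where
  "free_class A w = free_eq A `` {w}"

definition free_group :: "'a set \<Rightarrow> ('a word set) monoid" where
  "free_group A = \<lparr>carrier = words A // free_eq A,
     mult = (\<lambda>g h. \<Union>u\<in>g. \<Union>v\<in>h. free_class A (u @ v)),
     one = free_class A []\<rparr>"

definition reduced :: "'a word \<Rightarrow> bool" where
  "reduced w \<longleftrightarrow> \<not> (\<exists>u x v. w = u @ [x, inv_letter x] @ v)"

text \<open>Existence and uniqueness of the reduced representative are lemma \<open>reduced_word_unique\<close>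
  below.\<close>

definition reduced_word :: "'a word set \<Rightarrow> 'a word" where
  "reduced_word g = (THE w. w \<in> g \<and> reduced w)"


section \<open>Transducers\<close>

record ('a, 'q) transducer =
  states :: "'q set"
  initial :: 'q
  delta :: "'q \<times> 'a letter \<rightharpoonup> 'q"
  lambda :: "'q \<times> 'a letter \<rightharpoonup> 'a word"

definition edge :: "('a, 'q) transducer \<Rightarrow> 'q \<Rightarrow> 'a letter \<Rightarrow> 'a word \<Rightarrow> 'q \<Rightarrow> bool" where
  "edge T p a w q \<longleftrightarrow> delta T (p, a) = Some q \<and> lambda T (p, a) = Some w"

definition finite_transducer :: "'a set \<Rightarrow> ('a, 'q) transducer \<Rightarrow> bool" where
  "finite_transducer A T \<longleftrightarrow>
     finite (states T) \<and> initial T \<in> states T \<and>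
     dom (delta T) \<subseteq> states T \<times> (A <+> A) \<and> ran (delta T) \<subseteq> states T \<and>
     dom (lambda T) = dom (delta T) \<and> ran (lambda T) \<subseteq> words A"

definition inverse_transducer :: "('a, 'q) transducer \<Rightarrow> bool" where
  "inverse_transducer T \<longleftrightarrow>
     (\<forall>p a w q. edge T p a w q \<longleftrightarrow> edge T q (inv_letter a) (inv_word w) p)"

primrec delta_word :: "('a, 'q) transducer \<Rightarrow> 'q \<Rightarrow> 'a word \<Rightarrow> 'q option" where
  "delta_word T q [] = Some q"
| "delta_word T q (a # u) = Option.bind (delta T (q, a)) (\<lambda>r. delta_word T r u)"

primrec lambda_word :: "('a, 'q) transducer \<Rightarrow> 'q \<Rightarrow> 'a word \<Rightarrow> 'a word option" where
  "lambda_word T q [] = Some []"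
| "lambda_word T q (a # u) =
     Option.bind (delta T (q, a)) (\<lambda>r.
     Option.bind (lambda T (q, a)) (\<lambda>U.
     Option.bind (lambda_word T r u) (\<lambda>V. Some (U @ V))))"

definition readable :: "('a, 'q) transducer \<Rightarrow> 'q \<Rightarrow> 'a word \<Rightarrow> bool" where
  "readable T q u \<longleftrightarrow> delta_word T q u \<noteq> None"

definition transducer_map :: "'a set \<Rightarrow> ('a, 'q) transducer \<Rightarrow> 'a word set \<rightharpoonup> 'a word set" where
  "transducer_map A T g =
     (if g \<in> carrier (free_group A) \<and> readable T (initial T) (reduced_word g)
      then Some (free_class A (the (lambda_word T (initial T) (reduced_word g))))
      else None)"

definition fixed_points :: "'a set \<Rightarrow> ('a, 'q) transducer \<Rightarrow> 'a word set set" where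
  "fixed_points A T = {g \<in> carrier (free_group A). transducer_map A T g = Some g}"


section \<open>Partial recursive functions and decidability\<close>

datatype recf =
    Zero
  | Succ
  | Proj nat
  | Comp recf "recf list"
  | PrimRec recf recf
  | Mu recf

text \<open>\<open>computes f xs y\<close>: the partial recursive function denoted by \<open>f\<close> is defined at the
  argument tuple \<open>xs\<close> with value \<open>y\<close>. Recursion and minimisation act on the first argument.\<close>

inductive computes :: "recf \<Rightarrow> nat list \<Rightarrow> nat \<Rightarrow> bool" where
  zero: "computes Zero xs 0"
| succ: "computes Succ [x] (Suc x)"
| proj: "i < length xs \<Longrightarrow> computes (Proj i) xs (xs ! i)"
| comp: "list_all2 (\<lambda>g y. computes g xs y) gs ys \<Longrightarrow> computes f ys z \<Longrightarrow>
    computes (Comp f gs) xs z"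
| primrec_0: "computes f xs y \<Longrightarrow> computes (PrimRec f g) (0 # xs) y"
| primrec_Suc: "computes (PrimRec f g) (n # xs) y \<Longrightarrow> computes g (n # y # xs) z \<Longrightarrow>
    computes (PrimRec f g) (Suc n # xs) z"
| mu: "computes f (n # xs) 0 \<Longrightarrow> \<forall>m<n. \<exists>y. computes f (m # xs) (Suc y) \<Longrightarrow>
    computes (Mu f) xs n"

text \<open>\<open>decidable code I P\<close>: some algorithm halts on every instance in \<open>I\<close>, presented through
  \<open>code\<close>, and answers whether \<open>P\<close> holds. Nothing is required on numbers that do not code an
  instance.\<close>

definition decidable :: "('i \<Rightarrow> nat) \<Rightarrow> 'i set \<Rightarrow> ('i \<Rightarrow> bool) \<Rightarrow> bool" where
  "decidable code I P \<longleftrightarrow> (\<exists>f. \<forall>i\<in>I. computes f [code i] (if P i then 1 else 0))"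


section \<open>Transducers as inputs of algorithms\<close>

text \<open>Up to renaming, letters and states are natural numbers. An instance is coded by the
  canonical indices \<open>set_encode\<close> of its alphabet, its state set and its finite set of edges,
  together with the initial state; the coding is injective (lemma \<open>inj_on_transducer_code\<close>).\<close>

definition edge_code :: "nat \<times> nat letter \<times> nat word \<times> nat \<Rightarrow> nat" where
  "edge_code = (\<lambda>(p, a, w, q).
     prod_encode (p, prod_encode (sum_encode a,
       prod_encode (list_encode (map sum_encode w), q))))"

definition edges :: "('a, 'q) transducer \<Rightarrow> ('q \<times> 'a letter \<times> 'a word \<times> 'q) set" where
  "edges T = {(p, a, w, q). edge T p a w q}"

definition transducer_code :: "nat set \<times> (nat, nat) transducer \<Rightarrow> nat" where
  "transducer_code = (\<lambda>(A, T).
     prod_encode (set_encode A, prod_encode (set_encode (states T),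
       prod_encode (initial T, set_encode (edge_code ` edges T)))))"

definition inverse_transducers :: "(nat set \<times> (nat, nat) transducer) set" where
  "inverse_transducers =
     {(A, T). finite A \<and> finite_transducer A T \<and> inverse_transducer T}"


section \<open>The definitions are well behaved\<close>

subsection \<open>The free group\<close>

lemma inv_letter_simps [simp]:
  "inv_letter (Inl a) = Inr a" "inv_letter (Inr a) = Inl a"
  by (simp_all add: inv_letter_def)

lemma inv_letter_inv_letter [simp]: "inv_letter (inv_letter x) = x"
  by (cases x) auto

lemma inv_letter_mem [simp]: "inv_letter x \<in> A <+> A \<longleftrightarrow> x \<in> A <+> A"
  by (cases x) auto

lemma words_simps [simp]:
  "[] \<in> words A" "u @ v \<in> words A \<longleftrightarrow> u \<in> words A \<and> v \<in> words A"
  "x # u \<in> words A \<longleftrightarrow> x \<in> A <+> A \<and> u \<in> words A"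
  by (auto simp: words_def)

lemma inv_word_mem [simp]: "inv_word u \<in> words A \<longleftrightarrow> u \<in> words A"
  by (induction u) (auto simp: inv_word_def)

lemma equiv_free_eq: "equiv (words A) (free_eq A)"
proof (rule equivI)
  show "sym (free_eq A)"
    unfolding free_eq_def
    by (intro sym_Int sym_rtrancl sym_Un_converse) (auto simp: sym_def)
  show "trans (free_eq A)"
    unfolding free_eq_def by (intro trans_Int trans_rtrancl) (auto simp: trans_def)
qed (auto simp: free_eq_def refl_on_def)

lemma free_eq_cancel:
  assumes "u \<in> words A" "x \<in> A <+> A" "v \<in> words A"
  shows "(u @ [x, inv_letter x] @ v, u @ v) \<in> free_eq A"
proof -
  have "(u @ [x, inv_letter x] @ v, u @ v) \<in> free_step A"
    unfolding free_step_def using assms by blast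
  then show ?thesis using assms by (auto simp: free_eq_def)
qed

lemma free_step_context:
  assumes "(u, v) \<in> free_step A" "s \<in> words A" "t \<in> words A"
  shows "(s @ u @ t, s @ v @ t) \<in> free_step A"
proof -
  obtain p x q where *: "u = p @ [x, inv_letter x] @ q" "v = p @ q"
    "p \<in> words A" "x \<in> A <+> A" "q \<in> words A"
    using assms(1) unfolding free_step_def by blast
  have "s @ u @ t = (s @ p) @ [x, inv_letter x] @ (q @ t)" "s @ v @ t = (s @ p) @ (q @ t)"
    using * by auto
  moreover have "s @ p \<in> words A" "q @ t \<in> words A" using * assms by auto
  ultimately show ?thesis unfolding free_step_def using *(4) by blast
qed

lemma free_eq_context:
  assumes "(u, v) \<in> free_eq A" "s \<in> words A" "t \<in> words A"
  shows "(s @ u @ t, s @ v @ t) \<in> free_eq A"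
proof -
  have "(u, v) \<in> (free_step A \<union> (free_step A)\<inverse>)\<^sup>*" "u \<in> words A" "v \<in> words A"
    using assms(1) by (auto simp: free_eq_def)
  from this(1) have "(s @ u @ t, s @ v @ t) \<in> (free_step A \<union> (free_step A)\<inverse>)\<^sup>*"
  proof induction
    case (step y z)
    then have "(s @ y @ t, s @ z @ t) \<in> free_step A \<union> (free_step A)\<inverse>"
      using free_step_context assms(2,3) by blast
    with step.IH show ?case by (rule rtrancl_into_rtrancl)
  qed simp
  then show ?thesis using \<open>u \<in> words A\<close> \<open>v \<in> words A\<close> assms by (auto simp: free_eq_def)
qed

lemma free_class_eq_iff:
  assumes "u \<in> words A" "v \<in> words A"
  shows "free_class A u = free_class A v \<longleftrightarrow> (u, v) \<in> free_eq A"
  unfolding free_class_def using eq_equiv_class_iff[OF equiv_free_eq assms] .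

lemma mem_free_class_iff: "v \<in> free_class A u \<longleftrightarrow> (u, v) \<in> free_eq A"
  by (simp add: free_class_def)

lemma carrier_free_group: "carrier (free_group A) = free_class A ` words A"
  by (auto simp: free_group_def quotient_def free_class_def)

lemma one_free_group: "\<one>\<^bsub>free_group A\<^esub> = free_class A []"
  by (simp add: free_group_def)

lemma mult_free_class:
  assumes "u \<in> words A" "v \<in> words A"
  shows "free_class A u \<otimes>\<^bsub>free_group A\<^esub> free_class A v = free_class A (u @ v)"
proof -
  have eq: "free_class A (u' @ v') = free_class A (u @ v)"
    if "u' \<in> free_class A u" "v' \<in> free_class A v" for u' v'
  proof -
    have e: "(u, u') \<in> free_eq A" "(v, v') \<in> free_eq A"
      using that by (auto simp: mem_free_class_iff)
    then have "u' \<in> words A" "v' \<in> words A" by (auto simp: free_eq_def)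
    then have "(u @ v, u' @ v) \<in> free_eq A" "(u' @ v, u' @ v') \<in> free_eq A"
      using free_eq_context[OF e(1), of "[]" v] free_eq_context[OF e(2), of u' "[]"] assms
      by auto
    then have "(u @ v, u' @ v') \<in> free_eq A"
      using equiv_free_eq[of A] by (meson equivE transE)
    then show ?thesis
      using \<open>u' \<in> words A\<close> \<open>v' \<in> words A\<close> assms free_class_eq_iff[of "u @ v" A "u' @ v'"]
      by auto
  qed
  have "u \<in> free_class A u" "v \<in> free_class A v"
    using assms by (auto simp: mem_free_class_iff free_eq_def)
  then have "(\<Union>u'\<in>free_class A u. \<Union>v'\<in>free_class A v. free_class A (u' @ v')) =
      free_class A (u @ v)"
    using eq by blast
  then show ?thesis by (simp add: free_group_def)
qed

lemma inv_word_left_cancel: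
  "u \<in> words A \<Longrightarrow> (inv_word u @ u, []) \<in> free_eq A"
proof (induction u)
  case Nil
  then show ?case by (simp add: inv_word_def free_eq_def)
next
  case (Cons x u)
  have "(inv_word u @ [inv_letter x, inv_letter (inv_letter x)] @ u, inv_word u @ u) \<in> free_eq A"
    using Cons.prems by (intro free_eq_cancel) auto
  moreover have "inv_word (x # u) @ x # u = inv_word u @ [inv_letter x, x] @ u"
    by (simp add: inv_word_def)
  ultimately show ?case using Cons equiv_free_eq[of A] by (auto elim!: equivE dest: transD)
qed

theorem group_free_group: "group (free_group A)"
proof (rule groupI)
  fix g assume "g \<in> carrier (free_group A)"
  then obtain u where u: "u \<in> words A" "g = free_class A u"
    by (auto simp: carrier_free_group)
  have "free_class A (inv_word u) \<otimes>\<^bsub>free_group A\<^esub> g = \<one>\<^bsub>free_group A\<^esub>"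
    using inv_word_left_cancel[OF u(1)] u
    by (simp add: mult_free_class one_free_group free_class_eq_iff)
  moreover have "free_class A (inv_word u) \<in> carrier (free_group A)"
    using u by (auto simp: carrier_free_group)
  ultimately show "\<exists>h\<in>carrier (free_group A). h \<otimes>\<^bsub>free_group A\<^esub> g = \<one>\<^bsub>free_group A\<^esub>"
    by blast
qed (auto simp: carrier_free_group mult_free_class one_free_group)

text \<open>Free reduction, used only to show that the reduced representative is unique.\<close>

definition push :: "'a letter \<Rightarrow> 'a word \<Rightarrow> 'a word" where
  "push x w = (case w of y # ys \<Rightarrow> if y = inv_letter x then ys else x # w | [] \<Rightarrow> [x])"

definition normalise :: "'a word \<Rightarrow> 'a word" where
  "normalise w = foldr push w []"

lemma reduced_Nil: "reduced []"
  by (simp add: reduced_def)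

lemma reduced_Cons_iff:
  "reduced (x # w) \<longleftrightarrow> reduced w \<and> (\<forall>y ys. w = y # ys \<longrightarrow> y \<noteq> inv_letter x)"
  (is "?l \<longleftrightarrow> ?r")
proof
  assume ?l
  have "\<not> (w = u @ [z, inv_letter z] @ v)" for u z v
    using \<open>?l\<close> unfolding reduced_def by (metis append_Cons)
  moreover have "y \<noteq> inv_letter x" if "w = y # ys" for y ys
    using \<open>?l\<close> that unfolding reduced_def by (metis append_Cons append_Nil)
  ultimately show ?r unfolding reduced_def by blast
next
  assume r: ?r
  show ?l unfolding reduced_def
  proof clarify
    fix u z v assume "x # w = u @ [z, inv_letter z] @ v"
    then show False using r unfolding reduced_def by (cases u) auto
  qed
qed

lemma reduced_push: "reduced w \<Longrightarrow> reduced (push x w)"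
  by (auto simp: push_def reduced_Cons_iff reduced_Nil split: list.split)

lemma push_push_inv: "reduced w \<Longrightarrow> push x (push (inv_letter x) w) = w"
  by (auto simp: push_def reduced_Cons_iff split: list.split)

lemma reduced_foldr_push: "reduced w \<Longrightarrow> reduced (foldr push u w)"
  by (induction u) (auto intro: reduced_push)

lemma normalise_reduced: "reduced w \<Longrightarrow> normalise w = w"
  by (induction w) (auto simp: normalise_def reduced_Cons_iff push_def split: list.split)

lemma normalise_free_step: "(u, v) \<in> free_step A \<Longrightarrow> normalise u = normalise v"
  unfolding free_step_def normalise_def
  by (force simp: push_push_inv[OF reduced_foldr_push[OF reduced_Nil]] simp del: inv_letter_simps)

lemma normalise_free_eq:
  assumes "(u, v) \<in> free_eq A" shows "normalise u = normalise v"
proof -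
  have "(u, v) \<in> (free_step A \<union> (free_step A)\<inverse>)\<^sup>*" using assms by (simp add: free_eq_def)
  then show ?thesis by induction (auto dest: normalise_free_step)
qed

lemma reduced_exists:
  "w \<in> words A \<Longrightarrow> \<exists>v. (w, v) \<in> free_eq A \<and> reduced v"
proof (induction w rule: length_induct)
  case (1 w)
  show ?case
  proof (cases "reduced w")
    case True
    then show ?thesis using 1 by (auto simp: free_eq_def)
  next
    case False
    then obtain u x v where w: "w = u @ [x, inv_letter x] @ v" unfolding reduced_def by blast
    have "length (u @ v) < length w" "u @ v \<in> words A" using w 1(2) by auto
    then obtain v' where v': "(u @ v, v') \<in> free_eq A" "reduced v'" using 1(1) by blast
    have "(w, u @ v) \<in> free_eq A" unfolding w using w 1(2) by (intro free_eq_cancel) auto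
    then have "(w, v') \<in> free_eq A" using v'(1) equiv_free_eq[of A] by (meson equivE transE)
    then show ?thesis using v' by blast
  qed
qed

theorem reduced_word_unique:
  assumes "g \<in> carrier (free_group A)"
  shows "\<exists>!w. w \<in> g \<and> reduced w"
proof -
  obtain u where u: "u \<in> words A" "g = free_class A u"
    using assms by (auto simp: carrier_free_group)
  show ?thesis
  proof (rule ex_ex1I)
    show "\<exists>w. w \<in> g \<and> reduced w"
      using reduced_exists[OF u(1)] by (simp add: u(2) mem_free_class_iff)
    show "w = w'" if "w \<in> g \<and> reduced w" "w' \<in> g \<and> reduced w'" for w w'
    proof -
      have "normalise u = normalise w" "normalise u = normalise w'"
        using that by (auto simp: u(2) mem_free_class_iff intro: normalise_free_eq)
      then show ?thesis using that by (simp add: normalise_reduced)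
    qed
  qed
qed


subsection \<open>Partial recursive functions\<close>

inductive_cases computesE:
  "computes Zero xs z" "computes Succ xs z" "computes (Proj i) xs z" "computes (Comp f gs) xs z"
  "computes (PrimRec f g) (0 # xs) z" "computes (PrimRec f g) (Suc n # xs) z" "computes (Mu f) xs z"

theorem computes_deterministic: "computes f xs y \<Longrightarrow> computes f xs z \<Longrightarrow> y = z"
proof (induction arbitrary: z rule: computes.induct)
  case (comp xs gs ys f w)
  from comp.prems obtain ys' where
    ys': "list_all2 (\<lambda>g. computes g xs) gs ys'" "computes f ys' z"
    by (rule computesE(4))
  have "ys = ys'"
  proof (rule nth_equalityI)
    show "length ys = length ys'"
      using comp.IH(1) ys'(1) by (simp add: list_all2_conv_all_nth)
    show "ys ! i = ys' ! i" if "i < length ys" for i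
      using comp.IH(1) ys'(1) that by (simp add: list_all2_conv_all_nth)
  qed
  then show ?case using comp.IH(2) ys'(2) by blast
next
  case (primrec_Suc f g n xs y w)
  from primrec_Suc.prems obtain y' where "computes (PrimRec f g) (n # xs) y'"
    "computes g (n # y' # xs) z"
    by (rule computesE(6))
  then show ?case using primrec_Suc.IH by blast
next
  case (mu f n xs)
  from mu.prems have z: "computes f (z # xs) 0" "\<forall>m<z. \<exists>y. computes f (m # xs) (Suc y)"
    by - (rule computesE(7), assumption+)+
  show ?case
  proof (rule linorder_cases[of n z])
    assume "n < z"
    then obtain y where "computes f (n # xs) (Suc y)" using z(2) by blast
    then show ?thesis using mu.IH(1) by blast
  next
    assume "z < n"
    then show ?thesis using mu.IH(2) z(1) by blast
  qed
next
  case (zero xs)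
  then show ?case by (rule computesE(1)) simp
next
  case (succ x)
  then show ?case by (rule computesE(2)) simp
next
  case (proj i xs)
  from proj.prems show ?case by (rule computesE(3)) simp
next
  case (primrec_0 f xs y g)
  from primrec_0.prems have "computes f xs z" by (rule computesE(5))
  then show ?case by (rule primrec_0.IH)
qed


subsection \<open>The coding of transducers\<close>

lemma inj_edge_code: "inj edge_code"
proof (rule injI, unfold split_paired_all)
  fix p q p' q' :: nat and a a' :: "nat letter" and w w' :: "nat word"
  assume "edge_code (p, a, w, q) = edge_code (p', a', w', q')"
  then have "p = p'" "sum_encode a = sum_encode a'"
    "map sum_encode w = map sum_encode w'" "q = q'"
    unfolding edge_code_def prod.case prod_encode_eq list_encode_eq prod.inject by blast+
  moreover have "w = w'"
    using inj_mapI[OF inj_sum_encode] \<open>map sum_encode w = map sum_encode w'\<close> by (rule injD)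
  ultimately show "(p, a, w, q) = (p', a', w', q')" by (simp add: sum_encode_eq)
qed

lemma finite_edges:
  assumes "finite A" "finite_transducer A T"
  shows "finite (edges T)"
proof -
  let ?f = "\<lambda>(p, a). (p, a, the (lambda T (p, a)), the (delta T (p, a)))"
  have "edges T \<subseteq> ?f ` (states T \<times> (A <+> A))"
  proof (rule subsetI, unfold split_paired_all)
    fix p a w q assume "(p, a, w, q) \<in> edges T"
    then have d: "delta T (p, a) = Some q" and l: "lambda T (p, a) = Some w"
      by (simp_all add: edges_def edge_def)
    then have "(p, a) \<in> states T \<times> (A <+> A)"
      using assms(2) unfolding finite_transducer_def by blast
    moreover have "(p, a, w, q) = ?f (p, a)" using d l by simp
    ultimately show "(p, a, w, q) \<in> ?f ` (states T \<times> (A <+> A))" by (rule rev_image_eqI)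
  qed
  moreover have "finite (states T \<times> (A <+> A))"
    using assms by (simp add: finite_transducer_def)
  ultimately show ?thesis by (meson finite_surj)
qed

lemma edges_eqD:
  assumes "dom (lambda T) = dom (delta T)" "dom (lambda T') = dom (delta T')" "edges T = edges T'"
  shows "delta T = delta T'" "lambda T = lambda T'"
proof -
  have e: "edge T p a w q \<longleftrightarrow> edge T' p a w q" for p a w q
  proof -
    have "(p, a, w, q) \<in> edges T \<longleftrightarrow> (p, a, w, q) \<in> edges T'" using assms(3) by simp
    then show ?thesis by (simp add: edges_def)
  qed
  have "delta T (p, a) = delta T' (p, a) \<and> lambda T (p, a) = lambda T' (p, a)" for p a
  proof (cases "(p, a) \<in> dom (delta T)")
    case True
    then obtain w q where "edge T p a w q" using assms(1) by (fastforce simp: edge_def)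
    then show ?thesis using e[of p a w q] by (auto simp: edge_def)
  next
    case False
    have "(p, a) \<notin> dom (delta T')"
    proof
      assume "(p, a) \<in> dom (delta T')"
      then obtain w q where "edge T' p a w q" using assms(2) by (fastforce simp: edge_def)
      then show False using e[of p a w q] False by (auto simp: edge_def)
    qed
    then show ?thesis using False assms(1,2) by (metis domIff)
  qed
  then show "delta T = delta T'" "lambda T = lambda T'" by auto
qed

theorem inj_on_transducer_code: "inj_on transducer_code inverse_transducers"
proof (rule inj_onI, clarify)
  fix A A' :: "nat set" and T T' :: "(nat, nat) transducer"
  assume mem: "(A, T) \<in> inverse_transducers" "(A', T') \<in> inverse_transducers"
    and eq: "transducer_code (A, T) = transducer_code (A', T')"
  have fin: "finite A" "finite A'" "finite (states T)" "finite (states T')"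
    "finite (edge_code ` edges T)" "finite (edge_code ` edges T')"
    using mem finite_edges by (auto simp: inverse_transducers_def finite_transducer_def)
  have "set_encode A = set_encode A'" "set_encode (states T) = set_encode (states T')"
    "initial T = initial T'"
    "set_encode (edge_code ` edges T) = set_encode (edge_code ` edges T')"
    using eq by (auto simp: transducer_code_def)
  then have *: "A = A'" "states T = states T'" "initial T = initial T'"
    "edge_code ` edges T = edge_code ` edges T'"
    using fin by (auto simp: set_encode_eq)
  then have "edges T = edges T'" using inj_edge_code by (simp add: inj_image_eq_iff)
  then have "delta T = delta T'" "lambda T = lambda T'"
    using mem edges_eqD[of T T'] by (auto simp: inverse_transducers_def finite_transducer_def)
  then show "A = A' \<and> T = T'" using * by simp
qed

end

theory Submission
  imports Defs "HOL-Computational_Algebra.Primes" "HOL-Library.Infinite_Set"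
begin

text \<open>A register program is simulated by a finite-state machine on one number \<open>N\<close>, which branches on
  residues of \<open>N\<close> and rescales it; registers are exponents of primes. A transducer reads the run
  \<open>s c\<^bsup>N\<^sub>0\<^esup> m\<^sub>0 c\<^bsup>N\<^sub>1\<^esup> m\<^sub>1 \<dots>\<close> of such a machine, where the marker \<open>m\<^sub>i\<close> names the state at time \<open>i\<close>, and outputs it one
  step ahead: from \<open>c\<^bsup>N\<^esup> m\<close> it produces the next block. Only the letter \<open>s\<close>, read first, outputs an
  extra marker, and only the halting edge, which leads to a dead end, outputs none. Thus a
  halting run is a fixed point.

  Conversely, consider a nontrivial fixed point \<open>w\<close>, read along a path from the initial state, and
  count the markers in \<open>w\<close> and in the unreduced output. Cancellation removes markers in pairs. If the
  path ends in an ordinary state, the output has one marker too many, which is impossible. If it ends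
  in the dead end, the counts agree, so no markers cancel and \<open>w\<close> is a halting run. If it returns to
  the initial state, then \<open>w = s v s\<^sup>-\<^sup>1\<close> and exactly one pair of markers cancels; \<open>v\<close> consists of
  a run followed by an inverse run, both ending in the same configuration. A power of two in \<open>N\<close> serves
  as a clock, so both runs are equal and \<open>w\<close> is not reduced.

  Undecidability follows by diagonalisation: the program which halts on input \<open>e\<close> iff the decision
  procedure rejects the transducer of the program \<open>e\<close> on input \<open>e\<close> is run on its own code.\<close>

section \<open>Words over one counting letter and markers\<close>

text \<open>An inverse transducer must be deterministic in both directions: the target and the
  letter of an edge have to determine its source. The markers do most of this work, because the
  marker that is read names the state being left. So the program itself may be irreversible, and
  only two residues of one state can collide. This is why the loop test of a program is split: the
  residue is first stored in the control state, and only then is the number divided or kept.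

  Letters \<open>c\<close> cancel freely inside a block, so words are compared only by their markers
  and the exponents between them.

  That the two halves of a returning path end in the same configuration does not yet make them
  equal: a run that cycles reaches one configuration at several times. The clock excludes this.

  The diagonalisation uses no universal function and no coding of programs. A program enters only
  through the finite edge set made from it, and the canonical index of this set serves as its code.
  The input affects a single edge and its inverse, so the code of the transducer is obtained from
  \<open>e\<close> by elementary arithmetic.\<close>

definition letter_exp :: "nat letter \<Rightarrow> int" where
  "letter_exp x = (if x = Inl 0 then 1 else if x = Inr 0 then -1 else 0)"

definition marker :: "nat letter \<Rightarrow> bool" where
  "marker x \<longleftrightarrow> x \<noteq> Inl 0 \<and> x \<noteq> Inr 0"

primrec weight :: "nat word \<Rightarrow> nat" where
  "weight [] = 0"
| "weight (x # u) = (if marker x then Suc (weight u) else weight u)"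

primrec total_exp :: "nat word \<Rightarrow> int" where
  "total_exp [] = 0"
| "total_exp (x # u) = letter_exp x + total_exp u"

text \<open>A word \<open>c\<^bsup>k\<^sub>1\<^esup> m\<^sub>1 \<dots> c\<^bsup>k\<^sub>n\<^esup> m\<^sub>n c\<^bsup>k\<^esup>\<close> with markers \<open>m\<^sub>i\<close> is split into the list of the pairs
  \<open>(k\<^sub>i, m\<^sub>i)\<close> and the last exponent \<open>k\<close>; the first argument is an exponent already read.\<close>

primrec blocks :: "int \<Rightarrow> nat word \<Rightarrow> (int \<times> nat letter) list" where
  "blocks k [] = []"
| "blocks k (x # u) =
    (if marker x then (k, x) # blocks 0 u else blocks (k + letter_exp x) u)"

primrec block_tail :: "int \<Rightarrow> nat word \<Rightarrow> int" where
  "block_tail k [] = k"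
| "block_tail k (x # u) = (if marker x then block_tail 0 u else block_tail (k + letter_exp x) u)"

section \<open>Elementary rules for markers, exponents and blocks\<close>

lemma inv_word_simps [simp]:
  "inv_word [] = []" "inv_word (x # u) = inv_word u @ [inv_letter x]"
  "inv_word (u @ v) = inv_word v @ inv_word u"
  by (simp_all add: inv_word_def)

lemma inv_word_inv_word [simp]: "inv_word (inv_word u) = u"
  by (induction u) auto

lemma inv_word_replicate [simp]: "inv_word (replicate n x) = replicate n (inv_letter x)"
  by (simp add: inv_word_def)

lemma marker_inv_letter [simp]: "marker (inv_letter x) \<longleftrightarrow> marker x"
  by (cases x) (auto simp: marker_def)

lemma marker_simps [simp]: "marker (Inl a) \<longleftrightarrow> a \<noteq> 0" "marker (Inr a) \<longleftrightarrow> a \<noteq> 0"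
  by (auto simp: marker_def)

lemma letter_exp_simps [simp]:
  "letter_exp (Inl 0) = 1" "letter_exp (Inr 0) = -1" "marker x \<Longrightarrow> letter_exp x = 0"
  by (auto simp: letter_exp_def marker_def)

lemma letter_exp_inv_letter [simp]: "letter_exp (inv_letter x) = - letter_exp x"
  by (cases x) (auto simp: letter_exp_def)

lemma weight_append [simp]: "weight (u @ v) = weight u + weight v"
  by (induction u) auto

lemma weight_inv_word [simp]: "weight (inv_word u) = weight u"
  by (induction u) auto

lemma total_exp_append [simp]: "total_exp (u @ v) = total_exp u + total_exp v"
  by (induction u) auto

lemma total_exp_inv_word [simp]: "total_exp (inv_word u) = - total_exp u"
  by (induction u) auto

lemma weight_replicate [simp]: "weight (replicate n (Inl 0)) = 0" "weight (replicate n (Inr 0)) = 0"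
  by (induction n) auto

lemma total_exp_replicate [simp]:
  "total_exp (replicate n (Inl 0)) = int n" "total_exp (replicate n (Inr 0)) = - int n"
  by (induction n) auto

lemma blocks_append [simp]: "blocks k (u @ v) = blocks k u @ blocks (block_tail k u) v"
  by (induction u arbitrary: k) auto

lemma block_tail_append [simp]: "block_tail k (u @ v) = block_tail (block_tail k u) v"
  by (induction u arbitrary: k) auto

lemma length_blocks [simp]: "length (blocks k u) = weight u"
  by (induction u arbitrary: k) auto

lemma blocks_weight_0 [simp]: "weight u = 0 \<Longrightarrow> blocks k u = []"
  by (metis length_blocks length_0_conv)

lemma block_tail_weight_0 [simp]: "weight u = 0 \<Longrightarrow> block_tail k u = k + total_exp u"
  by (induction u arbitrary: k) (auto split: if_splits)

lemma total_exp_blocks: "k + total_exp u = sum_list (map fst (blocks k u)) + block_tail k u"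
proof (induction u arbitrary: k)
  case (Cons x u)
  show ?case using Cons[of 0] Cons[of "k + letter_exp x"] by auto
qed simp

text \<open>The cut is made directly behind a marker (or at the very beginning), so that
  \<open>block_tail 0 v1 = 0\<close> and a path reading \<open>v1\<close> stops at a block
  boundary.\<close>

lemma weight_split:
  assumes "i \<le> weight v"
  obtains v1 v2 where "v = v1 @ v2" "weight v1 = i" "v1 = [] \<or> marker (last v1)"
proof -
  have "\<exists>v1 v2. v = v1 @ v2 \<and> weight v1 = i \<and> (v1 = [] \<or> marker (last v1))"
    using assms
  proof (induction v rule: rev_induct)
    case (snoc x v)
    show ?case
    proof (cases "i \<le> weight v")
      case True
      then show ?thesis using snoc.IH by (metis append.assoc)
    next
      case False
      then have "marker x" "i = Suc (weight v)" using snoc.prems by (auto split: if_splits)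
      then show ?thesis by (intro exI[of _ "v @ [x]"] exI[of _ "[]"]) auto
    qed
  qed simp
  then show thesis using that by blast
qed

lemma weight_0_split_marker:
  assumes "0 < weight v"
  obtains v0 x v2 where "v = v0 @ x # v2" "weight v0 = 0" "marker x"
proof -
  have "\<exists>v0 x v2. v = v0 @ x # v2 \<and> weight v0 = 0 \<and> marker x"
    using assms
  proof (induction v)
    case (Cons y v)
    show ?case
    proof (cases "marker y")
      case True
      then show ?thesis by (intro exI[of _ "[]"]) auto
    next
      case False
      then obtain v0 x v2 where "v = v0 @ x # v2" "weight v0 = 0" "marker x"
        using Cons by auto
      then show ?thesis using False by (intro exI[of _ "y # v0"]) auto
    qed
  qed simp
  then show thesis using that by blast
qed


subsection \<open>Reduced words\<close>

lemma reduced_appendD: "reduced (u @ v) \<Longrightarrow> reduced u" "reduced (u @ v) \<Longrightarrow> reduced v"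
proof -
  assume "reduced (u @ v)"
  then have no: "u @ v \<noteq> a @ [x, inv_letter x] @ b" for a x b by (auto simp: reduced_def)
  have "u \<noteq> a @ [x, inv_letter x] @ b" for a x b using no[of a x "b @ v"] by auto
  then show "reduced u" by (auto simp: reduced_def)
  have "v \<noteq> a @ [x, inv_letter x] @ b" for a x b using no[of "u @ a" x b] by auto
  then show "reduced v" by (auto simp: reduced_def)
qed

lemma not_reduced [simp]: "\<not> reduced (u @ x # inv_letter x # v)"
  by (auto simp: reduced_def)

lemma reduced_inv_word [simp]: "reduced (inv_word u) \<longleftrightarrow> reduced u"
proof -
  have "\<not> reduced (inv_word u)" if r: "\<not> reduced u" for u :: "'a word"
  proof -
    obtain p x q where "u = p @ [x, inv_letter x] @ q" using r unfolding reduced_def by blast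
    then have "inv_word u = inv_word q @ [x, inv_letter x] @ inv_word p" by simp
    then show ?thesis unfolding reduced_def by blast
  qed
  from this[of u] this[of "inv_word u"] show ?thesis by auto
qed

definition power_word :: "int \<Rightarrow> nat word" where
  "power_word k = replicate (nat \<bar>k\<bar>) (if k \<ge> 0 then Inl 0 else Inr 0)"

lemma power_word_0 [simp]: "power_word 0 = []"
  by (simp add: power_word_def)

lemma power_word_snoc: "k \<ge> 0 \<Longrightarrow> power_word k @ [Inl 0] = power_word (k + 1)"
  "k \<le> 0 \<Longrightarrow> power_word k @ [Inr 0] = power_word (k - 1)"
proof -
  show "power_word k @ [Inl 0] = power_word (k + 1)" if "k \<ge> 0"
  proof -
    have "nat (k + 1) = Suc (nat k)" using that by simp
    then show ?thesis using that by (simp add: power_word_def replicate_append_same)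
  qed
  show "power_word k @ [Inr 0] = power_word (k - 1)" if "k \<le> 0"
  proof -
    have "nat \<bar>k - 1\<bar> = Suc (nat \<bar>k\<bar>)" using that by simp
    then show ?thesis using that by (cases "k = 0") (simp_all add: power_word_def replicate_append_same)
  qed
qed

lemma power_word_snoc_not_reduced:
  "k < 0 \<Longrightarrow> \<not> reduced (power_word k @ Inl 0 # u)" "k > 0 \<Longrightarrow> \<not> reduced (power_word k @ Inr 0 # u)"
proof -
  have *: "replicate n x @ y # u = replicate (n - 1) x @ x # y # u" if "n > 0" for n and x y :: "nat letter"
  proof -
    have "replicate n x = replicate (n - 1) x @ [x]"
      using that by (metis Suc_pred' replicate_Suc replicate_append_same)
    then show ?thesis by simp
  qed
  show "\<not> reduced (power_word k @ Inl 0 # u)" if "k < 0"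
    using that *[of "nat \<bar>k\<bar>" "Inr 0" "Inl 0"] not_reduced[of _ "Inr 0" u]
    by (simp add: power_word_def)
  show "\<not> reduced (power_word k @ Inr 0 # u)" if "k > 0"
    using that *[of "nat \<bar>k\<bar>" "Inl 0" "Inr 0"] not_reduced[of _ "Inl 0" u]
    by (simp add: power_word_def)
qed

primrec word_of_blocks :: "(int \<times> nat letter) list \<Rightarrow> int \<Rightarrow> nat word" where
  "word_of_blocks [] e = power_word e"
| "word_of_blocks (b # l) e = power_word (fst b) @ snd b # word_of_blocks l e"

text \<open>In a reduced word all counting letters between two markers have the same sign, so their
  exponent determines them.\<close>

lemma reduced_word_of_blocks:
  "reduced (power_word k @ u) \<Longrightarrow> power_word k @ u = word_of_blocks (blocks k u) (block_tail k u)"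
proof (induction u arbitrary: k)
  case (Cons x u)
  show ?case
  proof (cases "marker x")
    case True
    have "reduced u" using Cons.prems reduced_appendD(2)[of "power_word k @ [x]" u] by simp
    then show ?thesis using True Cons.IH[of 0] by simp
  next
    case False
    then have "power_word k @ [x] = power_word (k + letter_exp x)"
      using Cons.prems power_word_snoc[of k] power_word_snoc_not_reduced[of k u]
      by (cases x; cases "k < 0"; cases "k > 0") (auto simp: letter_exp_def)
    then have eq: "power_word k @ x # u = power_word (k + letter_exp x) @ u"
      by (metis append.assoc append_Cons append_Nil)
    show ?thesis using False Cons.IH[of "k + letter_exp x"] Cons.prems by (simp add: eq)
  qed
qed simp

lemma reduced_blocks_inj:
  assumes "reduced u" "reduced v" "blocks 0 u = blocks 0 v" "block_tail 0 u = block_tail 0 v"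
  shows "u = v"
  using assms reduced_word_of_blocks[of 0 u] reduced_word_of_blocks[of 0 v] by simp

lemma positive_reduced: "u \<in> lists (range Inl) \<Longrightarrow> reduced u"
  by (induction u) (auto simp: reduced_Nil reduced_Cons_iff)


subsection \<open>Free reduction and markers\<close>

text \<open>Equality up to cancellation of counting letters. The clauses on inverse words make the
  relation closed under inversion at once, so that an argument about the first part of a path can be
  applied to the inverse path.\<close>

definition same_blocks :: "nat word \<Rightarrow> nat word \<Rightarrow> bool" where
  "same_blocks u v \<longleftrightarrow> blocks 0 u = blocks 0 v \<and> block_tail 0 u = block_tail 0 v \<and>
     blocks 0 (inv_word u) = blocks 0 (inv_word v) \<and>
     block_tail 0 (inv_word u) = block_tail 0 (inv_word v)"

lemma same_blocks_refl [simp]: "same_blocks u u"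
  by (simp add: same_blocks_def)

lemma same_blocks_trans: "same_blocks u v \<Longrightarrow> same_blocks v w \<Longrightarrow> same_blocks u w"
  by (simp add: same_blocks_def)

lemma same_blocks_inv_word: "same_blocks u v \<Longrightarrow> same_blocks (inv_word u) (inv_word v)"
  by (simp add: same_blocks_def)

lemma same_blocks_total_exp: "same_blocks u v \<Longrightarrow> total_exp u = total_exp v"
  using total_exp_blocks[of 0 u] total_exp_blocks[of 0 v] by (simp add: same_blocks_def)

lemma same_blocks_weight: "same_blocks u v \<Longrightarrow> weight u = weight v"
  unfolding same_blocks_def by (metis length_blocks)

lemma same_blocks_cancel: "\<not> marker x \<Longrightarrow> same_blocks (u @ [x, inv_letter x] @ v) (u @ v)"
  by (simp add: same_blocks_def)

text \<open>Cancelling a counting pair keeps all blocks, cancelling a marker pair lowers the weight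
  by 2. If the weight drops by 2 in total, a single marker pair has cancelled; the counting
  cancellations before and after it are absorbed by \<open>same_blocks\<close>.\<close>

lemma free_step_blocks:
  assumes "(u, v) \<in> (free_step A)\<^sup>*"
  shows "weight v \<le> weight u \<and> even (weight u + weight v) \<and>
    (weight u = weight v \<longrightarrow> same_blocks u v) \<and>
    (weight u = weight v + 2 \<longrightarrow> (\<exists>a x b. marker x \<and>
       same_blocks u (a @ [x, inv_letter x] @ b) \<and> same_blocks v (a @ b)))"
  using assms
proof (induction rule: rtrancl_induct)
  case (step y z)
  obtain a x b where yz: "y = a @ [x, inv_letter x] @ b" "z = a @ b"
    using step.hyps(2) unfolding free_step_def by blast
  show ?case
  proof (cases "marker x")
    case True
    then have w: "weight y = weight z + 2" by (simp add: yz)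
    have "\<exists>a x b. marker x \<and> same_blocks u (a @ [x, inv_letter x] @ b) \<and> same_blocks z (a @ b)"
      if "weight u = weight z + 2"
    proof -
      have "same_blocks u y" using step.IH w that by simp
      then show ?thesis using True yz same_blocks_refl by blast
    qed
    then show ?thesis using step.IH w by auto
  next
    case False
    then have "same_blocks y z" using same_blocks_cancel yz by blast
    moreover from this have "weight y = weight z" by (rule same_blocks_weight)
    moreover have "same_blocks z y" using \<open>same_blocks y z\<close> by (simp add: same_blocks_def)
    ultimately show ?thesis
      using step.IH same_blocks_trans[of u y z] same_blocks_trans[of z y] by auto
  qed
qed auto

text \<open>\<open>free_eq\<close> also allows insertions, which would spoil the count of markers. A
  reduced word is reached from every equivalent word by cancellations alone, because
  \<open>normalise\<close> is constant on classes and fixes reduced words.\<close>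

lemma free_eq_imp_free_step:
  assumes "(u, v) \<in> free_eq A" "reduced v"
  shows "(u, v) \<in> (free_step A)\<^sup>*"
proof -
  have ex: "\<exists>v. (w, v) \<in> (free_step A)\<^sup>* \<and> reduced v" if "w \<in> words A" for w
    using that
  proof (induction w rule: length_induct)
    case (1 w)
    show ?case
    proof (cases "reduced w")
      case False
      then obtain a x b where w: "w = a @ [x, inv_letter x] @ b" unfolding reduced_def by blast
      moreover from this have "a \<in> words A" "x \<in> A <+> A" "b \<in> words A" using 1(2) by auto
      ultimately have "(w, a @ b) \<in> free_step A" unfolding free_step_def by blast
      moreover have "length (a @ b) < length w" "a @ b \<in> words A" using w 1(2) by auto
      ultimately show ?thesis using 1(1) by (meson converse_rtrancl_into_rtrancl)
    qed blast
  qed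
  have "u \<in> words A" using assms(1) by (simp add: free_eq_def)
  then obtain w where w: "(u, w) \<in> (free_step A)\<^sup>*" "reduced w" using ex by blast
  have "normalise u = normalise w"
    using w(1) by (induction rule: rtrancl_induct) (auto dest: normalise_free_step)
  moreover have "normalise u = normalise v" by (rule normalise_free_eq[OF assms(1)])
  ultimately have "w = v" using w(2) assms(2) by (simp add: normalise_reduced)
  then show ?thesis using w(1) by simp
qed


section \<open>Transducers given by edge sets\<close>

type_synonym ('a, 'q) edge_set = "('q \<times> 'a letter \<times> 'a word \<times> 'q) set"

inductive path :: "('a, 'q) edge_set \<Rightarrow> 'q \<Rightarrow> 'a word \<Rightarrow> 'a word \<Rightarrow> 'q \<Rightarrow> bool" for G where
  path_Nil: "path G p [] [] p"
| path_Cons: "(p, x, U, q) \<in> G \<Longrightarrow> path G q w V r \<Longrightarrow> path G p (x # w) (U @ V) r"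

lemma path_Nil_iff [simp]: "path G p [] V r \<longleftrightarrow> V = [] \<and> r = p"
  by (auto intro: path_Nil elim: path.cases)

inductive_cases path_ConsE: "path G p (x # w) V r"

lemma path_Cons_iff:
  "path G p (x # w) V r \<longleftrightarrow> (\<exists>U q W. (p, x, U, q) \<in> G \<and> path G q w W r \<and> V = U @ W)"
  by (auto intro: path_Cons elim!: path_ConsE)

lemma path_append_iff:
  "path G p (u @ v) V r \<longleftrightarrow> (\<exists>U W q. path G p u U q \<and> path G q v W r \<and> V = U @ W)"
proof (induction u arbitrary: p V)
  case (Cons x u)
  show ?case
  proof
    assume "path G p ((x # u) @ v) V r"
    then obtain U q W where e: "(p, x, U, q) \<in> G" "path G q (u @ v) W r" "V = U @ W"
      by (auto simp: path_Cons_iff)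
    from e(2) obtain U' W' q' where "path G q u U' q'" "path G q' v W' r" "W = U' @ W'"
      unfolding Cons.IH by blast
    then have "path G p (x # u) (U @ U') q'" "path G q' v W' r" "V = (U @ U') @ W'"
      using e by (auto intro: path_Cons)
    then show "\<exists>U W q. path G p (x # u) U q \<and> path G q v W r \<and> V = U @ W" by blast
  next
    assume "\<exists>U W q. path G p (x # u) U q \<and> path G q v W r \<and> V = U @ W"
    then obtain U W q where e: "path G p (x # u) U q" "path G q v W r" "V = U @ W" by blast
    then obtain U1 U2 q1 where e': "(p, x, U1, q1) \<in> G" "path G q1 u U2 q" "U = U1 @ U2"
      by (auto simp: path_Cons_iff)
    then have "path G q1 (u @ v) (U2 @ W) r" using e(2) Cons.IH by blast
    then show "path G p ((x # u) @ v) V r" using e' e(3) path_Cons by fastforce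
  qed
qed simp

lemma path_append: "path G p u U q \<Longrightarrow> path G q v V r \<Longrightarrow> path G p (u @ v) (U @ V) r"
  by (auto simp: path_append_iff)

lemma path_single: "(p, x, U, q) \<in> G \<Longrightarrow> path G p [x] U q"
  by (auto simp: path_Cons_iff)

definition symmetric_edges :: "('a, 'q) edge_set \<Rightarrow> bool" where
  "symmetric_edges G \<longleftrightarrow> (\<forall>p x U q. (p, x, U, q) \<in> G \<longrightarrow> (q, inv_letter x, inv_word U, p) \<in> G)"

definition deterministic_edges :: "('a, 'q) edge_set \<Rightarrow> bool" where
  "deterministic_edges G \<longleftrightarrow> (\<forall>p x U q U' q'. (p, x, U, q) \<in> G \<longrightarrow> (p, x, U', q') \<in> G \<longrightarrow>
     U = U' \<and> q = q')"

lemma path_inv_word: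
  assumes "path G p u U q" "symmetric_edges G"
  shows "path G q (inv_word u) (inv_word U) p"
  using assms(1)
proof (induction rule: path.induct)
  case (path_Cons p x U q w V r)
  then have "path G q [inv_letter x] (inv_word U) p"
    using assms(2) by (intro path_single) (auto simp: symmetric_edges_def)
  then show ?case using path_append[OF path_Cons.IH] by simp
qed simp

definition symmetric_closure :: "('q \<times> 'a \<times> 'a word \<times> 'q) set \<Rightarrow> ('a, 'q) edge_set" where
  "symmetric_closure F = (\<lambda>(p, a, U, q). (p, Inl a, U, q)) ` F \<union>
     (\<lambda>(p, a, U, q). (q, Inr a, inv_word U, p)) ` F"

lemma symmetric_closure_Inl [simp]: "(p, Inl a, U, q) \<in> symmetric_closure F \<longleftrightarrow> (p, a, U, q) \<in> F"
  by (force simp: symmetric_closure_def)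

lemma symmetric_closure_Inr [simp]:
  "(p, Inr a, U, q) \<in> symmetric_closure F \<longleftrightarrow> (q, a, inv_word U, p) \<in> F"
  by (force simp: symmetric_closure_def)

lemma symmetric_symmetric_closure: "symmetric_edges (symmetric_closure F)"
  unfolding symmetric_edges_def
proof (intro allI impI)
  fix p x U q assume "(p, x, U, q) \<in> symmetric_closure F"
  then show "(q, inv_letter x, inv_word U, p) \<in> symmetric_closure F" by (cases x) auto
qed

text \<open>Inverse edges run from target to source, so determinism on inverse letters is the second
  assumption: target and letter fix output and source.\<close>

lemma deterministic_symmetric_closure:
  assumes "\<And>p a U q U' q'. (p, a, U, q) \<in> F \<Longrightarrow> (p, a, U', q') \<in> F \<Longrightarrow> U = U' \<and> q = q'"
    and "\<And>p a U q U' p'. (p, a, U, q) \<in> F \<Longrightarrow> (p', a, U', q) \<in> F \<Longrightarrow> U = U' \<and> p = p'"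
  shows "deterministic_edges (symmetric_closure F)"
  unfolding deterministic_edges_def
proof (intro allI impI)
  fix p x U q U' q'
  assume "(p, x, U, q) \<in> symmetric_closure F" "(p, x, U', q') \<in> symmetric_closure F"
  then show "U = U' \<and> q = q'"
  proof (cases x)
    case (Inl a)
    then show ?thesis
      using \<open>(p, x, U, q) \<in> _\<close> \<open>(p, x, U', q') \<in> _\<close> assms(1)[of p a U q U' q'] by simp
  next
    case (Inr a)
    then have "inv_word U = inv_word U' \<and> q = q'"
      using \<open>(p, x, U, q) \<in> _\<close> \<open>(p, x, U', q') \<in> _\<close>
        assms(2)[of q a "inv_word U" p q' "inv_word U'"] by simp
    then show ?thesis using inv_word_inv_word by metis
  qed
qed

definition edge_transducer :: "'q set \<Rightarrow> 'q \<Rightarrow> ('a, 'q) edge_set \<Rightarrow> ('a, 'q) transducer" where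
  "edge_transducer S i G = \<lparr>states = S, initial = i,
     delta = (\<lambda>(p, x). if \<exists>U q. (p, x, U, q) \<in> G then Some (SOME q. \<exists>U. (p, x, U, q) \<in> G) else None),
     lambda = (\<lambda>(p, x). if \<exists>U q. (p, x, U, q) \<in> G then Some (SOME U. \<exists>q. (p, x, U, q) \<in> G) else None)\<rparr>"

lemma edge_transducer_simps [simp]:
  "states (edge_transducer S i G) = S" "initial (edge_transducer S i G) = i"
  by (simp_all add: edge_transducer_def)

context
  fixes S :: "'q set" and i :: 'q and G :: "('a, 'q) edge_set"
  assumes det: "deterministic_edges G"
begin

lemma delta_lambda_edge:
  assumes "(p, x, U, q) \<in> G"
  shows "delta (edge_transducer S i G) (p, x) = Some q"
    "lambda (edge_transducer S i G) (p, x) = Some U"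
proof -
  have *: "(\<exists>U. (p, x, U, q') \<in> G) \<longleftrightarrow> q' = q" "(\<exists>q. (p, x, U', q) \<in> G) \<longleftrightarrow> U' = U" for q' U'
    using det assms unfolding deterministic_edges_def by blast+
  have "\<exists>U q. (p, x, U, q) \<in> G" using assms by blast
  then show "delta (edge_transducer S i G) (p, x) = Some q"
    "lambda (edge_transducer S i G) (p, x) = Some U"
    by (simp_all add: edge_transducer_def *)
qed

lemma delta_lambda_no_edge:
  assumes "\<nexists>U q. (p, x, U, q) \<in> G"
  shows "delta (edge_transducer S i G) (p, x) = None" "lambda (edge_transducer S i G) (p, x) = None"
  using assms by (simp_all add: edge_transducer_def)

lemma edge_edge_transducer: "edge (edge_transducer S i G) p x U q \<longleftrightarrow> (p, x, U, q) \<in> G"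
proof
  assume e: "edge (edge_transducer S i G) p x U q"
  show "(p, x, U, q) \<in> G"
  proof (cases "\<exists>U q. (p, x, U, q) \<in> G")
    case True
    then obtain U' q' where "(p, x, U', q') \<in> G" by blast
    then show ?thesis using e delta_lambda_edge[of p x U' q'] by (auto simp: edge_def)
  next
    case False
    then show ?thesis using e delta_lambda_no_edge[of p x] by (auto simp: edge_def)
  qed
qed (simp add: edge_def delta_lambda_edge)

lemma edges_edge_transducer: "edges (edge_transducer S i G) = G"
  by (auto simp: edges_def edge_edge_transducer)

lemma inverse_edge_transducer:
  assumes "symmetric_edges G" shows "inverse_transducer (edge_transducer S i G)"
proof -
  have "(p, x, U, q) \<in> G \<longleftrightarrow> (q, inv_letter x, inv_word U, p) \<in> G" for p x U q
    using assms unfolding symmetric_edges_def by (metis inv_letter_inv_letter inv_word_inv_word)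
  then show ?thesis by (simp add: inverse_transducer_def edge_edge_transducer)
qed

lemma finite_edge_transducer:
  assumes "finite S" "i \<in> S"
    "\<And>p x U q. (p, x, U, q) \<in> G \<Longrightarrow> p \<in> S \<and> x \<in> A <+> A \<and> U \<in> words A \<and> q \<in> S"
  shows "finite_transducer A (edge_transducer S i G)"
proof -
  have *: "(delta (edge_transducer S i G) px = Some q \<longrightarrow> (\<exists>U. (fst px, snd px, U, q) \<in> G)) \<and>
     (lambda (edge_transducer S i G) px = Some U \<longrightarrow> (\<exists>q. (fst px, snd px, U, q) \<in> G)) \<and>
     (delta (edge_transducer S i G) px = None \<longleftrightarrow> lambda (edge_transducer S i G) px = None)"
    for px q U
  proof (cases "\<exists>U q. (fst px, snd px, U, q) \<in> G")
    case True
    then obtain U' q' where "(fst px, snd px, U', q') \<in> G" by blast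
    then show ?thesis using delta_lambda_edge[of "fst px" "snd px" U' q'] by auto
  next
    case False
    then show ?thesis using delta_lambda_no_edge[of "fst px" "snd px"] by auto
  qed
  have "dom (lambda (edge_transducer S i G)) = dom (delta (edge_transducer S i G))"
    using * by (simp only: set_eq_iff domIff) blast
  moreover have "dom (delta (edge_transducer S i G)) \<subseteq> S \<times> (A <+> A)"
  proof
    fix px assume "px \<in> dom (delta (edge_transducer S i G))"
    then obtain U q where "(fst px, snd px, U, q) \<in> G" using * by blast
    then have "fst px \<in> S \<and> snd px \<in> A <+> A" using assms(3) by blast
    then show "px \<in> S \<times> (A <+> A)" by (cases px) simp
  qed
  moreover have "ran (delta (edge_transducer S i G)) \<subseteq> S"
  proof
    fix q assume "q \<in> ran (delta (edge_transducer S i G))"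
    then obtain px where "delta (edge_transducer S i G) px = Some q" by (auto simp: ran_def)
    then show "q \<in> S" using * assms(3) by blast
  qed
  moreover have "ran (lambda (edge_transducer S i G)) \<subseteq> words A"
  proof
    fix U assume "U \<in> ran (lambda (edge_transducer S i G))"
    then obtain px where "lambda (edge_transducer S i G) px = Some U" by (auto simp: ran_def)
    then show "U \<in> words A" using * assms(3) by blast
  qed
  ultimately show ?thesis using assms(1,2) by (simp add: finite_transducer_def)
qed

lemma path_edge_transducer:
  "path G p w V q \<longleftrightarrow> delta_word (edge_transducer S i G) p w = Some q \<and>
     lambda_word (edge_transducer S i G) p w = Some V"
proof (induction w arbitrary: p V)
  case (Cons x w)
  show ?case
  proof (cases "\<exists>U r. (p, x, U, r) \<in> G")
    case True
    then obtain U r where e: "(p, x, U, r) \<in> G" by blast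
    then have "(p, x, U', r') \<in> G \<longleftrightarrow> U' = U \<and> r' = r" for U' r'
      using det unfolding deterministic_edges_def by blast
    then have "path G p (x # w) V q \<longleftrightarrow> (\<exists>W. path G r w W q \<and> V = U @ W)"
      by (simp add: path_Cons_iff)
    then show ?thesis by (auto simp: Cons.IH delta_lambda_edge[OF e] bind_eq_Some_conv)
  next
    case False
    then show ?thesis using delta_lambda_no_edge[OF False] by (auto simp: path_Cons_iff)
  qed
qed auto

lemma readable_edge_transducer:
  "readable (edge_transducer S i G) p w \<longleftrightarrow> (\<exists>V q. path G p w V q)"
proof (induction w arbitrary: p)
  case (Cons x w)
  show ?case
  proof (cases "\<exists>U r. (p, x, U, r) \<in> G")
    case True
    then obtain U r where e: "(p, x, U, r) \<in> G" by blast
    then have "(p, x, U', r') \<in> G \<longleftrightarrow> U' = U \<and> r' = r" for U' r'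
      using det unfolding deterministic_edges_def by blast
    then have "(\<exists>V q. path G p (x # w) V q) \<longleftrightarrow> (\<exists>V q. path G r w V q)"
      by (auto simp: path_Cons_iff)
    then show ?thesis using Cons.IH[of r] by (simp add: readable_def delta_lambda_edge[OF e])
  next
    case False
    then show ?thesis using delta_lambda_no_edge[OF False] by (auto simp: path_Cons_iff readable_def)
  qed
qed (auto simp: readable_def intro: path_Nil)

text \<open>The identity is always fixed, through the empty path. So the set differs from the
  trivial one exactly if some other class is fixed, and the transducer reads the reduced word of
  that class.\<close>

lemma nontrivial_fixed_point_iff:
  assumes words: "\<And>p w V q. w \<in> words A \<Longrightarrow> path G p w V q \<Longrightarrow> V \<in> words A"
  shows "fixed_points A (edge_transducer S i G) \<noteq> {\<one>\<^bsub>free_group A\<^esub>} \<longleftrightarrow>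
    (\<exists>w V q. w \<in> words A \<and> reduced w \<and> w \<noteq> [] \<and> path G i w V q \<and> (V, w) \<in> free_eq A)"
    (is "?l \<longleftrightarrow> ?r")
proof -
  let ?T = "edge_transducer S i G"
  have rw: "reduced_word (free_class A w) = w" if "w \<in> words A" "reduced w" for w
  proof -
    have "free_class A w \<in> carrier (free_group A)" using that by (simp add: carrier_free_group)
    moreover have "w \<in> free_class A w" using that by (simp add: mem_free_class_iff free_eq_def)
    ultimately show ?thesis
      unfolding reduced_word_def
      using that(2) by (intro the1_equality reduced_word_unique) auto
  qed
  have fp: "free_class A w \<in> fixed_points A ?T \<longleftrightarrow> (\<exists>V q. path G i w V q \<and> (V, w) \<in> free_eq A)"
    if w: "w \<in> words A" "reduced w" for w
  proof -
    have "free_class A w \<in> carrier (free_group A)" using w by (simp add: carrier_free_group)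
    then have "free_class A w \<in> fixed_points A ?T \<longleftrightarrow> readable ?T i w \<and>
        free_class A (the (lambda_word ?T i w)) = free_class A w"
      by (simp add: fixed_points_def transducer_map_def rw[OF w])
    also have "\<dots> \<longleftrightarrow> (\<exists>V q. path G i w V q \<and> free_class A V = free_class A w)"
    proof -
      have "the (lambda_word ?T i w) = V" if "path G i w V q" for V q
        using that unfolding path_edge_transducer by simp
      then show ?thesis unfolding readable_edge_transducer by blast
    qed
    also have "\<dots> \<longleftrightarrow> (\<exists>V q. path G i w V q \<and> (V, w) \<in> free_eq A)"
      using free_class_eq_iff[OF words[OF w(1)] w(1)] by blast
    finally show ?thesis .
  qed
  have one: "\<one>\<^bsub>free_group A\<^esub> \<in> fixed_points A ?T"
  proof -
    have "path G i [] [] i" "([], []) \<in> free_eq A" by (auto simp: free_eq_def)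
    then show ?thesis unfolding one_free_group using fp[of "[]", OF words_simps(1) reduced_Nil] by blast
  qed
  show ?thesis
  proof
    assume ?l
    then obtain g where g: "g \<in> fixed_points A ?T" "g \<noteq> free_class A []"
      using one by (auto simp: one_free_group)
    then obtain u where u: "u \<in> words A" "g = free_class A u"
      by (auto simp: fixed_points_def carrier_free_group)
    then obtain w where w: "(u, w) \<in> free_eq A" "reduced w" using reduced_exists by blast
    then have "w \<in> words A" by (simp add: free_eq_def)
    moreover from this have "g = free_class A w" using u w free_class_eq_iff[of u A w] by simp
    ultimately have "\<exists>V q. path G i w V q \<and> (V, w) \<in> free_eq A" "w \<noteq> []"
      using g fp[of w] w(2) by auto
    then show ?r using \<open>w \<in> words A\<close> w(2) by blast
  next
    assume ?r
    then obtain w V q where w: "w \<in> words A" "reduced w" "w \<noteq> []" "path G i w V q" "(V, w) \<in> free_eq A"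
      by blast
    then have "free_class A w \<in> fixed_points A ?T" using fp by blast
    moreover have "free_class A w \<noteq> free_class A []"
      using rw[OF w(1,2)] rw[of "[]"] w(3) by (metis reduced_Nil words_simps(1))
    ultimately show ?l unfolding one_free_group by blast
  qed
qed

end


section \<open>Modular counter machines\<close>

text \<open>Output of the edge that reads \<open>s\<close>. The letters 0, 1 and 2 are
  \<open>c\<close>, \<open>s\<close> and the marker of the start state.\<close>

definition start_word :: "nat \<Rightarrow> nat word" where
  "start_word N = Inl 1 # replicate N (Inl 0) @ [Inl 2]"

text \<open>In state \<open>q\<close> with value \<open>N = md q * k + j\<close>, where \<open>j < md q\<close>, the machine moves to the state \<open>q'\<close>
  with value \<open>mult q * k + b\<close> if \<open>exits q j = Some (b, q')\<close>.\<close>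

locale modular_machine =
  fixes Q :: "'k set" and start halt :: 'k
    and md mult :: "'k \<Rightarrow> nat" and exits :: "'k \<Rightarrow> nat \<Rightarrow> (nat \<times> 'k) option"
    and code :: "'k \<Rightarrow> nat"
  assumes finite_Q: "finite Q" and start_in_Q: "start \<in> Q" and halt_in_Q: "halt \<in> Q"
    and md_pos: "q \<in> Q \<Longrightarrow> 0 < md q"
    and mult_pos: "q \<in> Q \<Longrightarrow> q \<noteq> halt \<Longrightarrow> 0 < mult q"
    and exitsD: "exits q j = Some (b, q') \<Longrightarrow> q \<in> Q \<and> q' \<in> Q \<and> j < md q \<and> q \<noteq> halt"
    and exits_inj: "exits q i = Some (b, q') \<Longrightarrow> exits q j = Some (b', q') \<Longrightarrow> i = j"
    and md_halt: "md halt = 1" and mult_halt: "mult halt = 0"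
    and inj_code: "inj_on code Q" and code_start: "code start = 0"
begin

section \<open>Machine steps and the transducer edges that carry them out\<close>

definition mstep :: "'k \<times> nat \<Rightarrow> 'k \<times> nat \<Rightarrow> bool" where
  "mstep c d \<longleftrightarrow> (\<exists>b. exits (fst c) (snd c mod md (fst c)) = Some (b, fst d) \<and>
     snd d = mult (fst c) * (snd c div md (fst c)) + b)"

lemma mstep_deterministic: "mstep c d \<Longrightarrow> mstep c d' \<Longrightarrow> d = d'"
  by (auto simp: mstep_def prod_eq_iff)

lemma mstep_pow_deterministic: "(mstep ^^ n) c d \<Longrightarrow> (mstep ^^ n) c d' \<Longrightarrow> d = d'"
proof (induction n arbitrary: d d')
  case (Suc n)
  then show ?case by (metis mstep_deterministic relpowp_Suc_E)
qed simp

text \<open>Letters 0 and 1 are reserved for \<open>c\<close> and \<open>s\<close>. As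
  \<open>code start = 0\<close>, the start marker is 2 for every machine, so the edge that outputs
  \<open>start_word N\<close> is independent of the machine.\<close>

definition mark :: "'k \<Rightarrow> nat" where
  "mark q = code q + 2"

text \<open>In \<open>(q, j)\<close> the second component is the exponent read so far modulo
  \<open>md q\<close>; each full turn of the cycle outputs \<open>mult q\<close> letters.\<close>

definition cycle_edges :: "(('k \<times> nat) \<times> nat \<times> nat word \<times> ('k \<times> nat)) set" where
  "cycle_edges = {((q, j), 0, if Suc j < md q then [] else replicate (mult q) (Inl 0), (q, Suc j mod md q)) |
     q j. q \<in> Q \<and> j < md q}"

definition exit_edges :: "(('k \<times> nat) \<times> nat \<times> nat word \<times> ('k \<times> nat)) set" where
  "exit_edges = {((q, j), mark q, replicate b (Inl 0) @ [Inl (mark q')], (q', 0)) |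
     q j b q'. exits q j = Some (b, q')}"

definition core_edges :: "(nat, 'k \<times> nat) edge_set" where
  "core_edges = symmetric_closure (cycle_edges \<union> exit_edges)"

definition core_state :: "'k \<times> nat \<Rightarrow> bool" where
  "core_state c \<longleftrightarrow> fst c \<in> Q \<and> snd c < md (fst c)"

text \<open>The numbers 0 and 1 stay free for the initial state and the dead end, and
  \<open>(start, 0)\<close> becomes 2.\<close>

definition state_code :: "'k \<times> nat \<Rightarrow> nat" where
  "state_code c = prod_encode (code (fst c), snd c) + 2"

text \<open>All positive edges except the one reading \<open>s\<close>, which alone depends on the
  input. The inserted edge is the halting edge into the dead end.\<close>

definition base_edges :: "(nat \<times> nat \<times> nat word \<times> nat) set" where
  "base_edges = insert (state_code (halt, 0), mark halt, [], 1)
     ((\<lambda>(c, a, U, d). (state_code c, a, U, state_code d)) ` (cycle_edges \<union> exit_edges))"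

definition input_edges :: "nat \<Rightarrow> (nat, nat) edge_set" where
  "input_edges N = symmetric_closure (insert (0, 1, start_word N, 2) base_edges)"

lemma mark_start: "mark start = 2"
  by (simp add: mark_def code_start)

lemma state_code_start: "state_code (start, 0) = 2"
  by (simp add: state_code_def code_start prod_encode_def)

lemma mark_inj: "q \<in> Q \<Longrightarrow> q' \<in> Q \<Longrightarrow> mark q = mark q' \<longleftrightarrow> q = q'"
  using inj_code by (auto simp: mark_def inj_on_def)

lemma mark_simps [simp]: "mark q \<noteq> 0" "0 \<noteq> mark q" "mark q \<noteq> Suc 0" "Suc 0 \<noteq> mark q"
  by (auto simp: mark_def)

lemma state_code_simps [simp]: "state_code c \<noteq> 0" "0 \<noteq> state_code c"
  "state_code c \<noteq> Suc 0" "Suc 0 \<noteq> state_code c"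
  by (auto simp: state_code_def)

lemma state_code_inj: "core_state c \<Longrightarrow> core_state d \<Longrightarrow> state_code c = state_code d \<longleftrightarrow> c = d"
  using inj_code by (auto simp: state_code_def core_state_def inj_on_def prod_eq_iff)

lemma core_state_start: "core_state (start, 0)"
  by (simp add: core_state_def start_in_Q md_pos)

lemma core_state_halt: "core_state (halt, 0)"
  by (simp add: core_state_def halt_in_Q md_pos)

lemma core_edges_state:
  assumes "(c, a, U, d) \<in> cycle_edges \<union> exit_edges" shows "core_state c \<and> core_state d"
  using assms
proof
  assume "(c, a, U, d) \<in> cycle_edges"
  then show ?thesis using md_pos by (auto simp: cycle_edges_def core_state_def)
next
  assume "(c, a, U, d) \<in> exit_edges"
  then obtain q j b q' where "c = (q, j)" "d = (q', 0)" "exits q j = Some (b, q')"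
    by (auto simp: exit_edges_def)
  then show ?thesis using exitsD[of q j b q'] md_pos[of q'] by (simp add: core_state_def)
qed

lemma core_edges_deterministic:
  assumes "(c, a, U, d) \<in> cycle_edges \<union> exit_edges" "(c, a, U', d') \<in> cycle_edges \<union> exit_edges"
  shows "U = U' \<and> d = d'"
  using assms by (auto simp: cycle_edges_def exit_edges_def)

text \<open>On the letter 0, adding 1 modulo \<open>md q\<close> is injective. On a marker, the
  letter names the source state and \<open>exits_inj\<close> recovers the residue.\<close>

lemma core_edges_codeterministic:
  assumes "(c, a, U, d) \<in> cycle_edges \<union> exit_edges" "(c', a, U', d) \<in> cycle_edges \<union> exit_edges"
  shows "U = U' \<and> c = c'"
proof (cases "a = 0")
  case True
  then obtain q i j where *: "c = (q, i)" "c' = (q, j)" "i < md q" "j < md q"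
    "Suc i mod md q = Suc j mod md q"
    "U = (if Suc i < md q then [] else replicate (mult q) (Inl 0))"
    "U' = (if Suc j < md q then [] else replicate (mult q) (Inl 0))"
    using assms by (auto simp: cycle_edges_def exit_edges_def)
  have "i = j" using *(3,4,5) by (auto simp: mod_Suc split: if_splits)
  then show ?thesis using * by simp
next
  case False
  then obtain q i b r q2 j b' where *: "c = (q, i)" "exits q i = Some (b, r)" "a = mark q"
    "c' = (q2, j)" "exits q2 j = Some (b', r)" "a = mark q2"
    "U = replicate b (Inl 0) @ [Inl (mark r)]" "U' = replicate b' (Inl 0) @ [Inl (mark r)]"
    using assms by (auto simp: cycle_edges_def exit_edges_def)
  have "q = q2" using * exitsD mark_inj by metis
  moreover have "i = j" using exits_inj * \<open>q = q2\<close> by blast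
  ultimately show ?thesis using * by simp
qed

lemma base_edges_cases:
  assumes "(p, a, U, p') \<in> base_edges"
  obtains "p = state_code (halt, 0)" "a = mark halt" "U = []" "p' = 1"
  | c d where "p = state_code c" "p' = state_code d" "(c, a, U, d) \<in> cycle_edges \<union> exit_edges"
    "core_state c" "core_state d"
proof -
  have "p = state_code (halt, 0) \<and> a = mark halt \<and> U = [] \<and> p' = 1 \<or>
    (\<exists>c d. p = state_code c \<and> p' = state_code d \<and> (c, a, U, d) \<in> cycle_edges \<union> exit_edges)"
    using assms unfolding base_edges_def by (elim insertE imageE) auto
  then show thesis using that core_edges_state by blast
qed

lemma halt_no_exit: "((halt, 0), mark halt, U, d) \<notin> cycle_edges \<union> exit_edges"
  using exitsD[of halt 0] by (auto simp: cycle_edges_def exit_edges_def)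

text \<open>Among the positive edges, the one reading \<open>s\<close> is alone in its source 0 and
  in its letter 1. The halting edge is alone in its target 1, and it clashes with no exit because
  \<open>halt\<close> has none.\<close>

lemma input_edges_deterministic: "deterministic_edges (input_edges N)"
  unfolding input_edges_def
proof (rule deterministic_symmetric_closure)
  fix p a U q U' q'
  assume 1: "(p, a, U, q) \<in> insert (0, 1, start_word N, 2) base_edges"
    and 2: "(p, a, U', q') \<in> insert (0, 1, start_word N, 2) base_edges"
  show "U = U' \<and> q = q'"
  proof (cases "p = 0")
    case True
    have "(p, a, U, q) \<notin> base_edges" for U q
    proof
      assume "(p, a, U, q) \<in> base_edges"
      then show False by (cases rule: base_edges_cases) (use True in auto)
    qed
    then show ?thesis using 1 2 by blast
  next
    case False
    then have b: "(p, a, U, q) \<in> base_edges" "(p, a, U', q') \<in> base_edges" using 1 2 by auto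
    from b(1) show ?thesis
    proof (cases rule: base_edges_cases)
      case 1
      from b(2) show ?thesis
      proof (cases rule: base_edges_cases)
        case (2 c d)
        then have "c = (halt, 0)" using 1 state_code_inj core_state_halt by metis
        then show ?thesis using 1 2 halt_no_exit by blast
      qed (use 1 in simp)
    next
      case (2 c d)
      note c = this
      from b(2) show ?thesis
      proof (cases rule: base_edges_cases)
        case 1
        then have "c = (halt, 0)" using c state_code_inj core_state_halt by metis
        then show ?thesis using 1 c halt_no_exit by blast
      next
        case (2 c' d')
        then have "c' = c" using c state_code_inj by metis
        then show ?thesis using c 2 core_edges_deterministic by blast
      qed
    qed
  qed
next
  fix p a U q U' p'
  assume 1: "(p, a, U, q) \<in> insert (0, 1, start_word N, 2) base_edges"
    and 2: "(p', a, U', q) \<in> insert (0, 1, start_word N, 2) base_edges"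
  have no: "a \<noteq> 1" if "(p, a, U, q) \<in> base_edges" for p U q
    using that by (cases rule: base_edges_cases) (auto simp: cycle_edges_def exit_edges_def)
  show "U = U' \<and> p = p'"
  proof (cases "a = 1")
    case True
    then show ?thesis using 1 2 no by blast
  next
    case False
    then have b: "(p, a, U, q) \<in> base_edges" "(p', a, U', q) \<in> base_edges" using 1 2 by auto
    show ?thesis
    proof (cases "q = 1")
      case True
      have "p = state_code (halt, 0) \<and> U = []" if "(p, a, U, q) \<in> base_edges" for p U
        using that by (cases rule: base_edges_cases) (use True in auto)
      then show ?thesis using b by blast
    next
      case False
      obtain c d where c: "p = state_code c" "q = state_code d" "core_state d"
        "(c, a, U, d) \<in> cycle_edges \<union> exit_edges"
        using b(1) by (cases rule: base_edges_cases) (use False that in blast)+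
      obtain c' d' where c': "p' = state_code c'" "q = state_code d'" "core_state d'"
        "(c', a, U', d') \<in> cycle_edges \<union> exit_edges"
        using b(2) by (cases rule: base_edges_cases) (use False that in blast)+
      have "d = d'" using c c' state_code_inj by metis
      then show ?thesis using c c' core_edges_codeterministic by blast
    qed
  qed
qed

lemma core_edge_cases:
  assumes "(c, x, U, d) \<in> core_edges"
  shows "core_state c" "core_state d" "weight U = weight [x]"
proof -
  have w: "weight U = (if a = 0 then 0 else 1)" if "(c, a, U, d) \<in> cycle_edges \<union> exit_edges" for c a U d
    using that by (auto simp: cycle_edges_def exit_edges_def)
  show "core_state c" "core_state d"
    using assms core_edges_state unfolding core_edges_def by (cases x; auto)+
  show "weight U = weight [x]"
  proof (cases x)
    case (Inl a)
    then show ?thesis using assms w[of c a U d] by (simp add: core_edges_def)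
  next
    case (Inr a)
    then show ?thesis using assms w[of d a "inv_word U" c] by (simp add: core_edges_def)
  qed
qed

section \<open>Markers and exponents along core paths\<close>

lemma core_path_weight: "path core_edges c v V d \<Longrightarrow> weight V = weight v"
proof (induction rule: path.induct)
  case (path_Cons p x U q w V r)
  then show ?case using core_edge_cases(3) by fastforce
qed simp

lemma core_edges_symmetric: "symmetric_edges core_edges"
  by (simp add: core_edges_def symmetric_symmetric_closure)

text \<open>Integers are used so that one formula covers both directions: the output exponent is
  \<open>mult q\<close> times the number of turns, counted with sign.\<close>

lemma cycle_step:
  assumes "((q, j), x, U, d) \<in> core_edges" "\<not> marker x" "j < md q"
  shows "d = (q, nat ((int j + letter_exp x) mod int (md q)))" "weight U = 0"
    "total_exp U = int (mult q) * ((int j + letter_exp x) div int (md q))"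
proof -
  let ?m = "int (md q)"
  have fwd: "int (Suc i mod md q) = (int i + 1) mod ?m" for i by (simp add: zmod_int ac_simps)
  have div: "(int i + 1) div ?m = (if Suc i < md q then 0 else 1)" if "i < md q" for i
  proof (cases "Suc i < md q")
    case False
    then have "int i + 1 = ?m" using that by simp
    moreover have "?m div ?m = 1" using that by simp
    ultimately show ?thesis using False by simp
  qed simp
  have "d = (q, nat ((int j + letter_exp x) mod int (md q))) \<and> weight U = 0 \<and>
    total_exp U = int (mult q) * ((int j + letter_exp x) div int (md q))"
  proof (cases x)
    case (Inl a)
    then have *: "((q, j), 0, U, d) \<in> cycle_edges \<union> exit_edges" "a = 0"
      using assms by (auto simp: core_edges_def)
    then have "d = (q, Suc j mod md q)" "U = (if Suc j < md q then [] else replicate (mult q) (Inl 0))"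
      by (auto simp: cycle_edges_def exit_edges_def)
    moreover have "Suc j mod md q = nat ((int j + 1) mod ?m)" using fwd[of j] by simp
    ultimately show ?thesis using *(2) Inl div[OF assms(3)] by simp
  next
    case (Inr a)
    then have *: "(d, 0, inv_word U, (q, j)) \<in> cycle_edges \<union> exit_edges" "a = 0"
      using assms by (auto simp: core_edges_def)
    then obtain i where i: "d = (q, i)" "i < md q" "j = Suc i mod md q"
      "inv_word U = (if Suc i < md q then [] else replicate (mult q) (Inl 0))"
      by (auto simp: cycle_edges_def exit_edges_def)
    have U: "U = (if Suc i < md q then [] else replicate (mult q) (Inr 0))"
      using arg_cong[OF i(4), of inv_word] by (auto split: if_splits)
    have "int i + 1 = ?m * ((int i + 1) div ?m) + int j"
      unfolding i(3) fwd by (simp add: mult_div_mod_eq)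
    then have j: "int j - 1 = int i + ?m * (- ((int i + 1) div ?m))" by (simp add: algebra_simps)
    have "(int j - 1) mod ?m = int i" "(int j - 1) div ?m = - ((int i + 1) div ?m)"
      unfolding j using i(2) by (subst mod_mult_self2 div_mult_self2; simp)+
    then show ?thesis using U i(1) *(2) Inr div[OF i(2)] by simp
  qed
  then show "d = (q, nat ((int j + letter_exp x) mod int (md q)))" "weight U = 0"
    "total_exp U = int (mult q) * ((int j + letter_exp x) div int (md q))" by blast+
qed

lemma cycle_path:
  assumes "path core_edges (q, j) v V d" "weight v = 0" "j < md q"
  shows "d = (q, nat ((int j + total_exp v) mod int (md q))) \<and>
    total_exp V = int (mult q) * ((int j + total_exp v) div int (md q))"
  using assms
proof (induction v arbitrary: j V)
  case Nil
  then show ?case by (simp add: nat_mod_as_int)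
next
  case (Cons x v)
  let ?m = "int (md q)" and ?a = "int j + letter_exp x"
  obtain U d1 W where e: "((q, j), x, U, d1) \<in> core_edges" "path core_edges d1 v W d" "V = U @ W"
    using Cons.prems(1) by (auto simp: path_Cons_iff)
  have "\<not> marker x" "weight v = 0" using Cons.prems(2) by (auto split: if_splits)
  note s = cycle_step[OF e(1) \<open>\<not> marker x\<close> Cons.prems(3)]
  have m: "0 < ?m" using Cons.prems(3) by simp
  have j1: "int (nat (?a mod ?m)) = ?a mod ?m" using m by simp
  have "nat (?a mod ?m) < md q" using m j1 pos_mod_bound[of ?m ?a] by linarith
  then have IH: "d = (q, nat ((?a mod ?m + total_exp v) mod ?m))"
    "total_exp W = int (mult q) * ((?a mod ?m + total_exp v) div ?m)"
    using Cons.IH[OF e(2)[unfolded s(1)] \<open>weight v = 0\<close>] unfolding j1 by auto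
  \<comment> \<open>The turn made by the first letter is split off, so that the quotients add up
    along the path.\<close>
  have "?a + total_exp v = (?a mod ?m + total_exp v) + ?m * (?a div ?m)"
    using mult_div_mod_eq[of ?m ?a] by linarith
  then have "(?a + total_exp v) div ?m = ?a div ?m + (?a mod ?m + total_exp v) div ?m"
    using m by (metis div_mult_self2 less_irrefl)
  moreover have "(?a mod ?m + total_exp v) mod ?m = (?a + total_exp v) mod ?m"
    by (rule mod_add_left_eq)
  moreover have "int j + total_exp (x # v) = ?a + total_exp v" by simp
  ultimately show ?case using IH s(3) e(3) by (simp only: total_exp_append distrib_left simp_thms)
qed

text \<open>The last assumption says that the output, with the block \<open>(N, mark q)\<close> put
  in front, runs one block ahead of the input. So the first block of \<open>v\<close> is the
  configuration \<open>(q, N)\<close>, the transducer answers with the block of its successor, and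
  induction on the number of markers shows that the blocks of \<open>v\<close> spell a run. In
  particular no block has an inverse marker or a negative exponent.\<close>

lemma valid_run:
  assumes "path core_edges (q, 0) v V p" "q \<in> Q"
    "blocks (int N) (Inl (mark q) # V) = blocks 0 v @ [(d, x)]"
  shows "\<exists>q' N'. (mstep ^^ weight v) (q, N) (q', N') \<and> d = int N' \<and> x = Inl (mark q') \<and> q' \<in> Q \<and>
    p = (q', nat (block_tail 0 v mod int (md q'))) \<and>
    block_tail 0 V = int (mult q') * (block_tail 0 v div int (md q')) \<and>
    (\<forall>i<weight v. \<exists>q'' N''. (mstep ^^ i) (q, N) (q'', N'') \<and>
       blocks 0 v ! i = (int N'', Inl (mark q'')))"
  using assms
proof (induction "weight v" arbitrary: v q N V)
  case 0
  have "weight V = 0" using core_path_weight[OF "0.prems"(1)] 0 by simp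
  then show ?case using 0 cycle_path[OF "0.prems"(1)] md_pos by simp
next
  case (Suc n)
  obtain v0 x0 v2 where v: "v = v0 @ x0 # v2" "weight v0 = 0" "marker x0"
    using weight_0_split_marker[of v] Suc.hyps(2) by auto
  obtain V0 c U c1 V2 where p: "path core_edges (q, 0) v0 V0 c" "(c, x0, U, c1) \<in> core_edges"
    "path core_edges c1 v2 V2 p" "V = V0 @ U @ V2"
    using Suc.prems(1) unfolding v(1) path_append_iff path_Cons_iff by blast
  have wV0: "weight V0 = 0" using core_path_weight[OF p(1)] v(2) by simp
  have "blocks 0 v = (total_exp v0, x0) # blocks 0 v2" using v by simp
  then have N: "total_exp v0 = int N" "x0 = Inl (mark q)" and
    rest: "blocks 0 V = blocks 0 v2 @ [(d, x)]"
    using Suc.prems(3) by auto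
  have "c = (q, N mod md q)" "total_exp V0 = int (mult q * (N div md q))"
    using cycle_path[OF p(1) v(2)] md_pos[OF Suc.prems(2)] N(1)
    by (simp_all add: zmod_int[symmetric] zdiv_int[symmetric])
  moreover from this have "((q, N mod md q), mark q, U, c1) \<in> exit_edges"
    using p(2) N(2) by (auto simp: core_edges_def cycle_edges_def)
  then obtain b q1 where e: "exits q (N mod md q) = Some (b, q1)" "c1 = (q1, 0)"
    "U = replicate b (Inl 0) @ [Inl (mark q1)]"
    by (auto simp: exit_edges_def)
  define N1 where "N1 = mult q * (N div md q) + b"
  have step: "mstep (q, N) (q1, N1)" using e(1) by (simp add: mstep_def N1_def)
  have "blocks (int N1) (Inl (mark q1) # V2) = blocks 0 v2 @ [(d, x)]"
    using rest p(4) wV0 calculation(2) e(3) by (simp add: N1_def)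
  moreover have "q1 \<in> Q" using exitsD[OF e(1)] by simp
  moreover have "n = weight v2" using Suc.hyps(2) v by simp
  ultimately obtain q' N' where IH: "(mstep ^^ weight v2) (q1, N1) (q', N')" "d = int N'"
    "x = Inl (mark q')" "q' \<in> Q" "p = (q', nat (block_tail 0 v2 mod int (md q')))"
    "block_tail 0 V2 = int (mult q') * (block_tail 0 v2 div int (md q'))"
    "\<And>i. i < weight v2 \<Longrightarrow> \<exists>q'' N''. (mstep ^^ i) (q1, N1) (q'', N'') \<and>
       blocks 0 v2 ! i = (int N'', Inl (mark q''))"
    using Suc.hyps(1)[of v2 q1 V2 N1] p(3) e(2) by blast
  have w: "weight v = Suc (weight v2)" using v by simp
  have bv: "blocks 0 v = (int N, Inl (mark q)) # blocks 0 v2" using v N by simp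
  have "\<exists>q'' N''. (mstep ^^ i) (q, N) (q'', N'') \<and> blocks 0 v ! i = (int N'', Inl (mark q''))"
    if i: "i < weight v" for i
  proof (cases i)
    case 0
    then show ?thesis using bv by auto
  next
    case (Suc k)
    then obtain q'' N'' where "(mstep ^^ k) (q1, N1) (q'', N'')" "blocks 0 v2 ! k = (int N'', Inl (mark q''))"
      using IH(7)[of k] i w by auto
    then have "(mstep ^^ Suc k) (q, N) (q'', N'')" using relpowp_Suc_I2[of mstep, OF step] by blast
    then show ?thesis using Suc bv \<open>blocks 0 v2 ! k = _\<close> by auto
  qed
  moreover have "(mstep ^^ weight v) (q, N) (q', N')"
    unfolding w using relpowp_Suc_I2[of mstep, OF step IH(1)] .
  moreover have "block_tail 0 v = block_tail 0 v2" "block_tail 0 V = block_tail 0 V2"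
    using v p(4) e(3) by simp_all
  ultimately show ?case using IH(2-6) by (intro exI[of _ q'] exI[of _ N']) simp
qed


subsection \<open>The fixed point of a halting run\<close>

lemma core_path_input:
  "path core_edges c v V d \<Longrightarrow> path (input_edges N) (state_code c) v V (state_code d)"
proof (induction rule: path.induct)
  case (path_Cons p x U q w V r)
  have "(state_code p, x, U, state_code q) \<in> input_edges N"
    using path_Cons.hyps(1)
    by (cases x) (force simp: core_edges_def input_edges_def base_edges_def)+
  then show ?case using path_Cons.IH by (rule path.path_Cons)
qed simp

lemma core_path_power:
  assumes "q \<in> Q"
  shows "path core_edges (q, 0) (replicate N (Inl 0)) (replicate (mult q * (N div md q)) (Inl 0))
    (q, N mod md q)"
proof (induction N)
  case (Suc N)
  let ?U = "if Suc (N mod md q) < md q then [] else replicate (mult q) (Inl 0)"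
  have "((q, N mod md q), Inl 0, ?U, (q, Suc (N mod md q) mod md q)) \<in> core_edges"
    using assms md_pos by (simp add: core_edges_def cycle_edges_def)
  then have "path core_edges (q, N mod md q) [Inl 0] ?U (q, Suc N mod md q)"
    unfolding mod_Suc_eq by (rule path_single)
  from path_append[OF Suc this]
  have "path core_edges (q, 0) (replicate (Suc N) (Inl 0))
      (replicate (mult q * (N div md q)) (Inl 0) @ ?U) (q, Suc N mod md q)"
    by (simp add: replicate_append_same)
  moreover have "replicate (mult q * (N div md q)) (Inl 0) @ ?U =
      replicate (mult q * (Suc N div md q)) (Inl 0 :: nat letter)"
  proof (cases "Suc (N mod md q) < md q")
    case True
    then have "Suc N div md q = N div md q" by (simp add: div_Suc mod_Suc)
    then show ?thesis using True by simp
  next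
    case False
    then have "Suc (N mod md q) = md q" using md_pos[OF assms] mod_less_divisor[of "md q" N] by linarith
    then have "Suc N mod md q = 0" by (simp add: mod_Suc)
    then have "Suc N div md q = Suc (N div md q)" by (simp add: div_Suc)
    then show ?thesis using False by (simp add: replicate_add[symmetric] add.commute)
  qed
  ultimately show ?case by simp
qed simp

text \<open>Here \<open>v\<close> spells all configurations but the last one, while the output,
  preceded by the first configuration, spells all of them: the shift by one block that
  \<open>valid_run\<close> assumes.\<close>

lemma run_path:
  assumes "(mstep ^^ n) (q, N) (q', N')" "q \<in> Q"
  shows "\<exists>v V. path core_edges (q, 0) v V (q', 0) \<and> v \<in> lists (range Inl) \<and> q' \<in> Q \<and>
    replicate N (Inl 0) @ Inl (mark q) # V = v @ replicate N' (Inl 0) @ [Inl (mark q')]"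
  using assms
proof (induction n arbitrary: q N)
  case 0
  then show ?case by (intro exI[of _ "[]"]) simp
next
  case (Suc n)
  obtain q1 N1 where 1: "mstep (q, N) (q1, N1)" "(mstep ^^ n) (q1, N1) (q', N')"
    using relpowp_Suc_D2[OF Suc.prems(1)] by auto
  then obtain b where b: "exits q (N mod md q) = Some (b, q1)" "N1 = mult q * (N div md q) + b"
    by (auto simp: mstep_def)
  then have "q1 \<in> Q" using exitsD by blast
  then obtain v V where IH: "path core_edges (q1, 0) v V (q', 0)" "v \<in> lists (range Inl)" "q' \<in> Q"
    "replicate N1 (Inl 0) @ Inl (mark q1) # V = v @ replicate N' (Inl 0) @ [Inl (mark q')]"
    using Suc.IH[OF 1(2)] by blast
  have "((q, N mod md q), Inl (mark q), replicate b (Inl 0) @ [Inl (mark q1)], (q1, 0)) \<in> core_edges"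
    using b(1) by (auto simp: core_edges_def exit_edges_def)
  from path_append[OF core_path_power[OF Suc.prems(2)] path_Cons[OF this IH(1)]]
  have "path core_edges (q, 0) (replicate N (Inl 0) @ Inl (mark q) # v)
      (replicate N1 (Inl 0) @ Inl (mark q1) # V) (q', 0)"
    by (simp add: b(2) replicate_add)
  moreover have "replicate N (Inl 0) @ Inl (mark q) # replicate N1 (Inl 0) @ Inl (mark q1) # V =
    (replicate N (Inl 0) @ Inl (mark q) # v) @ replicate N' (Inl 0) @ [Inl (mark q')]"
    using IH(4) by simp
  moreover have "replicate N (Inl 0) @ Inl (mark q) # v \<in> lists (range Inl)" using IH(2) by auto
  ultimately show ?case using IH(3) by blast
qed

lemma halting_fixed_point:
  assumes "(mstep ^^ n) (start, N) (halt, N')"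
  shows "\<exists>w. reduced w \<and> w \<noteq> [] \<and> path (input_edges N) 0 w w 1"
proof -
  obtain v V where v: "path core_edges (start, 0) v V (halt, 0)" "v \<in> lists (range Inl)"
    "replicate N (Inl 0) @ Inl 2 # V = v @ replicate N' (Inl 0) @ [Inl (mark halt)]"
    using run_path[OF assms start_in_Q] by (auto simp: mark_start)
  have e: "(0, Inl 1, start_word N, state_code (start, 0)) \<in> input_edges N"
    "(state_code (halt, 0), Inl (mark halt), [], 1) \<in> input_edges N"
    by (auto simp: input_edges_def base_edges_def state_code_start)
  \<comment> \<open>With \<open>md halt = 1\<close> and \<open>mult halt = 0\<close> the last
    exponent is swallowed silently; its block has already been output.\<close>
  have "path core_edges (halt, 0) (replicate N' (Inl 0)) [] (halt, 0)"
    using core_path_power[OF halt_in_Q, of N'] by (simp add: md_halt mult_halt)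
  note h = path_append[OF core_path_input[OF this] path_single[OF e(2)]]
  let ?w = "Inl 1 # v @ replicate N' (Inl 0) @ [Inl (mark halt)]"
  have "path (input_edges N) 0 ?w (start_word N @ V) 1"
    using path_Cons[OF e(1) path_append[OF core_path_input[OF v(1)] h]] by simp
  moreover have "start_word N @ V = ?w" using v(3) by (simp add: start_word_def)
  moreover have "?w \<in> lists (range Inl)" using v(2) by auto
  then have "reduced ?w" by (rule positive_reduced)
  ultimately show ?thesis by fastforce
qed


subsection \<open>Fixed points come from halting runs\<close>

lemma input_edge_from_core:
  assumes "(state_code c, x, U, p) \<in> input_edges N" "core_state c"
  shows "(\<exists>d. (c, x, U, d) \<in> core_edges \<and> p = state_code d) \<or>
    c = (halt, 0) \<and> x = Inl (mark halt) \<and> U = [] \<and> p = 1 \<or>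
    c = (start, 0) \<and> x = Inr 1 \<and> U = inv_word (start_word N) \<and> p = 0"
proof (cases x)
  case (Inl a)
  then have "(state_code c, a, U, p) \<in> base_edges" using assms by (auto simp: input_edges_def)
  then show ?thesis
  proof (cases rule: base_edges_cases)
    case 1
    then have "c = (halt, 0)" using state_code_inj[OF assms(2) core_state_halt] by simp
    then show ?thesis using 1 Inl by simp
  next
    case (2 c' d)
    then have "c' = c" using state_code_inj[OF assms(2)] by simp
    then have "(c, x, U, d) \<in> core_edges" using 2 Inl by (simp add: core_edges_def)
    then show ?thesis using 2 by blast
  qed
next
  case (Inr a)
  then consider "p = 0" "a = 1" "inv_word U = start_word N" "state_code c = 2"
    | "(p, a, inv_word U, state_code c) \<in> base_edges"
    using assms by (auto simp: input_edges_def)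
  then show ?thesis
  proof cases
    case 1
    then have "c = (start, 0)" using state_code_inj[OF assms(2) core_state_start] state_code_start by simp
    moreover have "U = inv_word (start_word N)" using 1(3) inv_word_inv_word by metis
    ultimately show ?thesis using 1 Inr by simp
  next
    case 2
    then show ?thesis
    proof (cases rule: base_edges_cases)
      case (2 c' d)
      then have "d = c" using state_code_inj[OF assms(2)] by simp
      then have "(c, x, U, c') \<in> core_edges" using 2 Inr by (simp add: core_edges_def)
      then show ?thesis using 2 by blast
    qed simp
  qed
qed

lemma input_edge_from_0: "(0, x, U, p) \<in> input_edges N \<Longrightarrow> x = Inl 1 \<and> U = start_word N \<and> p = state_code (start, 0)"
proof (cases x)
  case (Inl a)
  assume "(0, x, U, p) \<in> input_edges N"
  then consider "a = 1" "U = start_word N" "p = 2" | "(0, a, U, p) \<in> base_edges"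
    using Inl by (auto simp: input_edges_def)
  then show ?thesis
  proof cases
    case 2
    then show ?thesis by (cases rule: base_edges_cases) simp_all
  qed (simp add: Inl state_code_start)
next
  case (Inr a)
  assume "(0, x, U, p) \<in> input_edges N"
  then have "(p, a, inv_word U, 0) \<in> base_edges" using Inr by (simp add: input_edges_def)
  then have False
  proof (cases rule: base_edges_cases)
    case 1
    then show False by (simp only: zero_neq_one)
  next
    case (2 c d)
    from 2(2) show False by (simp only: state_code_simps)
  qed
  then show ?thesis ..
qed

lemma input_edge_from_1: "(1, x, U, p) \<in> input_edges N \<Longrightarrow> x = Inr (mark halt)"
proof (cases x)
  case (Inl a)
  assume "(1, x, U, p) \<in> input_edges N"
  then have "(1, a, U, p) \<in> base_edges" using Inl by (simp add: input_edges_def)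
  then show ?thesis by (cases rule: base_edges_cases) simp_all
next
  case (Inr a)
  assume "(1, x, U, p) \<in> input_edges N"
  then have "(p, a, inv_word U, 1) \<in> base_edges" using Inr by (simp add: input_edges_def)
  then show ?thesis by (cases rule: base_edges_cases) (use Inr in simp_all)
qed

text \<open>The states 0 and 1 each have a single edge, so a path that enters one of them can only
  go back along the edge by which it came. A reduced word excludes this, so the core can be left by
  the last letter only.\<close>

lemma input_path_cases:
  assumes "path (input_edges N) (state_code c) v V p" "core_state c" "reduced v"
  shows "(\<exists>d. core_state d \<and> p = state_code d \<and> path core_edges c v V d) \<or>
    (\<exists>v'. v = v' @ [Inl (mark halt)] \<and> path core_edges c v' V (halt, 0) \<and> p = 1) \<or>
    (\<exists>v' V'. v = v' @ [Inr 1] \<and> V = V' @ inv_word (start_word N) \<and>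
       path core_edges c v' V' (start, 0) \<and> p = 0)"
  using assms
proof (induction v arbitrary: V p rule: rev_induct)
  case Nil
  then show ?case by (intro disjI1 exI[of _ c]) simp
next
  case (snoc x v)
  obtain V1 q U where s: "path (input_edges N) (state_code c) v V1 q" "(q, x, U, p) \<in> input_edges N"
    "V = V1 @ U"
    using snoc.prems(1) by (auto simp: path_append_iff path_Cons_iff)
  have "reduced v" using snoc.prems(3) reduced_appendD(1) by blast
  from snoc.IH[OF s(1) snoc.prems(2) this] consider
    (core) d where "core_state d" "q = state_code d" "path core_edges c v V1 d"
    | (dead) v' where "v = v' @ [Inl (mark halt)]" "q = 1"
    | (init) v' where "v = v' @ [Inr 1]" "q = 0"
    by blast
  then show ?case
  proof cases
    case core
    from input_edge_from_core[OF s(2)[unfolded core(2)] core(1)] show ?thesis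
    proof (elim disjE exE conjE)
      fix d' assume "(d, x, U, d') \<in> core_edges" "p = state_code d'"
      moreover from this have "path core_edges c (v @ [x]) V d'"
        using path_append[OF core(3) path_single] s(3) by blast
      ultimately show ?thesis using core_edge_cases(2) by blast
    next
      assume "d = (halt, 0)" "x = Inl (mark halt)" "U = []" "p = 1"
      then show ?thesis using core(3) s(3) by simp
    next
      assume "d = (start, 0)" "x = Inr 1" "U = inv_word (start_word N)" "p = 0"
      then show ?thesis using core(3) s(3) by blast
    qed
  next
    case dead
    then have "x = Inr (mark halt)" using input_edge_from_1 s(2) by simp
    then show ?thesis using snoc.prems(3) dead not_reduced[of v' "Inl (mark halt)" "[]"] by simp
  next
    case init
    then have "x = Inl 1" using input_edge_from_0 s(2) by simp
    then show ?thesis using snoc.prems(3) init not_reduced[of v' "Inr 1" "[]"] by simp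
  qed
qed

lemma blocks_start_word: "blocks 0 (start_word N @ V) = (0, Inl 1) # blocks (int N) (Inl (mark start) # V)"
  by (simp add: start_word_def mark_start)

lemma weight_start_word: "weight (start_word N) = 2"
  by (simp add: start_word_def)

lemma dead_end_fixed_point:
  assumes "path core_edges (start, 0) v V (halt, 0)"
    "same_blocks (start_word N @ V) (Inl 1 # v @ [Inl (mark halt)])"
  shows "\<exists>n N'. (mstep ^^ n) (start, N) (halt, N')"
proof -
  have "blocks 0 (start_word N @ V) = blocks 0 (Inl 1 # v @ [Inl (mark halt)])"
    using assms(2) by (simp add: same_blocks_def)
  then have "blocks (int N) (Inl (mark start) # V) = blocks 0 v @ [(block_tail 0 v, Inl (mark halt))]"
    unfolding blocks_start_word by simp
  from valid_run[OF assms(1) start_in_Q this]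
  obtain q' N' where "(mstep ^^ weight v) (start, N) (q', N')" "mark halt = mark q'" "q' \<in> Q"
    by blast
  then show ?thesis using mark_inj halt_in_Q by blast
qed

text \<open>In a fixed point \<open>s v s\<^sup>-\<^sup>1\<close> exactly one pair \<open>x x\<^sup>-\<^sup>1\<close> of output markers cancels. The next lemma
  describes the part of the path to the left of this pair; applied to the inverse path it
  describes the other part as well.\<close>

lemma half_run:
  assumes v: "path core_edges (start, 0) v V (start, 0)" "reduced v"
    and x: "marker x"
    and out: "same_blocks (start_word N @ V @ inv_word (start_word N)) (a @ [x, inv_letter x] @ b)"
    and inp: "same_blocks (Inl 1 # v @ [Inr 1]) (a @ b)"
  obtains v1 v2 V1 V2 q' N' where "v = v1 @ v2" "V = V1 @ V2" "v1 = [] \<or> marker (last v1)"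
    "weight a = Suc (weight v1)" "total_exp a = total_exp v1 + int N'"
    "path core_edges (start, 0) v1 V1 (q', 0)" "path core_edges (q', 0) v2 V2 (start, 0)"
    "(mstep ^^ weight v1) (start, N) (q', N')" "x = Inl (mark q')" "q' \<in> Q" "block_tail 0 v1 = 0"
    "block_tail 0 V1 = 0"
    "\<And>i. i < weight v1 \<Longrightarrow> \<exists>q'' N''. (mstep ^^ i) (start, N) (q'', N'') \<and>
       blocks 0 v1 ! i = (int N'', Inl (mark q''))"
proof -
  have wV: "weight V = weight v" by (rule core_path_weight[OF v(1)])
  have wab: "weight a + weight b = weight v + 2"
    using same_blocks_weight[OF inp] by simp
  have bl: "blocks 0 (start_word N @ V @ inv_word (start_word N)) =
      blocks 0 a @ (block_tail 0 a, x) # (0, inv_letter x) # blocks 0 b"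
    using out x by (simp add: same_blocks_def)
  have bl_inp: "blocks 0 (Inl 1 # v @ [Inr 1]) = blocks 0 a @ blocks (block_tail 0 a) b"
    using inp by (simp add: same_blocks_def)
  \<comment> \<open>Otherwise the cancelling pair would be the first two markers of the output,
    which are \<open>Inl 1\<close> and \<open>Inl 2\<close>.\<close>
  have "weight a \<noteq> 0"
  proof
    assume "weight a = 0"
    then have "blocks 0 a = []" by simp
    then show False using bl unfolding blocks_start_word by auto
  qed
  \<comment> \<open>Likewise the last two markers of the output, \<open>Inr 2\<close> and
    \<open>Inr 1\<close>, are not inverse to each other.\<close>
  moreover have "weight b \<noteq> 0"
  proof
    assume "weight b = 0"
    then have "blocks 0 b = []" by simp
    moreover have "blocks 0 (start_word N @ V @ inv_word (start_word N)) =
      (blocks 0 (start_word N @ V) @ [(block_tail 0 (start_word N @ V), Inr 2)]) @ [(- int N, Inr 1)]"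
      by (simp add: start_word_def)
    ultimately have "x = Inr 2" "inv_letter x = Inr 1" using bl
      by (simp_all add: append_eq_Cons_conv Cons_eq_append_conv)
    then show False by simp
  qed
  ultimately have i: "weight a - 1 \<le> weight v" using wab by simp
  \<comment> \<open>The first marker of \<open>a\<close> is the leading \<open>s\<close> of the
    input, which is not part of \<open>v\<close>; hence the weight
    \<open>weight a - 1\<close>.\<close>
  obtain v1 v2 where vs: "v = v1 @ v2" "weight v1 = weight a - 1" "v1 = [] \<or> marker (last v1)"
    using weight_split[OF i] .
  obtain V1 c V2 where p: "path core_edges (start, 0) v1 V1 c" "path core_edges c v2 V2 (start, 0)"
    "V = V1 @ V2"
    using v(1) unfolding vs(1) path_append_iff by blast
  have wV1: "weight V1 = weight v1" by (rule core_path_weight[OF p(1)])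
  have wa: "weight a = Suc (weight v1)" using vs(2) \<open>weight a \<noteq> 0\<close> by simp
  \<comment> \<open>Both sides have \<open>weight a + 1\<close> markers: on the left, two come from
    the start word and \<open>weight a - 1\<close> from \<open>V1\<close>.\<close>
  have "blocks 0 (start_word N @ V1) = blocks 0 a @ [(block_tail 0 a, x)]"
  proof -
    have "blocks 0 (start_word N @ V1) = take (Suc (weight a)) (blocks 0 (start_word N @ V @ inv_word (start_word N)))"
      using wV1 wa weight_start_word[of N] by (simp add: p(3))
    also have "\<dots> = blocks 0 a @ [(block_tail 0 a, x)]" unfolding bl by simp
    finally show ?thesis .
  qed
  moreover have a: "blocks 0 a = (0, Inl 1) # blocks 0 v1"
  proof -
    have "blocks 0 a = take (weight a) (blocks 0 (Inl 1 # v @ [Inr 1]))" unfolding bl_inp by simp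
    also have "\<dots> = (0, Inl 1) # blocks 0 v1" using wa by (simp add: vs(1))
    finally show ?thesis .
  qed
  ultimately have "blocks (int N) (Inl (mark start) # V1) = blocks 0 v1 @ [(block_tail 0 a, x)]"
    unfolding blocks_start_word by simp
  from valid_run[OF p(1) start_in_Q this] obtain q' N' where r:
    "(mstep ^^ weight v1) (start, N) (q', N')" "block_tail 0 a = int N'" "x = Inl (mark q')" "q' \<in> Q"
    "c = (q', nat (block_tail 0 v1 mod int (md q')))"
    "block_tail 0 V1 = int (mult q') * (block_tail 0 v1 div int (md q'))"
    "\<And>i. i < weight v1 \<Longrightarrow> \<exists>q'' N''. (mstep ^^ i) (start, N) (q'', N'') \<and>
       blocks 0 v1 ! i = (int N'', Inl (mark q''))"
    by blast
  have tail: "block_tail 0 v1 = 0"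
    using vs(3) by (cases v1 rule: rev_cases) auto
  then have c: "c = (q', 0)" "block_tail 0 V1 = 0" using r(5,6) by simp_all
  have "total_exp a = total_exp v1 + int N'"
    using total_exp_blocks[of 0 a] total_exp_blocks[of 0 v1] a r(2) tail by simp
  then show thesis
    using that[OF vs(1) p(3) vs(3) wa _ p(1)[unfolded c(1)] p(2)[unfolded c(1)] r(1,3,4) tail c(2) r(7)]
    by blast
qed

end


text \<open>Inversion turns the exponent behind the last marker into the exponent before the first
  one, with the opposite sign.\<close>

lemma hd_blocks_inv_word:
  "0 < weight u \<Longrightarrow> fst (hd (blocks k (inv_word u))) = k - block_tail 0 u"
proof (induction u arbitrary: k rule: rev_induct)
  case (snoc x u)
  then show ?case by (cases "marker x") auto
qed simp

lemma path_deterministic: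
  assumes "deterministic_edges G" "path G p w V q" "path G p w V' q'"
  shows "V = V' \<and> q = q'"
  using assms(2,3)
proof (induction arbitrary: V' rule: path.induct)
  case (path_Cons p x U q w V r)
  obtain U1 q1 V1 where "(p, x, U1, q1) \<in> G" "path G q1 w V1 q'" "V' = U1 @ V1"
    using path_Cons.prems by (auto simp: path_Cons_iff)
  moreover from this have "U1 = U" "q1 = q"
    using path_Cons.hyps(1) assms(1) unfolding deterministic_edges_def by blast+
  ultimately show ?case using path_Cons.IH by blast
qed simp

section \<open>Paths that return to the initial state\<close>

context modular_machine
begin

lemma deterministic_core_edges: "deterministic_edges core_edges"
  unfolding core_edges_def
  by (rule deterministic_symmetric_closure)
    (use core_edges_deterministic core_edges_codeterministic in blast)+

text \<open>\<open>half_run\<close>, applied to \<open>v\<close> and to its inverse, yields runs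
  \<open>v1\<close> and \<open>w1\<close> that stop in the state \<open>q\<close> named by the
  cancelled marker. Then \<open>v\<close> is \<open>v1\<close>, a markerless word \<open>us\<close>
  and the inverse of \<open>w1\<close>; it remains to show that \<open>us\<close> is empty and that
  \<open>v1 = w1\<close>.\<close>

lemma no_return_fixed_point:
  assumes v: "path core_edges (start, 0) v V (start, 0)"
    and red: "reduced (Inl 1 # v @ [Inr 1])" and x: "marker x"
    and out: "same_blocks (start_word N @ V @ inv_word (start_word N)) (a @ [x, inv_letter x] @ b)"
    and inp: "same_blocks (Inl 1 # v @ [Inr 1]) (a @ b)"
    and no_repeat: "\<And>i j c. (mstep ^^ i) (start, N) c \<Longrightarrow> (mstep ^^ j) (start, N) c \<Longrightarrow> i = j"
    and no_halt: "\<And>n N'. \<not> (mstep ^^ n) (start, N) (halt, N')"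
  shows False
proof -
  have rv: "reduced v"
    using red reduced_appendD(1)[of v "[Inr 1]"] by (simp add: reduced_Cons_iff)
  obtain v1 v2 V1 V2 q N1 where 1: "v = v1 @ v2" "V = V1 @ V2" "v1 = [] \<or> marker (last v1)"
    "weight a = Suc (weight v1)" "total_exp a = total_exp v1 + int N1"
    "path core_edges (start, 0) v1 V1 (q, 0)" "path core_edges (q, 0) v2 V2 (start, 0)"
    "(mstep ^^ weight v1) (start, N) (q, N1)" "x = Inl (mark q)" "q \<in> Q" "block_tail 0 v1 = 0"
    "block_tail 0 V1 = 0"
    "\<And>i. i < weight v1 \<Longrightarrow> \<exists>q'' N''. (mstep ^^ i) (start, N) (q'', N'') \<and>
       blocks 0 v1 ! i = (int N'', Inl (mark q''))"
    using half_run[OF v rv x out inp] by metis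
  note v' = path_inv_word[OF v core_edges_symmetric]
  have rv': "reduced (inv_word v)" using rv by simp
  have out': "same_blocks (start_word N @ inv_word V @ inv_word (start_word N))
      (inv_word b @ [x, inv_letter x] @ inv_word a)"
    using same_blocks_inv_word[OF out] by simp
  have inp': "same_blocks (Inl 1 # inv_word v @ [Inr 1]) (inv_word b @ inv_word a)"
    using same_blocks_inv_word[OF inp] by simp
  obtain w1 w2 W1 W2 q2 N2 where 2: "inv_word v = w1 @ w2" "inv_word V = W1 @ W2"
    "weight (inv_word b) = Suc (weight w1)" "total_exp (inv_word b) = total_exp w1 + int N2"
    "path core_edges (start, 0) w1 W1 (q2, 0)"
    "(mstep ^^ weight w1) (start, N) (q2, N2)" "x = Inl (mark q2)" "q2 \<in> Q" "block_tail 0 w1 = 0"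
    "block_tail 0 W1 = 0"
    "\<And>i. i < weight w1 \<Longrightarrow> \<exists>q'' N''. (mstep ^^ i) (start, N) (q'', N'') \<and>
       blocks 0 w1 ! i = (int N'', Inl (mark q''))"
    using half_run[OF v' rv' x out' inp'] by metis
  have q: "q2 = q" using 1(9,10) 2(7,8) mark_inj by auto
  have wv: "weight v1 + weight w1 = weight v"
    using same_blocks_weight[OF inp] 1(4) 2(3) by simp
  have v12: "v1 @ v2 = inv_word w2 @ inv_word w1"
    using arg_cong[OF 2(1), of inv_word] 1(1) by simp
  obtain us where us: "v2 = us @ inv_word w1"
  proof -
    from v12 consider us where "v1 = inv_word w2 @ us" "us @ v2 = inv_word w1"
      | us where "v1 @ us = inv_word w2" "v2 = us @ inv_word w1"
      unfolding append_eq_append_conv2 by blast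
    then show thesis
    proof cases
      \<comment> \<open>An overlap of the two halves has weight 0, since together they carry exactly
        the markers of \<open>v\<close>. It is empty because a nonempty \<open>v1\<close> ends in a
        marker.\<close>
      case (1 us)
      have "weight us + weight v2 = weight w1" using arg_cong[OF 1(2), of weight] by simp
      then have "weight us = 0" using wv \<open>v = v1 @ v2\<close> by simp
      have "us = []"
      proof (rule ccontr)
        assume "us \<noteq> []"
        then have "marker (last us)" using 1(1) \<open>v1 = [] \<or> marker (last v1)\<close> by auto
        then show False using \<open>weight us = 0\<close> \<open>us \<noteq> []\<close> by (cases us rule: rev_cases) auto
      qed
      then show thesis using that[of "[]"] 1 by simp
    qed (use that in blast)
  qed
  have wus: "weight us = 0" using wv 1(1) us by simp
  obtain Us c Z where p: "path core_edges (q, 0) us Us c" "path core_edges c (inv_word w1) Z (start, 0)"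
    "V2 = Us @ Z"
    using 1(7) unfolding us path_append_iff by blast
  \<comment> \<open>Reversed, this piece starts at \<open>(start, 0)\<close>, and determinism
    identifies it with the path of the second half. So \<open>us\<close> leads from
    \<open>(q, 0)\<close> back to \<open>(q, 0)\<close>.\<close>
  have "path core_edges (start, 0) w1 (inv_word Z) c"
    using path_inv_word[OF p(2) core_edges_symmetric] by simp
  from path_deterministic[OF deterministic_core_edges this 2(5)]
  have c: "c = (q, 0)" and Z: "Z = inv_word W1" using q inv_word_inv_word by auto
  have cyc: "(q, 0) = (q, nat (total_exp us mod int (md q)))"
    "total_exp Us = int (mult q) * (total_exp us div int (md q))"
    using cycle_path[OF p(1)[unfolded c] wus md_pos[OF 1(10)]] by auto
  \<comment> \<open>The two cancelled markers are adjacent, so the exponent between them is 0;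
    \<open>V1\<close> and \<open>W1\<close> have tail 0, hence that exponent comes from
    \<open>Us\<close> alone.\<close>
  have "total_exp Us = 0"
  proof -
    have wUs: "weight Us = 0" using core_path_weight[OF p(1)] wus by simp
    have wV1: "weight V1 = weight v1" by (rule core_path_weight[OF 1(6)])
    let ?l = "blocks 0 (start_word N @ V1)" and ?r = "inv_word (start_word N @ W1)"
    have "start_word N @ V @ inv_word (start_word N) = (start_word N @ V1) @ Us @ ?r"
      using 1(2) p(3) Z by simp
    moreover have "block_tail 0 (start_word N @ V1) = 0" using 1(12) by (simp add: start_word_def)
    ultimately have "blocks 0 (start_word N @ V @ inv_word (start_word N)) =
        ?l @ blocks (total_exp Us) ?r"
      using wUs by (simp only: blocks_append[of 0 "start_word N @ V1"] blocks_append[of 0 Us]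
        blocks_weight_0 block_tail_weight_0 append_Nil add_0)
    moreover have "blocks 0 (start_word N @ V @ inv_word (start_word N)) =
        blocks 0 a @ (block_tail 0 a, x) # (0, inv_letter x) # blocks 0 b"
      using out x by (simp add: same_blocks_def)
    ultimately have "?l @ blocks (total_exp Us) ?r =
        (blocks 0 a @ [(block_tail 0 a, x)]) @ (0, inv_letter x) # blocks 0 b" by simp
    moreover have "length ?l = length (blocks 0 a @ [(block_tail 0 a, x)])"
      using wV1 1(4) weight_start_word[of N] by simp
    ultimately have "blocks (total_exp Us) ?r = (0, inv_letter x) # blocks 0 b"
      by (metis append_eq_append_conv)
    then have "fst (hd (blocks (total_exp Us) ?r)) = 0" by simp
    moreover have "block_tail 0 (start_word N @ W1) = 0" using 2(10) by (simp add: start_word_def)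
    ultimately show ?thesis
      using hd_blocks_inv_word[of "start_word N @ W1" "total_exp Us"] weight_start_word[of N] by simp
  qed
  \<comment> \<open>Away from \<open>halt\<close>, \<open>mult q\<close> is positive, so output
    exponent 0 means no net turn of the cycle; as the residue at the end is 0 too, \<open>us\<close>
    has exponent 0.\<close>
  moreover have "q \<noteq> halt" using 1(8) no_halt by blast
  ultimately have "total_exp us div int (md q) = 0" using cyc(2) mult_pos[OF 1(10)] by simp
  moreover have "total_exp us mod int (md q) = 0"
  proof -
    have "0 \<le> total_exp us mod int (md q)" using md_pos[OF 1(10)] by simp
    then show ?thesis using cyc(1) by simp
  qed
  ultimately have "total_exp us = 0" by (metis mult_div_mod_eq mult_zero_right add_0)
  moreover have "reduced us" using rv 1(1) us reduced_appendD by metis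
  ultimately have "us = []"
    using reduced_blocks_inj[of us "[]"] wus by (simp add: reduced_Nil)
  then have v_eq: "v = v1 @ inv_word w1" using 1(1) us by simp
  \<comment> \<open>The left side is \<open>total_exp v1 - total_exp w1\<close>; the right side
    exceeds it by \<open>N1 - N2\<close>.\<close>
  have "total_exp (Inl 1 # v @ [Inr 1]) = total_exp (a @ b)" by (rule same_blocks_total_exp[OF inp])
  then have "N1 = N2" using 1(5) 2(4) v_eq by simp
  then have w: "weight v1 = weight w1" using no_repeat 1(8) 2(6) q by blast
  have "blocks 0 v1 = blocks 0 w1"
  proof (rule nth_equalityI)
    show "length (blocks 0 v1) = length (blocks 0 w1)" using w by simp
    fix i assume i: "i < length (blocks 0 v1)"
    obtain q3 N3 where 3: "(mstep ^^ i) (start, N) (q3, N3)" "blocks 0 v1 ! i = (int N3, Inl (mark q3))"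
      using 1(13) i by fastforce
    obtain q4 N4 where 4: "(mstep ^^ i) (start, N) (q4, N4)" "blocks 0 w1 ! i = (int N4, Inl (mark q4))"
      using 2(11) i w by fastforce
    show "blocks 0 v1 ! i = blocks 0 w1 ! i" using mstep_pow_deterministic[OF 3(1) 4(1)] 3(2) 4(2) by simp
  qed
  moreover have "reduced v1" "reduced w1"
    using rv rv' 1(1) 2(1) reduced_appendD(1) by metis+
  ultimately have "v1 = w1" using reduced_blocks_inj 1(11) 2(9) by metis
  then show False
  proof (cases v1 rule: rev_cases)
    case Nil
    then show False using red v_eq \<open>v1 = w1\<close> by (simp add: reduced_Cons_iff)
  next
    case (snoc ys y)
    then show False
      using red v_eq \<open>v1 = w1\<close> not_reduced[of "Inl 1 # ys" y "inv_word ys @ [Inr 1]"] by simp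
  qed
qed

theorem fixed_point_halts:
  assumes w: "reduced w" "w \<noteq> []" "path (input_edges N) 0 w V p" "(V, w) \<in> free_eq A"
    and no_repeat: "\<And>i j c. (mstep ^^ i) (start, N) c \<Longrightarrow> (mstep ^^ j) (start, N) c \<Longrightarrow> i = j"
  shows "\<exists>n N'. (mstep ^^ n) (start, N) (halt, N')"
proof -
  obtain x v where "w = x # v" using w(2) by (cases w) auto
  then obtain U q V' where 1: "(0, x, U, q) \<in> input_edges N" "path (input_edges N) q v V' p" "V = U @ V'"
    using w(3) by (auto simp: path_Cons_iff)
  then have e: "x = Inl 1" "U = start_word N" "q = state_code (start, 0)"
    using input_edge_from_0 by blast+
  have "reduced v" using w(1) \<open>w = x # v\<close> by (simp add: reduced_Cons_iff)
  note red = free_step_blocks[OF free_eq_imp_free_step[OF w(4,1)]]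
  from input_path_cases[OF 1(2)[unfolded e(3)] core_state_start \<open>reduced v\<close>] show ?thesis
  proof (elim disjE exE conjE)
    fix d assume "path core_edges (start, 0) v V' d"
    then have "weight V' = weight v" by (rule core_path_weight)
    then have "weight V = weight w + 1" using 1(3) e \<open>w = x # v\<close> by (simp add: weight_start_word)
    then show ?thesis using red by simp
  next
    fix v' assume v': "v = v' @ [Inl (mark halt)]" "path core_edges (start, 0) v' V' (halt, 0)"
    then have "weight V' = weight v'" using core_path_weight by blast
    then have "weight V = weight w" using 1(3) e \<open>w = x # v\<close> v'(1) by (simp add: weight_start_word)
    then have "same_blocks (start_word N @ V') (Inl 1 # v' @ [Inl (mark halt)])"
      using red 1(3) e \<open>w = x # v\<close> v'(1) by simp
    then show ?thesis using dead_end_fixed_point v'(2) by blast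
  next
    fix v' V'' assume v': "v = v' @ [Inr 1]" "V' = V'' @ inv_word (start_word N)"
      "path core_edges (start, 0) v' V'' (start, 0)"
    then have "weight V'' = weight v'" using core_path_weight by blast
    then have "weight V = weight w + 2"
      using 1(3) e \<open>w = x # v\<close> v'(1,2) by (simp add: weight_start_word)
    then obtain a x' b where x': "marker x'"
      "same_blocks V (a @ [x', inv_letter x'] @ b)" "same_blocks w (a @ b)"
      using red by blast
    have eq: "V = start_word N @ V'' @ inv_word (start_word N)" "w = Inl 1 # v' @ [Inr 1]"
      using 1(3) e \<open>w = x # v\<close> v'(1,2) by simp_all
    show ?thesis
    proof (rule ccontr)
      assume no_halt: "\<not> ?thesis"
      show False
        by (rule no_return_fixed_point[OF v'(3) w(1)[unfolded eq] x'[unfolded eq]])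
          (use no_repeat no_halt in blast)+
    qed
  qed
qed

end


section \<open>Register programs\<close>

text \<open>Structured loops replace jumps: programs compose by concatenation, and a configuration
  needs only the list of commands still to be run. \<open>Loop i cs\<close> decrements register
  \<open>i\<close> before each pass.\<close>

datatype cmd = Inc nat | Loop nat "cmd list"

type_synonym config = "cmd list \<times> (nat \<Rightarrow> nat)"

fun next_config :: "config \<Rightarrow> config" where
  "next_config ([], r) = ([], r)"
| "next_config (Inc i # K, r) = (K, r(i := Suc (r i)))"
| "next_config (Loop i cs # K, r) =
    (if r i = 0 then (K, r) else (cs @ Loop i cs # K, r(i := r i - 1)))"

definition terminates :: "cmd list \<Rightarrow> (nat \<Rightarrow> nat) \<Rightarrow> bool" where
  "terminates K r \<longleftrightarrow> (\<exists>n. fst ((next_config ^^ n) (K, r)) = [])"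

text \<open>The same number of steps has to serve for every continuation \<open>K\<close>, so that
  executions compose.\<close>

definition exec :: "cmd list \<Rightarrow> (nat \<Rightarrow> nat) \<Rightarrow> (nat \<Rightarrow> nat) \<Rightarrow> bool" where
  "exec cs r r' \<longleftrightarrow> (\<exists>n. \<forall>K. (next_config ^^ n) (cs @ K, r) = (K, r'))"

definition diverges :: "cmd list \<Rightarrow> (nat \<Rightarrow> nat) \<Rightarrow> bool" where
  "diverges cs r \<longleftrightarrow> (\<forall>K. \<not> terminates (cs @ K) r)"

section \<open>Execution, termination and divergence of register programs\<close>

lemma next_config_pow_Nil: "fst c = [] \<Longrightarrow> (next_config ^^ n) c = c"
  by (cases c) (induction n, auto)

lemma next_config_pow_mono:
  assumes "fst ((next_config ^^ m) c) = []" "m \<le> n"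
  shows "fst ((next_config ^^ n) c) = []"
proof -
  have "(next_config ^^ n) c = (next_config ^^ (n - m)) ((next_config ^^ m) c)"
    using assms(2) by (metis funpow_add comp_apply le_add_diff_inverse2)
  then show ?thesis using next_config_pow_Nil[OF assms(1)] assms(1) by simp
qed

lemma terminates_Nil: "terminates [] r"
  unfolding terminates_def by (intro exI[of _ 0]) simp

lemma terminates_pow:
  assumes "(next_config ^^ n) (K, r) = (K', r')"
  shows "terminates K r \<longleftrightarrow> terminates K' r'"
proof
  assume "terminates K r"
  then obtain m where m: "fst ((next_config ^^ m) (K, r)) = []" by (auto simp: terminates_def)
  have "fst ((next_config ^^ (m + n)) (K, r)) = []" by (rule next_config_pow_mono[OF m]) simp
  then show "terminates K' r'" using assms by (auto simp: terminates_def funpow_add)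
next
  assume "terminates K' r'"
  then obtain m where "fst ((next_config ^^ m) (K', r')) = []" by (auto simp: terminates_def)
  then have "fst ((next_config ^^ (m + n)) (K, r)) = []" using assms by (simp add: funpow_add)
  then show "terminates K r" by (auto simp: terminates_def)
qed

lemma exec_terminates: "exec cs r r' \<Longrightarrow> terminates (cs @ K) r \<longleftrightarrow> terminates K r'"
  unfolding exec_def using terminates_pow by blast

lemma exec_Nil: "exec [] r r"
  unfolding exec_def by (intro exI[of _ 0]) simp

lemma exec_append: "exec a r r1 \<Longrightarrow> exec b r1 r2 \<Longrightarrow> exec (a @ b) r r2"
proof -
  assume "exec a r r1" "exec b r1 r2"
  then obtain m n where "\<And>K. (next_config ^^ m) (a @ K, r) = (K, r1)"
    "\<And>K. (next_config ^^ n) (b @ K, r1) = (K, r2)"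
    unfolding exec_def by blast
  then have "(next_config ^^ (n + m)) ((a @ b) @ K, r) = (K, r2)" for K by (simp add: funpow_add)
  then show ?thesis unfolding exec_def by blast
qed

lemma exec_Cons: "exec [c] r r1 \<Longrightarrow> exec b r1 r2 \<Longrightarrow> exec (c # b) r r2"
  using exec_append[of "[c]"] by simp

lemma exec_Inc: "exec [Inc i] r (r(i := Suc (r i)))"
  unfolding exec_def by (intro exI[of _ 1]) simp

lemma exec_Loop_0: "r i = 0 \<Longrightarrow> exec [Loop i cs] r r"
  unfolding exec_def by (intro exI[of _ 1]) simp

lemma exec_Loop_Suc:
  assumes "0 < r i" "exec cs (r(i := r i - 1)) r1" "exec [Loop i cs] r1 r2"
  shows "exec [Loop i cs] r r2"
proof -
  obtain m where m: "\<And>K. (next_config ^^ m) (cs @ K, r(i := r i - 1)) = (K, r1)"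
    using assms(2) unfolding exec_def by blast
  obtain n where n: "\<And>K. (next_config ^^ n) ([Loop i cs] @ K, r1) = (K, r2)"
    using assms(3) unfolding exec_def by blast
  have "(next_config ^^ (n + m + 1)) ([Loop i cs] @ K, r) = (K, r2)" for K
    using assms(1) m n by (simp add: funpow_add funpow_swap1)
  then show ?thesis unfolding exec_def by blast
qed

lemma diverges_append1: "diverges a r \<Longrightarrow> diverges (a @ b) r"
  by (simp add: diverges_def)

lemma diverges_append2: "exec a r r1 \<Longrightarrow> diverges b r1 \<Longrightarrow> diverges (a @ b) r"
  by (simp add: diverges_def exec_terminates)

lemma diverges_Loop_body:
  assumes "0 < r i" "diverges cs (r(i := r i - 1))"
  shows "diverges [Loop i cs] r"
proof -
  have "terminates ([Loop i cs] @ K) r \<longleftrightarrow> terminates (cs @ Loop i cs # K) (r(i := r i - 1))" for K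
    using assms(1) by (intro terminates_pow[of 1]) simp
  then show ?thesis using assms(2) by (simp add: diverges_def)
qed

lemma diverges_Loop_Suc:
  assumes "0 < r i" "exec cs (r(i := r i - 1)) r1" "diverges [Loop i cs] r1"
  shows "diverges [Loop i cs] r"
proof -
  have "terminates ([Loop i cs] @ K) r \<longleftrightarrow> terminates (cs @ Loop i cs # K) (r(i := r i - 1))" for K
    using assms(1) by (intro terminates_pow[of 1]) simp
  then show ?thesis using exec_terminates[OF assms(2)] assms(3) by (simp add: diverges_def)
qed

text \<open>\<open>\<rho> k\<close> holds the registers at the loop head before pass
  \<open>k\<close>. Every pass costs at least one step, so strong induction on the number of steps
  applies.\<close>

lemma diverges_Loop:
  assumes "\<And>k. 0 < \<rho> k i" "\<And>k. exec cs ((\<rho> k)(i := \<rho> k i - 1)) (\<rho> (Suc k))"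
  shows "diverges [Loop i cs] (\<rho> 0)"
proof -
  have "fst ((next_config ^^ n) (Loop i cs # K, \<rho> k)) \<noteq> []" for n k K
  proof (induction n arbitrary: k rule: less_induct)
    case (less n)
    obtain m where m: "\<And>K. (next_config ^^ m) (cs @ K, (\<rho> k)(i := \<rho> k i - 1)) = (K, \<rho> (Suc k))"
      using assms(2) unfolding exec_def by blast
    have *: "(next_config ^^ (m + 1)) (Loop i cs # K, \<rho> k) = (Loop i cs # K, \<rho> (Suc k))"
      using m[of "Loop i cs # K"] assms(1)[of k] by (simp add: funpow_swap1)
    show ?case
    proof (cases "n \<le> m + 1")
      case True
      then show ?thesis using next_config_pow_mono[of n _ "m + 1"] * by fastforce
    next
      case False
      then have "(next_config ^^ n) (Loop i cs # K, \<rho> k) =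
          (next_config ^^ (n - (m + 1))) ((next_config ^^ (m + 1)) (Loop i cs # K, \<rho> k))"
        by (metis funpow_add comp_apply le_add_diff_inverse2 nat_le_linear)
      then show ?thesis using less[of "n - (m + 1)" "Suc k"] False * by simp
    qed
  qed
  then show ?thesis by (auto simp: diverges_def terminates_def)
qed

lemma exec_clear: "exec [Loop i []] r (r(i := 0))"
proof (induction "r i" arbitrary: r)
  case 0
  then have "r(i := 0) = r" by (simp add: fun_upd_idem)
  then show ?case using exec_Loop_0[of r i "[]"] 0 by simp
next
  case (Suc n)
  have "exec [Loop i []] (r(i := n)) ((r(i := n))(i := 0))" by (rule Suc.hyps(1)) simp
  then have "exec [Loop i []] (r(i := r i - 1)) (r(i := 0))"
    by (simp add: Suc.hyps(2)[symmetric])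
  moreover have "0 < r i" using Suc.hyps(2) by simp
  ultimately show ?case using exec_Loop_Suc[OF _ exec_Nil] by blast
qed

lemma exec_clear_list:
  "exec (map (\<lambda>i. Loop i []) is) r (\<lambda>k. if k \<in> set is then 0 else r k)"
proof (induction "is" arbitrary: r)
  case (Cons i "is")
  have "(\<lambda>k. if k \<in> set is then 0 else (r(i := 0)) k) = (\<lambda>k. if k \<in> set (i # is) then 0 else r k)"
    by auto
  then show ?case using exec_Cons[OF exec_clear Cons, of i r] by simp
qed (simp add: exec_Nil)

lemma exec_move: "i \<noteq> j \<Longrightarrow> exec [Loop i [Inc j]] r (r(i := 0, j := r j + r i))"
proof (induction "r i" arbitrary: r)
  case 0
  then have eq: "r(i := 0, j := r j + r i) = r" by (auto simp: fun_eq_iff)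
  show ?case unfolding eq by (rule exec_Loop_0) (use 0 in simp)
next
  case (Suc n)
  let ?r = "r(i := n, j := Suc (r j))"
  have "exec [Loop i [Inc j]] ?r (?r(i := 0, j := ?r j + ?r i))"
    using Suc by (intro Suc.hyps(1)) auto
  moreover have "?r(i := 0, j := ?r j + ?r i) = r(i := 0, j := r j + r i)"
    using Suc.prems Suc.hyps(2)[symmetric] by (auto simp: fun_eq_iff)
  moreover have "exec [Inc j] (r(i := r i - 1)) ?r"
    using exec_Inc[of j "r(i := n)"] Suc.prems Suc.hyps(2)[symmetric] by simp
  moreover have "0 < r i" using Suc.hyps(2) by simp
  ultimately show ?case using exec_Loop_Suc[of r i "[Inc j]" ?r] by simp
qed

text \<open>A register can only be read by emptying it: its content goes to \<open>j\<close> and to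
  the scratch register \<open>t\<close>, from which it is restored.\<close>

definition copy :: "nat \<Rightarrow> nat \<Rightarrow> nat \<Rightarrow> cmd list" where
  "copy i j t = [Loop i [Inc j, Inc t], Loop t [Inc i]]"

lemma exec_copy:
  assumes "i \<noteq> j" "i \<noteq> t" "j \<noteq> t" "r t = 0"
  shows "exec (copy i j t) r (r(j := r j + r i))"
proof -
  have 1: "exec [Loop i [Inc j, Inc t]] r (r(i := 0, j := r j + r i, t := r t + r i))" for r
    using assms(1-3)
  proof (induction "r i" arbitrary: r)
    case 0
    then have eq: "r(i := 0, j := r j + r i, t := r t + r i) = r" by (auto simp: fun_eq_iff)
    show ?case unfolding eq by (rule exec_Loop_0) (use 0 in simp)
  next
    case (Suc n)
    let ?r = "r(i := n, j := Suc (r j), t := Suc (r t))"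
    have "exec [Loop i [Inc j, Inc t]] ?r (?r(i := 0, j := ?r j + ?r i, t := ?r t + ?r i))"
      using Suc by (intro Suc.hyps(1)) auto
    moreover have "?r(i := 0, j := ?r j + ?r i, t := ?r t + ?r i) =
        r(i := 0, j := r j + r i, t := r t + r i)"
      using Suc.prems Suc.hyps(2)[symmetric] by (auto simp: fun_eq_iff)
    moreover have "exec [Inc j, Inc t] (r(i := r i - 1)) ?r"
      using exec_Cons[OF exec_Inc[of j "r(i := n)"] exec_Inc[of t]] Suc.prems Suc.hyps(2)[symmetric] by simp
    moreover have "0 < r i" using Suc.hyps(2) by simp
    ultimately show ?case using exec_Loop_Suc[of r i "[Inc j, Inc t]" ?r] by simp
  qed
  let ?r = "r(i := 0, j := r j + r i, t := r t + r i)"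
  have "?r(t := 0, i := ?r i + ?r t) = r(j := r j + r i)" using assms by (auto simp: fun_eq_iff)
  then show ?thesis using exec_Cons[OF 1[of r] exec_move[of t i ?r]] assms(2) by (simp add: copy_def)
qed


subsection \<open>Partial recursive functions as register programs\<close>

text \<open>Inputs are preserved and all registers from \<open>fr\<close> on are zero again at the
  end; this invariant lets such programs be concatenated and used as loop bodies.\<close>

definition realizes :: "recf \<Rightarrow> nat list \<Rightarrow> nat \<Rightarrow> nat \<Rightarrow> cmd list \<Rightarrow> bool" where
  "realizes f ins out fr cs \<longleftrightarrow> (\<forall>r. r out = 0 \<longrightarrow> (\<forall>k\<ge>fr. r k = 0) \<longrightarrow>
     (\<forall>y. computes f (map r ins) y \<longrightarrow> exec cs r (r(out := y))) \<and>
     ((\<nexists>y. computes f (map r ins) y) \<longrightarrow> diverges cs r))"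

lemma realizesI:
  assumes "\<And>r y. r out = 0 \<Longrightarrow> \<forall>k\<ge>fr. r k = 0 \<Longrightarrow> computes f (map r ins) y \<Longrightarrow> exec cs r (r(out := y))"
    and "\<And>r. r out = 0 \<Longrightarrow> \<forall>k\<ge>fr. r k = 0 \<Longrightarrow> \<nexists>y. computes f (map r ins) y \<Longrightarrow> diverges cs r"
  shows "realizes f ins out fr cs"
  using assms unfolding realizes_def by blast

lemma realizes_exec:
  "realizes f ins out fr cs \<Longrightarrow> r out = 0 \<Longrightarrow> \<forall>k\<ge>fr. r k = 0 \<Longrightarrow> computes f (map r ins) y \<Longrightarrow>
    exec cs r (r(out := y))"
  unfolding realizes_def by blast

lemma realizes_diverges:
  "realizes f ins out fr cs \<Longrightarrow> r out = 0 \<Longrightarrow> \<forall>k\<ge>fr. r k = 0 \<Longrightarrow> \<nexists>y. computes f (map r ins) y \<Longrightarrow>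
    diverges cs r"
  unfolding realizes_def by blast

text \<open>Serves the terms that are applied to a tuple of the wrong length, where
  \<open>computes\<close> yields no value: the program loops forever.\<close>

lemma realizes_undefined:
  assumes "\<And>xs y. length xs = length ins \<Longrightarrow> \<not> computes f xs y"
  shows "realizes f ins out fr [Inc fr, Loop fr [Inc fr]]"
proof (rule realizesI)
  fix r :: "nat \<Rightarrow> nat" assume "\<forall>k\<ge>fr. r k = 0"
  have "exec [Inc fr] ((r(fr := 1))(fr := (r(fr := 1)) fr - 1)) (r(fr := 1))"
    using exec_Inc[of fr "r(fr := 0)"] by simp
  then have "diverges [Loop fr [Inc fr]] (r(fr := 1))"
    by (intro diverges_Loop[where \<rho> = "\<lambda>k. r(fr := 1)"]) auto
  moreover have "exec [Inc fr] r (r(fr := 1))"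
    using exec_Inc[of fr r] \<open>\<forall>k\<ge>fr. r k = 0\<close> by simp
  ultimately show "diverges [Inc fr, Loop fr [Inc fr]] r"
    using diverges_append2[of "[Inc fr]"] by simp
qed (use assms in simp)

text \<open>The values of \<open>gs\<close> are collected in consecutive registers from
  \<open>fr\<close> on. Each program uses only the registers beyond its own result as scratch
  space.\<close>

lemma realizes_Comp:
  assumes gs: "\<And>g ins out fr. g \<in> set gs \<Longrightarrow> \<forall>i\<in>set ins. i < fr \<Longrightarrow> out < fr \<Longrightarrow> out \<notin> set ins \<Longrightarrow>
      \<exists>cs. realizes g ins out fr cs"
    and f: "\<And>ins out fr. \<forall>i\<in>set ins. i < fr \<Longrightarrow> out < fr \<Longrightarrow> out \<notin> set ins \<Longrightarrow>
      \<exists>cs. realizes f ins out fr cs"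
    and ins: "\<forall>i\<in>set ins. i < fr" "out < fr" "out \<notin> set ins"
  shows "\<exists>cs. realizes (Comp f gs) ins out fr cs"
proof -
  define upd :: "(nat \<Rightarrow> nat) \<Rightarrow> nat \<Rightarrow> nat list \<Rightarrow> nat \<Rightarrow> nat" where
    "upd r b ys = (\<lambda>k. if b \<le> k \<and> k < b + length ys then ys ! (k - b) else r k)" for r b ys
  have list: "\<exists>cs. \<forall>r. (\<forall>k\<ge>b. r k = 0) \<longrightarrow>
      (\<forall>ys. list_all2 (\<lambda>g y. computes g (map r ins) y) gs ys \<longrightarrow> exec cs r (upd r b ys)) \<and>
      ((\<nexists>ys. list_all2 (\<lambda>g y. computes g (map r ins) y) gs ys) \<longrightarrow> diverges cs r)"
    if "fr \<le> b" for b
    using gs that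
  proof (induction gs arbitrary: b)
    case Nil
    have "upd r b [] = r" for r by (auto simp: upd_def)
    then show ?case by (intro exI[of _ "[]"]) (simp add: exec_Nil)
  next
    case (Cons g gs)
    have b: "\<forall>i\<in>set ins. i < Suc b" "b \<notin> set ins"
      using ins(1) Cons.prems(2) by (auto simp: less_Suc_eq)
    then obtain c where c: "realizes g ins b (Suc b) c" using Cons.prems(1)[of g ins "Suc b" b] by auto
    obtain cs where cs: "\<And>r. \<forall>k\<ge>Suc b. r k = 0 \<Longrightarrow>
      (\<forall>ys. list_all2 (\<lambda>g y. computes g (map r ins) y) gs ys \<longrightarrow> exec cs r (upd r (Suc b) ys)) \<and>
      ((\<nexists>ys. list_all2 (\<lambda>g y. computes g (map r ins) y) gs ys) \<longrightarrow> diverges cs r)"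
      using Cons.IH[of "Suc b"] Cons.prems by (auto simp del: map_eq_conv)
    have "(\<forall>ys. list_all2 (\<lambda>g y. computes g (map r ins) y) (g # gs) ys \<longrightarrow> exec (c @ cs) r (upd r b ys)) \<and>
        ((\<nexists>ys. list_all2 (\<lambda>g y. computes g (map r ins) y) (g # gs) ys) \<longrightarrow> diverges (c @ cs) r)"
      if r: "\<forall>k\<ge>b. r k = 0" for r
    proof (cases "\<exists>y. computes g (map r ins) y")
      case False
      then have "diverges (c @ cs) r"
        using realizes_diverges[OF c _ _ False] r by (intro diverges_append1) auto
      then show ?thesis using False by (auto simp: list_all2_Cons1)
    next
      case True
      then obtain y where y: "computes g (map r ins) y" by blast
      let ?r = "r(b := y)"
      have e: "exec c r ?r" using realizes_exec[OF c _ _ y] r by auto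
      have m: "map ?r ins = map r ins" using b(2) by simp
      have z: "\<forall>k\<ge>Suc b. ?r k = 0" using r by auto
      have u: "upd ?r (Suc b) ys = upd r b (y # ys)" for ys
        by (auto simp: upd_def fun_eq_iff nth_Cons')
      note rest = cs[OF z, unfolded m]
      have "exec (c @ cs) r (upd r b ys)"
        if all: "list_all2 (\<lambda>g y. computes g (map r ins) y) (g # gs) ys" for ys
      proof -
        obtain y' ys' where ys: "ys = y' # ys'" "computes g (map r ins) y'"
          "list_all2 (\<lambda>g y. computes g (map r ins) y) gs ys'"
          using all by (auto simp: list_all2_Cons1)
        then have "ys = y # ys'" using computes_deterministic[OF y ys(2)] by simp
        moreover have "exec cs ?r (upd ?r (Suc b) ys')" using rest ys(3) by blast
        ultimately show ?thesis using exec_append[OF e] u by simp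
      qed
      moreover have "diverges (c @ cs) r"
        if "\<nexists>ys. list_all2 (\<lambda>g y. computes g (map r ins) y) (g # gs) ys"
      proof -
        have "\<nexists>ys. list_all2 (\<lambda>g y. computes g (map r ins) y) gs ys"
          using that y by (auto simp: list_all2_Cons1)
        then show ?thesis using diverges_append2[OF e] rest by blast
      qed
      ultimately show ?thesis by blast
    qed
    then show ?case by blast
  qed
  let ?n = "length gs"
  let ?o = "[fr..<fr + ?n]"
  obtain c1 where c1: "\<And>r. \<forall>k\<ge>fr. r k = 0 \<Longrightarrow>
      (\<forall>ys. list_all2 (\<lambda>g y. computes g (map r ins) y) gs ys \<longrightarrow> exec c1 r (upd r fr ys)) \<and>
      ((\<nexists>ys. list_all2 (\<lambda>g y. computes g (map r ins) y) gs ys) \<longrightarrow> diverges c1 r)"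
    using list[of fr] by blast
  obtain c2 where c2: "realizes f ?o out (fr + ?n) c2"
    using f[of ?o "fr + ?n" out] ins(2) by auto
  \<comment> \<open>The collected values are erased, to restore zero scratch registers.\<close>
  let ?c3 = "map (\<lambda>i. Loop i []) ?o"
  have "realizes (Comp f gs) ins out fr (c1 @ c2 @ ?c3)"
  proof (rule realizesI)
    fix r z assume r: "r out = 0" "\<forall>k\<ge>fr. r k = 0" and "computes (Comp f gs) (map r ins) z"
    then obtain ys where ys: "list_all2 (\<lambda>g y. computes g (map r ins) y) gs ys" "computes f ys z"
      by (auto elim: computesE)
    have l: "length ys = ?n" using list_all2_lengthD[OF ys(1)] by simp
    let ?r = "upd r fr ys"
    have 1: "exec c1 r ?r" using c1[OF r(2)] ys(1) by blast
    have "map ?r ?o = ys" using l by (auto simp: upd_def intro: nth_equalityI)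
    then have 2: "exec c2 ?r (?r(out := z))"
      using r l ins(2) ys(2) by (intro realizes_exec[OF c2]) (auto simp: upd_def)
    have "(\<lambda>k. if k \<in> set ?o then 0 else (?r(out := z)) k) = r(out := z)"
      using r l ins(2) by (auto simp: upd_def fun_eq_iff)
    then show "exec (c1 @ c2 @ ?c3) r (r(out := z))"
      using exec_append[OF 1 exec_append[OF 2 exec_clear_list[of ?o]]] by simp
  next
    fix r assume r: "r out = 0" "\<forall>k\<ge>fr. r k = 0" and no: "\<nexists>z. computes (Comp f gs) (map r ins) z"
    show "diverges (c1 @ c2 @ ?c3) r"
    proof (cases "\<exists>ys. list_all2 (\<lambda>g y. computes g (map r ins) y) gs ys")
      case False
      then show ?thesis using c1[OF r(2)] diverges_append1 by blast
    next
      case True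
      then obtain ys where ys: "list_all2 (\<lambda>g y. computes g (map r ins) y) gs ys" by blast
      have l: "length ys = ?n" using list_all2_lengthD[OF ys] by simp
      let ?r = "upd r fr ys"
      have "map ?r ?o = ys" using l by (auto simp: upd_def intro: nth_equalityI)
      moreover have "\<nexists>z. computes f ys z" using no ys computes.comp by blast
      ultimately have "diverges c2 ?r"
        using r l ins(2) by (intro realizes_diverges[OF c2]) (auto simp: upd_def)
      then show ?thesis using c1[OF r(2)] ys diverges_append1 diverges_append2 by blast
    qed
  qed
  then show ?thesis by blast
qed

text \<open>A value is computed through the values at all smaller arguments. Hence a diverging pass
  of the loop means that all later values are undefined.\<close>

lemma computes_PrimRec_down:
  "computes (PrimRec f g) ((m + c) # xs) z \<Longrightarrow> \<exists>y. computes (PrimRec f g) (m # xs) y"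
proof (induction c arbitrary: z)
  case (Suc c)
  from Suc.prems show ?case by (auto elim: computesE(6) intro: Suc.IH)
qed auto

text \<open>Register \<open>fr\<close> counts the passes still to run, starting from a copy of the
  argument; \<open>fr + 1\<close> holds the recursion index, \<open>out\<close> the value reached
  and \<open>fr + 2\<close> receives the next value. In the proof \<open>S m c y\<close> is the
  register state with index \<open>m\<close>, \<open>c\<close> passes left and value
  \<open>y\<close>.\<close>

lemma realizes_PrimRec:
  assumes f: "\<And>ins out fr. \<forall>i\<in>set ins. i < fr \<Longrightarrow> out < fr \<Longrightarrow> out \<notin> set ins \<Longrightarrow>
      \<exists>cs. realizes f ins out fr cs"
    and g: "\<And>ins out fr. \<forall>i\<in>set ins. i < fr \<Longrightarrow> out < fr \<Longrightarrow> out \<notin> set ins \<Longrightarrow>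
      \<exists>cs. realizes g ins out fr cs"
    and ins: "\<forall>i\<in>set (a # ins). i < fr" "out < fr" "out \<notin> set (a # ins)"
  shows "\<exists>cs. realizes (PrimRec f g) (a # ins) out fr cs"
proof -
  let ?P = "PrimRec f g"
  obtain cf where cf: "realizes f ins out (fr + 3) cf"
  proof -
    have "\<forall>i\<in>set ins. i < fr + 3" using ins(1) by (simp add: trans_less_add1)
    then show thesis using f[of ins "fr + 3" out] ins that by auto
  qed
  obtain cg where cg: "realizes g ((fr + 1) # out # ins) (fr + 2) (fr + 3) cg"
    using g[of "(fr + 1) # out # ins" "fr + 3" "fr + 2"] ins by fastforce
  let ?body = "cg @ [Loop out []] @ [Loop (fr + 2) [Inc out]] @ [Inc (fr + 1)]"
  let ?cs = "copy a fr (fr + 1) @ cf @ [Loop fr ?body] @ [Loop (fr + 1) []]"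
  have main: "(\<forall>z. computes ?P (r a # map r ins) z \<longrightarrow> exec ?cs r (r(out := z))) \<and>
      ((\<nexists>z. computes ?P (r a # map r ins) z) \<longrightarrow> diverges ?cs r)"
    if r: "r out = 0" "\<forall>k\<ge>fr. r k = 0" for r
  proof -
    define S where "S m c y = r(fr := c, fr + 1 := m, out := y)" for m c y :: nat
    let ?xs = "map r ins"
    have S_ins: "map (S m c y) ins = ?xs" for m c y using ins by (auto simp: S_def)
    have S_0: "\<forall>k\<ge>fr + 2. S m c y k = 0" for m c y using r ins(2) by (auto simp: S_def)
    have S_vals: "S m c y fr = c" "S m c y (fr + 1) = m" "S m c y out = y" for m c y
      using ins(2) by (auto simp: S_def)
    have S_upd: "(S m c y)(fr := c') = S m c' y" "(S m c y)(fr + 1 := m') = S m' c y"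
      "(S m c y)(out := y') = S m c y'" for m c y m' c' y'
      using ins(2) by (auto simp: S_def fun_eq_iff)
    have S_arg: "map (S m c y) ((fr + 1) # out # ins) = m # y # ?xs" for m c y
      by (simp only: list.map S_vals S_ins)
    have S_tmp: "S m c y (fr + 2) = 0" "\<forall>k\<ge>fr + 3. S m c y k = 0" for m c y
      using S_0[of m c y] by simp_all
    have body: "exec ?body (S m c y) (S (Suc m) c y')" if "computes g (m # y # ?xs) y'" for m c y y'
    proof -
      let ?r1 = "(S m c y)(fr + 2 := y')"
      have "exec cg (S m c y) ?r1"
        using realizes_exec[OF cg S_tmp, unfolded S_arg, OF that] .
      moreover have "exec [Loop out []] ?r1 (?r1(out := 0))" by (rule exec_clear)
      moreover have "exec [Loop (fr + 2) [Inc out]] (?r1(out := 0)) (S m c y')"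
      proof -
        have "(?r1(out := 0))(fr + 2 := 0, out := (?r1(out := 0)) out + (?r1(out := 0)) (fr + 2)) =
          S m c y'" using ins(2) r(2) by (auto simp: S_def fun_eq_iff)
        then show ?thesis using exec_move[of "fr + 2" out "?r1(out := 0)"] ins(2) by simp
      qed
      moreover have "exec [Inc (fr + 1)] (S m c y') (S (Suc m) c y')"
        using exec_Inc[of "fr + 1" "S m c y'"] unfolding S_vals S_upd .
      ultimately show ?thesis by (blast intro: exec_append)
    qed
    have body_div: "diverges ?body (S m c y)" if "\<nexists>y'. computes g (m # y # ?xs) y'" for m c y
      using diverges_append1 realizes_diverges[OF cg S_tmp, unfolded S_arg, OF that] by blast
    \<comment> \<open>The sum \<open>m + c\<close> is the loop invariant; it is the argument at
      which the recursion is evaluated.\<close>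
    have loop: "(\<forall>z. computes ?P ((m + c) # ?xs) z \<longrightarrow> exec [Loop fr ?body] (S m c y) (S (m + c) 0 z)) \<and>
        ((\<nexists>z. computes ?P ((m + c) # ?xs) z) \<longrightarrow> diverges [Loop fr ?body] (S m c y))"
      if "computes ?P (m # ?xs) y" for m c y
      using that
    proof (induction c arbitrary: m y)
      case 0
      have "exec [Loop fr ?body] (S m 0 y) (S m 0 y)" by (rule exec_Loop_0) (rule S_vals)
      then show ?case using 0 computes_deterministic by auto
    next
      case (Suc c)
      have pos: "0 < S m (Suc c) y fr" and dec: "(S m (Suc c) y)(fr := S m (Suc c) y fr - 1) = S m c y"
        unfolding S_vals S_upd by simp_all
      show ?case
      proof (cases "\<exists>y'. computes g (m # y # ?xs) y'")
        case True
        then obtain y' where y': "computes g (m # y # ?xs) y'" by blast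
        have b: "exec ?body ((S m (Suc c) y)(fr := S m (Suc c) y fr - 1)) (S (Suc m) c y')"
          unfolding dec by (rule body[OF y'])
        have "computes ?P (Suc m # ?xs) y'" by (rule computes.primrec_Suc[OF Suc.prems y'])
        note IH = Suc.IH[OF this]
        show ?thesis
          using IH exec_Loop_Suc[of "S m (Suc c) y", OF pos b] diverges_Loop_Suc[of "S m (Suc c) y", OF pos b]
          by simp
      next
        case False
        have "\<not> computes ?P ((m + Suc c) # ?xs) z" for z
        proof
          assume "computes ?P ((m + Suc c) # ?xs) z"
          then obtain y' where "computes ?P (Suc m # ?xs) y'"
            using computes_PrimRec_down[of f g "Suc m" c ?xs z] by auto
          then obtain y2 where "computes ?P (m # ?xs) y2" "computes g (m # y2 # ?xs) y'"
            by (rule computesE(6))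
          then show False using False Suc.prems computes_deterministic by blast
        qed
        moreover have "diverges [Loop fr ?body] (S m (Suc c) y)"
          by (rule diverges_Loop_body[of "S m (Suc c) y", OF pos]) (use body_div[OF False] dec in simp)
        ultimately show ?thesis by blast
      qed
    qed
    have 1: "exec (copy a fr (fr + 1)) r (S 0 (r a) 0)"
    proof -
      have "r(fr := r fr + r a) = S 0 (r a) 0" using r ins(2) by (auto simp: S_def fun_eq_iff)
      then show ?thesis using exec_copy[of a fr "fr + 1" r] r ins by auto
    qed
    show ?thesis
    proof (cases "\<exists>y. computes f ?xs y")
      case True
      then obtain y where y: "computes f ?xs y" by blast
      have "exec cf (S 0 (r a) 0) ((S 0 (r a) 0)(out := y))"
        using realizes_exec[OF cf S_vals(3)[of 0 "r a" 0] S_tmp(2), unfolded S_ins, OF y] .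
      then have 2: "exec cf (S 0 (r a) 0) (S 0 (r a) y)" unfolding S_upd .
      have "computes ?P (0 # ?xs) y" by (rule computes.primrec_0[OF y])
      note l = loop[OF this, of "r a"]
      have "exec ?cs r (r(out := z))" if "computes ?P (r a # ?xs) z" for z
      proof -
        have 3: "exec [Loop fr ?body] (S 0 (r a) y) (S (r a) 0 z)" using l that by simp
        have "(S (r a) 0 z)(fr + 1 := 0) = r(out := z)"
          using r ins(2) by (auto simp: S_def fun_eq_iff less_not_refl2)
        then have "exec [Loop (fr + 1) []] (S (r a) 0 z) (r(out := z))"
          using exec_clear[of "fr + 1" "S (r a) 0 z"] by simp
        then show ?thesis by (intro exec_append[OF 1] exec_append[OF 2] exec_append[OF 3])
      qed
      moreover have "diverges ?cs r" if "\<nexists>z. computes ?P (r a # ?xs) z"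
        by (intro diverges_append2[OF 1] diverges_append2[OF 2] diverges_append1) (use l that in simp)
      ultimately show ?thesis by blast
    next
      case False
      have "\<not> computes ?P (r a # ?xs) z" for z
        using False computes_PrimRec_down[of f g 0 "r a" ?xs z] by (auto elim: computesE(5))
      moreover have "diverges cf (S 0 (r a) 0)"
        using realizes_diverges[OF cf S_vals(3)[of 0 "r a" 0] S_tmp(2), unfolded S_ins, OF False] .
      then have "diverges ?cs r" by (intro diverges_append2[OF 1] diverges_append1)
      ultimately show ?thesis by blast
    qed
  qed
  have "realizes ?P (a # ins) out fr ?cs"
    unfolding realizes_def list.map using main by blast
  then show ?thesis by blast
qed

text \<open>Register \<open>out\<close> holds the current candidate and \<open>fr\<close> the value
  of \<open>f\<close> there; the loop runs while this value is positive. Its decrement does no harm,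
  as the body clears \<open>fr\<close> first.\<close>

lemma realizes_Mu:
  assumes f: "\<And>ins out fr. \<forall>i\<in>set ins. i < fr \<Longrightarrow> out < fr \<Longrightarrow> out \<notin> set ins \<Longrightarrow>
      \<exists>cs. realizes f ins out fr cs"
    and ins: "\<forall>i\<in>set ins. i < fr" "out < fr" "out \<notin> set ins"
  shows "\<exists>cs. realizes (Mu f) ins out fr cs"
proof -
  obtain cf where cf: "realizes f (out # ins) fr (fr + 1) cf"
    using f[of "out # ins" "fr + 1" fr] ins by fastforce
  let ?body = "[Loop fr []] @ [Inc out] @ cf"
  let ?cs = "cf @ [Loop fr ?body]"
  have main: "(\<forall>z. computes (Mu f) (map r ins) z \<longrightarrow> exec ?cs r (r(out := z))) \<and>
      ((\<nexists>z. computes (Mu f) (map r ins) z) \<longrightarrow> diverges ?cs r)"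
    if r: "r out = 0" "\<forall>k\<ge>fr. r k = 0" for r
  proof -
    define S where "S m v = r(out := m, fr := v)" for m v :: nat
    let ?xs = "map r ins"
    have S_ins: "map (S m v) ins = ?xs" for m v using ins by (auto simp: S_def)
    have S_0: "\<forall>k\<ge>fr + 1. S m v k = 0" for m v using r ins(2) by (auto simp: S_def)
    have S_vals: "S m v fr = v" "S m v out = m" for m v using ins(2) by (auto simp: S_def)
    have S_upd: "(S m v)(fr := v') = S m v'" "(S m v)(out := m') = S m' v" for m v m' v'
      using ins(2) by (auto simp: S_def fun_eq_iff)
    have S_00: "S 0 0 = r" using r by (auto simp: S_def fun_eq_iff)
    have S_arg: "map (S m v) (out # ins) = m # ?xs" for m v by (simp only: list.map S_vals S_ins)
    have test: "exec cf (S m 0) (S m v)" if "computes f (m # ?xs) v" for m v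
      using realizes_exec[OF cf S_vals(1) S_0, unfolded S_arg S_upd, OF that] .
    have test_div: "diverges cf (S m 0)" if "\<nexists>v. computes f (m # ?xs) v" for m
      using realizes_diverges[OF cf S_vals(1) S_0, unfolded S_arg, OF that] .
    have next_m: "exec ([Loop fr []] @ [Inc out]) (S m v) (S (Suc m) 0)" for m v
      using exec_append[OF exec_clear[of fr "S m v"] exec_Inc[of out]] unfolding S_upd S_vals .
    have body: "exec ?body (S m v) (S (Suc m) v')" if "computes f (Suc m # ?xs) v'" for m v v'
      using exec_append[OF next_m test[OF that]] by simp
    have body_div: "diverges ?body (S m v)" if "\<nexists>v. computes f (Suc m # ?xs) v" for m v
      using diverges_append2[OF next_m test_div[OF that]] by simp
    have pos: "0 < S m (Suc v) fr" and dec: "(S m (Suc v))(fr := S m (Suc v) fr - 1) = S m v" for m v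
      unfolding S_vals S_upd by simp_all
    show ?thesis
    proof (cases "\<forall>m. \<exists>v. computes f (m # ?xs) (Suc v)")
      case True
      then obtain h where h: "\<And>m. computes f (m # ?xs) (Suc (h m))" by metis
      have "diverges [Loop fr ?body] (S 0 (Suc (h 0)))"
        by (rule diverges_Loop[where \<rho> = "\<lambda>m. S m (Suc (h m))"]) (rule pos, unfold dec, rule body[OF h])
      then have "diverges ?cs r" using diverges_append2[OF test[OF h[of 0]]] S_00 by simp
      moreover have "\<not> computes (Mu f) ?xs z" for z
        using True computes_deterministic by (fastforce elim: computesE(7))
      ultimately show ?thesis by blast
    next
      case False
      \<comment> \<open>The first candidate without a positive value: there the search ends if the
        value is 0 and diverges if it is undefined.\<close>
      define n where "n = (LEAST n. \<nexists>v. computes f (n # ?xs) (Suc v))"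
      have n: "\<nexists>v. computes f (n # ?xs) (Suc v)" unfolding n_def using False LeastI_ex[of "\<lambda>n. \<nexists>v. computes f (n # ?xs) (Suc v)"] by blast
      have below: "\<exists>v. computes f (m # ?xs) (Suc v)" if "m < n" for m
        using that not_less_Least unfolding n_def by blast
      show ?thesis
      proof (cases "computes f (n # ?xs) 0")
        case True
        have loop: "exec [Loop fr ?body] (S m v) (S n 0)" if "m \<le> n" "computes f (m # ?xs) v" for m v
          using that
        proof (induction m arbitrary: v rule: inc_induct)
          case base
          then have "v = 0" using True computes_deterministic by blast
          then show ?case using exec_Loop_0[of "S n v" fr] S_vals by simp
        next
          case (step m)
          obtain v0 where "v = Suc v0" using below[OF step.hyps(2)] step.prems computes_deterministic by blast
          obtain v' where v': "computes f (Suc m # ?xs) v'"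
            using below[of "Suc m"] True step.hyps(2) by (cases "Suc m = n") auto
          have "exec ?body ((S m (Suc v0))(fr := S m (Suc v0) fr - 1)) (S (Suc m) v')"
            unfolding dec by (rule body[OF v'])
          then show ?case unfolding \<open>v = Suc v0\<close> by (rule exec_Loop_Suc[of "S m (Suc v0)", OF pos _ step.IH[OF v']])
        qed
        have "\<exists>v. computes f (0 # ?xs) v" using below[of 0] True by (cases n) auto
        then obtain v where v: "computes f (0 # ?xs) v" by blast
        have "exec ?cs r (S n 0)"
          using exec_append[OF test[OF v] loop[OF _ v]] S_00 by simp
        moreover have "S n 0 = r(out := n)" using r ins(2) by (auto simp: S_def fun_eq_iff)
        ultimately have e: "exec ?cs r (r(out := n))" by simp
        have c: "computes (Mu f) ?xs n" using True below by (intro computes.mu) auto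
        have "exec ?cs r (r(out := z))" if "computes (Mu f) ?xs z" for z
          using e computes_deterministic[OF c that] by simp
        then show ?thesis using c by blast
      next
        case False
        have undef: "\<nexists>v. computes f (n # ?xs) v" using n False by (metis not0_implies_Suc)
        have loop: "diverges [Loop fr ?body] (S m v)" if "m < n" "computes f (m # ?xs) v" for m v
          using that
        proof (induction "n - m" arbitrary: m v)
          case (Suc k)
          obtain v0 where v0: "v = Suc v0"
            using below[OF Suc.prems(1)] computes_deterministic[OF Suc.prems(2)] by auto
          show ?case
          proof (cases "Suc m = n")
            case True
            have "diverges ?body (S m v0)" by (rule body_div) (use True undef in simp)
            then show ?thesis
              unfolding v0 by (intro diverges_Loop_body[of "S m (Suc v0)", OF pos]) (simp only: dec)
          next
            case False
            then have "Suc m < n" using Suc.prems(1) by simp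
            then obtain v' where v': "computes f (Suc m # ?xs) v'" using below[of "Suc m"] by auto
            have "diverges [Loop fr ?body] (S (Suc m) v')"
              using Suc.hyps \<open>Suc m < n\<close> v' by simp
            moreover have "exec ?body ((S m (Suc v0))(fr := S m (Suc v0) fr - 1)) (S (Suc m) v')"
              unfolding dec by (rule body[OF v'])
            ultimately show ?thesis
              unfolding v0 using diverges_Loop_Suc[of "S m (Suc v0)", OF pos] by blast
          qed
        qed simp
        have "diverges ?cs r"
        proof (cases n)
          case 0
          then show ?thesis using test_div[of 0] undef S_00 diverges_append1 by simp
        next
          case (Suc k)
          then obtain v where v: "computes f (0 # ?xs) v" using below[of 0] by auto
          then show ?thesis using diverges_append2[OF test[OF v] loop[OF _ v]] S_00 Suc by simp
        qed
        moreover have "\<not> computes (Mu f) ?xs z" for z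
        proof
          assume "computes (Mu f) ?xs z"
          then have z: "computes f (z # ?xs) 0" "\<forall>m<z. \<exists>v. computes f (m # ?xs) (Suc v)"
            by (auto elim: computesE(7))
          then show False using below[of z] undef computes_deterministic n
            by (metis linorder_neqE_nat nat.distinct(1))
        qed
        ultimately show ?thesis by blast
      qed
    qed
  qed
  have "realizes (Mu f) ins out fr ?cs" unfolding realizes_def using main by blast
  then show ?thesis by blast
qed

theorem realizes_exists:
  "\<forall>i\<in>set ins. i < fr \<Longrightarrow> out < fr \<Longrightarrow> out \<notin> set ins \<Longrightarrow> \<exists>cs. realizes f ins out fr cs"
proof (induction f arbitrary: ins out fr)
  case Zero
  have "realizes Zero ins out fr []"
  proof (rule realizesI)
    fix r y assume "r out = 0" "computes Zero (map r ins) y"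
    then have "r(out := y) = r" by (auto elim: computesE(1) simp: fun_eq_iff)
    then show "exec [] r (r(out := y))" using exec_Nil by simp
  qed (use computes.zero in blast)
  then show ?case by blast
next
  case Succ
  show ?case
  proof (cases "length ins = 1")
    case True
    then obtain a where a: "ins = [a]" by (auto simp: length_Suc_conv)
    have "realizes Succ ins out fr (copy a out fr @ [Inc out])"
    proof (rule realizesI)
      fix r y assume r: "r out = 0" "\<forall>k\<ge>fr. r k = 0" and "computes Succ (map r ins) y"
      then have y: "y = Suc (r a)" by (auto simp: a elim: computesE(2))
      have "exec (copy a out fr) r (r(out := r a))"
        using exec_copy[of a out fr r] Succ r a by auto
      from exec_append[OF this exec_Inc[of out]]
      show "exec (copy a out fr @ [Inc out]) r (r(out := y))" by (simp add: y)
    qed (use computes.succ a in auto)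
    then show ?thesis by blast
  next
    case False
    then have "\<not> computes Succ xs y" if "length xs = length ins" for xs y
      using that by (auto elim: computesE(2))
    then show ?thesis using realizes_undefined by blast
  qed
next
  case (Proj i)
  show ?case
  proof (cases "i < length ins")
    case True
    have "realizes (Proj i) ins out fr (copy (ins ! i) out fr)"
    proof (rule realizesI)
      fix r y assume r: "r out = 0" "\<forall>k\<ge>fr. r k = 0" and "computes (Proj i) (map r ins) y"
      then have y: "y = r (ins ! i)" using True by (auto elim: computesE(3))
      have "ins ! i \<in> set ins" using True by simp
      then have "ins ! i < fr" "ins ! i \<noteq> out" using Proj by auto
      then have "exec (copy (ins ! i) out fr) r (r(out := r out + r (ins ! i)))"
        using Proj(2) r by (intro exec_copy) auto
      then show "exec (copy (ins ! i) out fr) r (r(out := y))" using r(1) y by simp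
    next
      fix r assume "\<nexists>y. computes (Proj i) (map r ins) y"
      moreover have "computes (Proj i) (map r ins) (map r ins ! i)"
        by (rule computes.proj) (simp add: True)
      ultimately show "diverges (copy (ins ! i) out fr) r" by blast
    qed
    then show ?thesis by blast
  next
    case False
    then have "\<not> computes (Proj i) xs y" if "length xs = length ins" for xs y
      using that by (auto elim: computesE(3))
    then show ?thesis using realizes_undefined by blast
  qed
next
  case (Comp f gs)
  show ?case by (rule realizes_Comp[OF _ _ Comp.prems]) (use Comp.IH in blast)+
next
  case (PrimRec f g)
  show ?case
  proof (cases ins)
    case Nil
    have "\<not> computes (PrimRec f g) [] y" for y
      by (auto elim: computes.cases)
    then have "\<not> computes (PrimRec f g) xs y" if "length xs = length ins" for xs y
      using that Nil by simp
    then show ?thesis using realizes_undefined by blast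
  next
    case (Cons a "is")
    show ?thesis unfolding Cons
      by (rule realizes_PrimRec[OF _ _ PrimRec.prems[unfolded Cons]]) (use PrimRec.IH in blast)+
  qed
next
  case (Mu f)
  show ?case by (rule realizes_Mu[OF _ Mu.prems]) (use Mu.IH in blast)
qed

corollary program_of_recf:
  obtains cs where "\<And>n. terminates cs ((\<lambda>_. 0)(0 := n)) \<longleftrightarrow> (\<exists>y. computes f [n] y)"
proof -
  obtain cs where cs: "realizes f [0] 1 2 cs" using realizes_exists[of "[0]" 2 1 f] by auto
  have "terminates cs ((\<lambda>_. 0)(0 := n)) \<longleftrightarrow> (\<exists>y. computes f [n] y)" for n
  proof -
    let ?r = "(\<lambda>_. 0)(0 := n) :: nat \<Rightarrow> nat"
    have r: "?r 1 = 0" "\<forall>k\<ge>2. ?r k = 0" "map ?r [0] = [n]" by auto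
    show ?thesis
    proof (cases "\<exists>y. computes f [n] y")
      case True
      then obtain y where "exec cs ?r (?r(1 := y))" using realizes_exec[OF cs r(1,2)] r(3) by metis
      then have "terminates cs ?r" using exec_terminates[of cs _ _ "[]"] terminates_Nil by simp
      then show ?thesis using True by simp
    next
      case False
      then have "diverges cs ?r" using realizes_diverges[OF cs r(1,2)] r(3) by metis
      then have "\<not> terminates cs ?r" unfolding diverges_def by (metis append_Nil2)
      then show ?thesis using False by simp
    qed
  qed
  then show thesis by (rule that)
qed


section \<open>Register programs as modular machines\<close>

text \<open>The prime 2 is left out: its exponent is the clock, which \<open>represents\<close> does
  not constrain.\<close>

definition reg_prime :: "nat \<Rightarrow> nat" where
  "reg_prime = enumerate {p. prime p \<and> 2 < p}"

lemma reg_prime: "prime (reg_prime i)" "2 < reg_prime i"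
  and inj_reg_prime: "inj reg_prime"
proof -
  have "infinite ({p::nat. prime p} - {..2})" using primes_infinite by (rule Diff_infinite_finite[rotated]) simp
  moreover have "{p::nat. prime p} - {..2} = {p. prime p \<and> 2 < p}" by auto
  ultimately have inf: "infinite {p::nat. prime p \<and> 2 < p}" by simp
  show "prime (reg_prime i)" "2 < reg_prime i"
    using enumerate_in_set[OF inf, of i] by (auto simp: reg_prime_def)
  show "inj reg_prime"
    unfolding reg_prime_def by (rule strict_mono_imp_inj_on, rule strict_mono_enumerate[OF inf])
qed

lemma reg_prime_pos: "0 < reg_prime i"
  using reg_prime(1) prime_gt_0_nat by blast

lemma multiplicity_times_prime:
  "prime p \<Longrightarrow> prime q \<Longrightarrow> 0 < N \<Longrightarrow> multiplicity p (q * N) = (if p = q then Suc (multiplicity p N) else multiplicity p N)"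
  for p q N :: nat
  by (auto simp: prime_elem_multiplicity_mult_distrib prime_multiplicity_other)

definition represents :: "nat \<Rightarrow> (nat \<Rightarrow> nat) \<Rightarrow> bool" where
  "represents N r \<longleftrightarrow> 0 < N \<and> (\<forall>i. multiplicity (reg_prime i) N = r i)"

lemma represents_twice: "represents N r \<Longrightarrow> represents (2 * N) r"
proof -
  have "reg_prime i \<noteq> 2" for i using reg_prime(2)[of i] by simp
  then show "represents N r \<Longrightarrow> represents (2 * N) r"
    by (simp add: represents_def multiplicity_times_prime reg_prime(1))
qed

lemma represents_times:
  "represents N r \<Longrightarrow> represents (reg_prime i * N) (r(i := Suc (r i)))"
  using reg_prime(1) inj_reg_prime
  by (auto simp: represents_def multiplicity_times_prime prime_gt_0_nat inj_eq)

lemma represents_div: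
  assumes "represents N r" "0 < r i"
  shows "reg_prime i dvd N" "represents (N div reg_prime i) (r(i := r i - 1))"
proof -
  have "multiplicity (reg_prime i) N \<noteq> 0" using assms by (simp add: represents_def)
  then show d: "reg_prime i dvd N" using not_dvd_imp_multiplicity_0[of "reg_prime i" N] by auto
  then obtain M where M: "N = reg_prime i * M" by (auto elim: dvdE)
  then have "0 < M" using assms(1) by (auto simp: represents_def)
  have "multiplicity (reg_prime k) M = (if k = i then r i - 1 else r k)" for k
  proof -
    have "multiplicity (reg_prime k) N = r k" using assms(1) by (simp add: represents_def)
    then show ?thesis
      using \<open>0 < M\<close> inj_reg_prime reg_prime(1)
      by (auto simp: M multiplicity_times_prime inj_eq split: if_splits)
  qed
  then show "represents (N div reg_prime i) (r(i := r i - 1))"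
    using \<open>0 < M\<close> M prime_gt_0_nat[OF reg_prime(1)[of i]] by (simp add: represents_def)
qed

lemma represents_not_dvd:
  assumes "represents N r" "r i = 0"
  shows "\<not> reg_prime i dvd N"
proof
  assume "reg_prime i dvd N"
  then have "0 < multiplicity (reg_prime i) N"
    using assms(1) reg_prime(1)[of i] prime_multiplicity_gt_zero_iff[of "reg_prime i" N]
    by (simp only: represents_def prime_imp_prime_elem) simp
  then show False using assms by (simp add: represents_def)
qed

lemma represents_initial: "represents (reg_prime 0 ^ n) ((\<lambda>_. 0)(0 := n))"
proof -
  have "multiplicity (reg_prime i) (reg_prime 0 ^ n) = (if i = 0 then n else 0)" for i
  proof (cases "i = 0")
    case True
    then show ?thesis using reg_prime(1)[of 0] by (simp add: prime_gt_1_nat multiplicity_same_power prime_gt_0_nat)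
  next
    case False
    then have "reg_prime i \<noteq> reg_prime 0" using inj_reg_prime by (auto simp: inj_eq)
    then show ?thesis using False reg_prime(1) by (simp add: multiplicity_distinct_prime_power)
  qed
  then show ?thesis using prime_gt_0_nat[OF reg_prime(1)[of 0]] by (simp add: represents_def fun_eq_iff)
qed

text \<open>A finite set of possible remaining programs, closed under \<open>next_config\<close>; it
  makes the control finite. Inside a loop, a rest \<open>s\<close> of the body is followed by the
  loop itself.\<close>

fun continuations :: "cmd list \<Rightarrow> cmd list set" where
  "continuations [] = {[]}"
| "continuations (Inc i # K) = insert (Inc i # K) (continuations K)"
| "continuations (Loop i cs # K) =
    insert (Loop i cs # K) (continuations K \<union> (\<lambda>s. s @ Loop i cs # K) ` continuations cs)"

lemma finite_continuations: "finite (continuations K)"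
  by (induction K rule: continuations.induct) auto

lemma self_in_continuations: "K \<in> continuations K"
  by (cases K rule: continuations.cases) auto

lemma Nil_in_continuations: "[] \<in> continuations K"
  by (induction K rule: continuations.induct) auto

lemma continuations_Inc: "Inc i # K' \<in> continuations K \<Longrightarrow> K' \<in> continuations K"
proof (induction K arbitrary: K' rule: continuations.induct)
  case (2 j K)
  then show ?case using self_in_continuations by auto
next
  case (3 j cs K)
  from 3(3) consider "Inc i # K' \<in> continuations K" | s where "s \<in> continuations cs" "Inc i # K' = s @ Loop j cs # K"
    by auto
  then show ?case
  proof cases
    case (2 s)
    then obtain s' where "s = Inc i # s'" "K' = s' @ Loop j cs # K" by (cases s) auto
    then show ?thesis using 3(2)[of s'] 2 by auto
  qed (use 3(1) in auto)
qed simp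

lemma continuations_Loop:
  "Loop i cs' # K' \<in> continuations K \<Longrightarrow> K' \<in> continuations K \<and> cs' @ Loop i cs' # K' \<in> continuations K"
proof (induction K arbitrary: K' rule: continuations.induct)
  case (3 j cs K)
  from 3(3) consider "Loop i cs' # K' = Loop j cs # K" | "Loop i cs' # K' \<in> continuations K"
    | s where "s \<in> continuations cs" "s \<noteq> []" "Loop i cs' # K' = s @ Loop j cs # K"
  proof -
    \<comment> \<open>An empty rest \<open>s\<close> of the body is the case of the loop head
      itself.\<close>
    have "thesis" if "Loop i cs' # K' = s @ Loop j cs # K" "s \<in> continuations cs" for s
      using that \<open>\<And>s. \<lbrakk>s \<in> continuations cs; s \<noteq> []; Loop i cs' # K' = s @ Loop j cs # K\<rbrakk> \<Longrightarrow> thesis\<close>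
        \<open>Loop i cs' # K' = Loop j cs # K \<Longrightarrow> thesis\<close> by (cases s) auto
    moreover have "Loop i cs' # K' = Loop j cs # K \<or> Loop i cs' # K' \<in> continuations K \<or>
      (\<exists>s\<in>continuations cs. Loop i cs' # K' = s @ Loop j cs # K)"
      using 3(3) by auto
    ultimately show thesis
      using \<open>Loop i cs' # K' = Loop j cs # K \<Longrightarrow> thesis\<close> \<open>Loop i cs' # K' \<in> continuations K \<Longrightarrow> thesis\<close> by blast
  qed
  then show ?case
  proof cases
    case 1
    then show ?thesis using self_in_continuations by auto
  next
    case (3 s)
    then obtain s' where s: "s = Loop i cs' # s'" "K' = s' @ Loop j cs # K" by (cases s) auto
    then have "s' \<in> continuations cs" "cs' @ Loop i cs' # s' \<in> continuations cs" using "3.IH"(2) 3(1) by auto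
    then have "s' @ Loop j cs # K \<in> continuations (Loop j cs # K)"
      "(cs' @ Loop i cs' # s') @ Loop j cs # K \<in> continuations (Loop j cs # K)" by auto
    then show ?thesis using s(2) by simp
  qed (use "3.IH"(1) in auto)
qed auto

text \<open>At a loop head the machine first finds the residue \<open>j\<close> of its value modulo the prime of the
  register. Every step except this test doubles the value, so no configuration is visited twice.\<close>

datatype control = Main "cmd list" | Aux "cmd list" nat

text \<open>The default 0 means that no register is tested; no \<open>j\<close> lies below it, so
  such a list has no \<open>Aux\<close> control.\<close>

fun head_prime :: "cmd list \<Rightarrow> nat" where
  "head_prime (Loop i cs # K) = reg_prime i"
| "head_prime _ = 0"

definition controls :: "cmd list \<Rightarrow> control set" where
  "controls P = Main ` continuations P \<union> (\<lambda>(K, j). Aux K j) ` (SIGMA K:continuations P. {..<head_prime K})"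

fun control_md :: "control \<Rightarrow> nat" where
  "control_md (Main K) = (if head_prime K = 0 then 1 else head_prime K)"
| "control_md (Aux K j) = (if j = 0 then head_prime K else 1)"

text \<open>At a loop head \<open>control_md\<close> and \<open>control_mult\<close> are the same
  prime and the exit adds the residue back, so the test keeps the value. Then \<open>Aux K 0\<close>
  divides by the prime and doubles, while the other \<open>Aux K j\<close> only double.\<close>

fun control_mult :: "control \<Rightarrow> nat" where
  "control_mult (Main []) = 0"
| "control_mult (Main (Inc i # K)) = 2 * reg_prime i"
| "control_mult (Main (Loop i cs # K)) = reg_prime i"
| "control_mult (Aux K j) = 2"

fun control_exit :: "control \<Rightarrow> nat \<Rightarrow> (nat \<times> control) option" where
  "control_exit (Main (Inc i # K)) j = (if j = 0 then Some (0, Main K) else None)"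
| "control_exit (Main (Loop i cs # K)) j =
    (if j < reg_prime i then Some (j, Aux (Loop i cs # K) j) else None)"
| "control_exit (Aux (Loop i cs # K) l) j =
    (if j = 0 then Some (0, Main (if l = 0 then cs @ Loop i cs # K else K)) else None)"
| "control_exit _ _ = None"

definition control_exits :: "cmd list \<Rightarrow> control \<Rightarrow> nat \<Rightarrow> (nat \<times> control) option" where
  "control_exits P q j = (if q \<in> controls P then control_exit q j else None)"

lemma finite_controls: "finite (controls P)"
  by (auto simp: controls_def intro!: finite_continuations)

lemma Main_in_controls [simp]: "Main K \<in> controls P \<longleftrightarrow> K \<in> continuations P"
  by (auto simp: controls_def)

lemma Aux_in_controls [simp]: "Aux K j \<in> controls P \<longleftrightarrow> K \<in> continuations P \<and> j < head_prime K"
  by (auto simp: controls_def)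

definition control_code :: "cmd list \<Rightarrow> control \<Rightarrow> nat" where
  "control_code P q = (if q = Main P then 0 else Suc ((SOME h. inj_on h (controls P)) q))"

text \<open>\<open>exits_inj\<close> is what the \<open>Aux\<close> controls are for: different
  residues at a loop head lead to different controls, and every other control has at most the exit
  at residue 0.\<close>

lemma control_machine:
  "modular_machine (controls P) (Main P) (Main []) control_md control_mult (control_exits P) (control_code P)"
proof
  show "finite (controls P)" by (rule finite_controls)
  show "Main P \<in> controls P" "Main [] \<in> controls P" by (simp_all add: self_in_continuations Nil_in_continuations)
  show "0 < control_md q" if "q \<in> controls P" for q using that by (cases q) auto
  show "0 < control_mult q" if "q \<in> controls P" "q \<noteq> Main []" for q
    using that by (cases q rule: control_mult.cases) (auto simp: reg_prime_pos)
  show "q \<in> controls P \<and> q' \<in> controls P \<and> j < control_md q \<and> q \<noteq> Main []"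
    if "control_exits P q j = Some (b, q')" for q j b q'
  proof -
    have q: "q \<in> controls P" and e: "control_exit q j = Some (b, q')"
      using that by (auto simp: control_exits_def split: if_splits)
    show ?thesis
    proof (cases "(q, j)" rule: control_exit.cases)
      case (1 i K j)
      then show ?thesis using q e continuations_Inc[of i K P] by (auto split: if_splits)
    next
      case (2 i cs K j)
      then show ?thesis using q e by (auto split: if_splits)
    next
      case (3 i cs K l j)
      then show ?thesis using q e continuations_Loop[of i cs K P] by (auto simp: reg_prime_pos split: if_splits)
    qed (use e in auto)
  qed
  show "i = j" if "control_exits P q i = Some (b, q')" "control_exits P q j = Some (b', q')"
    for q i j b b' q'
    using that by (cases "(q, i)" rule: control_exit.cases) (auto simp: control_exits_def split: if_splits)
  show "control_md (Main []) = 1" "control_mult (Main []) = 0" by simp_all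
  have "\<exists>h :: control \<Rightarrow> nat. inj_on h (controls P)"
    using finite_imp_inj_to_nat_seg[OF finite_controls] by blast
  then have "inj_on (SOME h :: control \<Rightarrow> nat. inj_on h (controls P)) (controls P)" by (rule someI_ex)
  then show "inj_on (control_code P) (controls P)"
    by (auto simp: inj_on_def control_code_def)
  show "control_code P (Main P) = 0" by (simp add: control_code_def)
qed

section \<open>Simulation of programs, and the clock\<close>

lemma relpowp_2: "(R ^^ 2) x z \<longleftrightarrow> (\<exists>y. R x y \<and> R y z)"
  by (auto simp: numeral_2_eq_2)

context
  fixes P :: "cmd list"
begin

interpretation modular_machine "controls P" "Main P" "Main []" control_md control_mult
  "control_exits P" "control_code P"
  by (rule control_machine)

text \<open>An \<open>Inc\<close> takes one machine step, a loop head two. The bound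
  \<open>0 < n\<close> turns a nonterminating program into machine runs of unbounded length.\<close>

lemma mstep_next_config:
  assumes "K \<in> continuations P" "K \<noteq> []" "represents N r" "next_config (K, r) = (K', r')"
  shows "K' \<in> continuations P \<and> (\<exists>n N'. 0 < n \<and> (mstep ^^ n) (Main K, N) (Main K', N') \<and> represents N' r')"
proof (cases "(K, r)" rule: next_config.cases)
  case (2 i K1 r)
  then have K: "K = Inc i # K1" and K': "K' = K1" "r' = r(i := Suc (r i))" using assms by auto
  have "mstep (Main K, N) (Main K', 2 * (reg_prime i * N))"
    using assms(1) K K' by (simp add: mstep_def control_exits_def)
  then have "(mstep ^^ 1) (Main K, N) (Main K', 2 * (reg_prime i * N))" by (simp only: relpowp_1)
  moreover have "represents (2 * (reg_prime i * N)) r'"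
    using assms(3) 2 K' by (intro represents_twice) (simp add: represents_times)
  ultimately show ?thesis using continuations_Inc[of i K1 P] assms(1) K K' by (metis zero_less_one)
next
  case (3 i cs K1 r)
  then have K: "K = Loop i cs # K1" by simp
  let ?p = "reg_prime i"
  have p: "0 < ?p" using reg_prime(1) prime_gt_0_nat by blast
  have 1: "mstep (Main K, N) (Aux K (N mod ?p), N)"
    using assms(1) K p by (simp add: mstep_def control_exits_def)
  have Aux: "Aux K (N mod ?p) \<in> controls P" using assms(1) K p by simp
  have next_in: "K1 \<in> continuations P" "cs @ K \<in> continuations P" using continuations_Loop assms(1) K by blast+
  show ?thesis
  proof (cases "r i = 0")
    case True
    then have "K' = K1" "r' = r" using 3 assms(4) by auto
    have "N mod ?p \<noteq> 0" using represents_not_dvd[of N r i] True assms(3) 3 by (simp add: dvd_eq_mod_eq_0)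
    then have "mstep (Aux K (N mod ?p), N) (Main K', 2 * N)"
      using Aux K \<open>K' = K1\<close> by (simp add: mstep_def control_exits_def)
    with 1 have "(mstep ^^ 2) (Main K, N) (Main K', 2 * N)"
      by (simp only: relpowp_2) blast
    moreover have "represents (2 * N) r'" using assms(3) 3 \<open>r' = r\<close> by (simp add: represents_twice)
    ultimately show ?thesis using next_in \<open>K' = K1\<close> by (metis zero_less_numeral)
  next
    case False
    then have K': "K' = cs @ K" "r' = r(i := r i - 1)" using 3 assms(4) by auto
    have d: "?p dvd N" "represents (N div ?p) r'"
      using represents_div[of N r i] False assms(3) 3 K'(2) by auto
    then have "mstep (Aux K (N mod ?p), N) (Main K', 2 * (N div ?p))"
      using Aux K K'(1) by (simp add: mstep_def control_exits_def)
    with 1 have "(mstep ^^ 2) (Main K, N) (Main K', 2 * (N div ?p))"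
      by (simp only: relpowp_2) blast
    moreover have "represents (2 * (N div ?p)) r'" using d(2) by (rule represents_twice)
    ultimately show ?thesis using next_in K'(1) by (metis zero_less_numeral)
  qed
qed (use assms(2) in simp)

lemma mstep_next_config_pow:
  assumes "represents N r" "(next_config ^^ n) (P, r) = (K', r')"
    "\<And>k. k < n \<Longrightarrow> fst ((next_config ^^ k) (P, r)) \<noteq> []"
  shows "K' \<in> continuations P \<and> (\<exists>m N'. n \<le> m \<and> (mstep ^^ m) (Main P, N) (Main K', N') \<and> represents N' r')"
  using assms(2,3)
proof (induction n arbitrary: K' r')
  case 0
  then have "K' = P" "r' = r" by simp_all
  moreover have "(mstep ^^ 0) (Main P, N) (Main P, N)" by simp
  ultimately show ?case using assms(1) self_in_continuations by blast
next
  case (Suc n)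
  obtain K1 r1 where 1: "(next_config ^^ n) (P, r) = (K1, r1)" by fastforce
  then obtain m N1 where m: "K1 \<in> continuations P" "n \<le> m" "(mstep ^^ m) (Main P, N) (Main K1, N1)"
    "represents N1 r1"
    using Suc.IH Suc.prems(2) by fastforce
  have "K1 \<noteq> []" using Suc.prems(2)[of n] 1 by simp
  moreover have "next_config (K1, r1) = (K', r')" using Suc.prems(1) 1 by simp
  ultimately obtain k N' where k: "K' \<in> continuations P" "0 < k" "(mstep ^^ k) (Main K1, N1) (Main K', N')"
    "represents N' r'"
    using mstep_next_config[OF m(1) _ m(4)] by blast
  have "(mstep ^^ (m + k)) (Main P, N) (Main K', N')" using m(3) k(3) by (auto simp: relpowp_add)
  moreover have "Suc n \<le> m + k" using m(2) k(2) by simp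
  ultimately show ?case using k by blast
qed

lemma terminates_iff_halts:
  assumes "represents N r"
  shows "terminates P r \<longleftrightarrow> (\<exists>n N'. (mstep ^^ n) (Main P, N) (Main [], N'))"
proof
  assume "terminates P r"
  then have ex: "\<exists>n. fst ((next_config ^^ n) (P, r)) = []" by (simp add: terminates_def)
  define n where "n = (LEAST n. fst ((next_config ^^ n) (P, r)) = [])"
  have "fst ((next_config ^^ n) (P, r)) = []" unfolding n_def using ex by (rule LeastI_ex)
  moreover have "fst ((next_config ^^ k) (P, r)) \<noteq> []" if "k < n" for k
    using not_less_Least that unfolding n_def by blast
  moreover obtain K' r' where "(next_config ^^ n) (P, r) = (K', r')" by fastforce
  ultimately show "\<exists>n N'. (mstep ^^ n) (Main P, N) (Main [], N')"
    using mstep_next_config_pow[OF assms, of n K' r'] by auto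
next
  assume "\<exists>n N'. (mstep ^^ n) (Main P, N) (Main [], N')"
  then obtain n N' where n: "(mstep ^^ n) (Main P, N) (Main [], N')" by blast
  show "terminates P r"
  proof (rule ccontr)
    assume "\<not> terminates P r"
    then have "fst ((next_config ^^ k) (P, r)) \<noteq> []" for k by (auto simp: terminates_def)
    moreover obtain K' r' where "(next_config ^^ Suc n) (P, r) = (K', r')" by fastforce
    ultimately obtain m N2 where "Suc n \<le> m" "(mstep ^^ m) (Main P, N) (Main K', N2)"
      using mstep_next_config_pow[OF assms, of "Suc n" K' r'] by blast
    \<comment> \<open>By determinism this longer run is in the halting configuration at time
      \<open>n\<close> and leaves it, although \<open>Main []\<close> has no exit.\<close>
    then have "(mstep ^^ (n + Suc (m - Suc n))) (Main P, N) (Main K', N2)" by simp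
    then obtain c where "(mstep ^^ n) (Main P, N) c" "(mstep ^^ Suc (m - Suc n)) c (Main K', N2)"
      unfolding relpowp_add by blast
    then obtain d where "mstep (Main [], N') d"
      using mstep_pow_deterministic[OF n] relpowp_Suc_D2 by metis
    then show False by (auto simp: mstep_def control_exits_def split: if_splits)
  qed
qed

text \<open>Doubling adds 2, entering an \<open>Aux\<close> control adds 1 and leaving it subtracts
  1. So the test, which keeps the value, also increases the clock; odd factors do not affect
  it.\<close>

definition clock :: "control \<times> nat \<Rightarrow> nat" where
  "clock c = 2 * multiplicity 2 (snd c) + (case fst c of Main K \<Rightarrow> 0 | Aux K j \<Rightarrow> 1)"

lemma clock_mstep:
  assumes "mstep c d" "0 < snd c"
  shows "clock c < clock d \<and> 0 < snd d"
proof -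
  obtain q N q' N' b where cd: "c = (q, N)" "d = (q', N')" "0 < N"
    and e: "control_exit q (N mod control_md q) = Some (b, q')"
    and N': "N' = control_mult q * (N div control_md q) + b"
    using assms by (cases c; cases d) (auto simp: mstep_def control_exits_def split: if_splits)
  have twice: "multiplicity 2 (2 * M) = Suc (multiplicity 2 M)" if "0 < M" for M :: nat
    using multiplicity_times_prime[of 2 2 M] that by simp
  have odd: "multiplicity 2 (reg_prime i * M) = multiplicity 2 M" if "0 < M" for i M
    using multiplicity_times_prime[of 2 "reg_prime i" M] reg_prime[of i] that by auto
  show ?thesis
  proof (cases "(q, N mod control_md q)" rule: control_exit.cases)
    case (1 i K j)
    then have "N' = 2 * (reg_prime i * N)" "q' = Main K" using e N' by (auto split: if_splits)
    then show ?thesis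
      using 1 cd twice[of "reg_prime i * N"] odd[of N i] prime_gt_0_nat[OF reg_prime(1)[of i]]
      by (simp add: clock_def)
  next
    case (2 i cs K j)
    then have "N' = N" "q' = Aux (Loop i cs # K) (N mod reg_prime i)"
      using e N' reg_prime(2)[of i] by (auto split: if_splits)
    then show ?thesis using 2 cd by (simp add: clock_def)
  next
    case (3 i cs K l j)
    have "\<exists>K'. q' = Main K'" using 3 e by (auto split: if_splits)
    show ?thesis
    proof (cases "l = 0")
      case True
      then have m: "N mod reg_prime i = 0" "N' = 2 * (N div reg_prime i)"
        using 3 e N' reg_prime(2)[of i] by (auto split: if_splits)
      then have "N = reg_prime i * (N div reg_prime i)" by auto
      moreover from this have "0 < N div reg_prime i" using cd(3) by (metis mult_0_right neq0_conv)
      ultimately have "multiplicity 2 N = multiplicity 2 (N div reg_prime i)" using odd by metis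
      then show ?thesis
        using 3 cd m(2) twice[OF \<open>0 < N div reg_prime i\<close>] \<open>0 < N div reg_prime i\<close> \<open>\<exists>K'. q' = Main K'\<close>
        by (auto simp: clock_def)
    next
      case False
      then have "N' = 2 * N" using 3 e N' by (auto split: if_splits)
      then show ?thesis using 3 cd twice[OF cd(3)] \<open>\<exists>K'. q' = Main K'\<close> by (auto simp: clock_def)
    qed
  qed (use e in auto)
qed

lemma clock_mstep_pow:
  "(mstep ^^ n) c d \<Longrightarrow> 0 < snd c \<Longrightarrow> clock c + n \<le> clock d \<and> 0 < snd d"
proof (induction n arbitrary: d)
  case (Suc n)
  then obtain e where "(mstep ^^ n) c e" "mstep e d" by auto
  then show ?case using Suc.IH[of e] Suc.prems(2) clock_mstep[of e d] by simp
qed simp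

lemma mstep_no_repeat:
  assumes "0 < N" "(mstep ^^ i) (Main P, N) c" "(mstep ^^ j) (Main P, N) c"
  shows "i = j"
proof -
  have "\<not> i < j" if "(mstep ^^ i) (Main P, N) c" "(mstep ^^ j) (Main P, N) c" for i j
  proof
    assume "i < j"
    then have "(mstep ^^ (i + (j - i))) (Main P, N) c" using that(2) by simp
    then obtain d where d: "(mstep ^^ i) (Main P, N) d" "(mstep ^^ (j - i)) d c"
      unfolding relpowp_add by blast
    have "d = c" by (rule mstep_pow_deterministic[OF d(1) that(1)])
    moreover have "0 < snd d" using clock_mstep_pow[OF d(1)] assms(1) by simp
    ultimately show False using clock_mstep_pow[OF d(2)] \<open>i < j\<close> by simp
  qed
  then show ?thesis using assms(2,3) by (meson linorder_neqE_nat)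
qed

end


section \<open>The reduction\<close>

context modular_machine
begin

lemma finite_base_edges: "finite base_edges"
proof -
  let ?c = "\<lambda>(q, j). ((q, j), 0 :: nat, if Suc j < md q then [] else replicate (mult q) (Inl 0),
      (q, Suc j mod md q))"
  have "cycle_edges \<subseteq> ?c ` (SIGMA q:Q. {..<md q})"
  proof
    fix z assume "z \<in> cycle_edges"
    then obtain q j where "z = ((q, j), 0, if Suc j < md q then [] else replicate (mult q) (Inl 0),
        (q, Suc j mod md q))" "q \<in> Q" "j < md q"
      unfolding cycle_edges_def by blast
    then show "z \<in> ?c ` (SIGMA q:Q. {..<md q})" by (intro image_eqI[of _ _ "(q, j)"]) auto
  qed
  then have "finite cycle_edges" by (rule finite_subset) (use finite_Q in simp)
  moreover have "exit_edges \<subseteq> (\<lambda>(q, j). case the (exits q j) of (b, q') \<Rightarrow>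
      ((q, j), mark q, replicate b (Inl 0) @ [Inl (mark q')], (q', 0))) ` (SIGMA q:Q. {..<md q})"
    (is "_ \<subseteq> ?f ` _")
  proof
    fix z assume "z \<in> exit_edges"
    then obtain q j b q' where z: "z = ((q, j), mark q, replicate b (Inl 0) @ [Inl (mark q')], (q', 0))"
      and e: "exits q j = Some (b, q')"
      by (auto simp: exit_edges_def)
    then have "z = ?f (q, j)" by simp
    moreover have "(q, j) \<in> (SIGMA q:Q. {..<md q})" using exitsD[OF e] by simp
    ultimately show "z \<in> ?f ` (SIGMA q:Q. {..<md q})" by (rule image_eqI)
  qed
  then have "finite exit_edges" by (rule finite_subset) (use finite_Q in simp)
  ultimately show ?thesis by (simp add: base_edges_def)
qed

end

lemma path_words:
  "path G p w V q \<Longrightarrow> (\<And>p x U q. (p, x, U, q) \<in> G \<Longrightarrow> x \<in> A <+> A \<and> U \<in> words A) \<Longrightarrow>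
    w \<in> words A \<and> V \<in> words A"
proof (induction rule: path.induct)
  case (path_Cons p x U q w V r)
  then show ?case using path_Cons.prems[OF path_Cons.hyps(1)] by simp
qed simp

text \<open>\<open>B\<close> depends on the program only. The initial number
  \<open>reg_prime 0 ^ n\<close> puts the input \<open>n\<close> into register 0.\<close>

definition instance_edges :: "(nat \<times> nat \<times> nat word \<times> nat) set \<Rightarrow> nat \<Rightarrow> (nat, nat) edge_set" where
  "instance_edges B n = symmetric_closure (insert (0, 1, start_word (reg_prime 0 ^ n), 2) B)"

text \<open>Exports what the diagonal argument uses: one set \<open>B\<close> for all inputs, in
  which state 0 does not occur, so that the two edges at 0 are new. The alphabet is left open
  because it will be chosen from the code of \<open>B\<close>.\<close>

theorem recf_base_edges:
  obtains B where "finite B" "\<forall>p a U q. (p, a, U, q) \<in> B \<longrightarrow> p \<noteq> 0 \<and> q \<noteq> 0"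
    "\<forall>n. deterministic_edges (instance_edges B n)"
    "\<forall>n A. (\<forall>p x U q. (p, x, U, q) \<in> instance_edges B n \<longrightarrow> x \<in> A <+> A \<and> U \<in> words A) \<longrightarrow>
      ((\<exists>w V q. w \<in> words A \<and> reduced w \<and> w \<noteq> [] \<and> path (instance_edges B n) 0 w V q \<and> (V, w) \<in> free_eq A)
      \<longleftrightarrow> (\<exists>y. computes f [n] y))"
proof -
  obtain P where P: "\<And>n. terminates P ((\<lambda>_. 0)(0 := n)) \<longleftrightarrow> (\<exists>y. computes f [n] y)"
    using program_of_recf[of f] by blast
  interpret modular_machine "controls P" "Main P" "Main []" control_md control_mult
    "control_exits P" "control_code P"
    by (rule control_machine)
  have G: "instance_edges base_edges n = input_edges (reg_prime 0 ^ n)" for n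
    by (simp add: instance_edges_def input_edges_def)
  have halts: "(\<exists>k N'. (mstep ^^ k) (Main P, reg_prime 0 ^ n) (Main [], N')) \<longleftrightarrow> (\<exists>y. computes f [n] y)" for n
    using terminates_iff_halts[OF represents_initial] P by blast
  have nonzero: "p \<noteq> 0 \<and> q \<noteq> 0" if "(p, a, U, q) \<in> base_edges" for p a U q
    using that by (cases rule: base_edges_cases) simp_all
  have iff: "(\<exists>w V q. w \<in> words A \<and> reduced w \<and> w \<noteq> [] \<and> path (instance_edges base_edges n) 0 w V q \<and>
      (V, w) \<in> free_eq A) \<longleftrightarrow> (\<exists>y. computes f [n] y)" (is "?l \<longleftrightarrow> ?r")
    if A: "\<forall>p x U q. (p, x, U, q) \<in> instance_edges base_edges n \<longrightarrow> x \<in> A <+> A \<and> U \<in> words A" for n A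
  proof
    assume ?l
    then obtain w V q where w: "reduced w" "w \<noteq> []" "path (input_edges (reg_prime 0 ^ n)) 0 w V q"
      "(V, w) \<in> free_eq A"
      unfolding G by blast
    have "0 < reg_prime 0 ^ n" by (simp add: reg_prime_pos)
    then show ?r
      unfolding halts[symmetric] using fixed_point_halts[OF w] mstep_no_repeat by blast
  next
    assume ?r
    then obtain k N' where "(mstep ^^ k) (Main P, reg_prime 0 ^ n) (Main [], N')"
      unfolding halts[symmetric] by blast
    then obtain w where w: "reduced w" "w \<noteq> []" "path (instance_edges base_edges n) 0 w w 1"
      unfolding G using halting_fixed_point by blast
    moreover have "w \<in> words A" using path_words[OF w(3), of A] A by blast
    moreover from this have "(w, w) \<in> free_eq A" by (simp add: free_eq_def)
    ultimately show ?l by blast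
  qed
  show thesis
    by (rule that[OF finite_base_edges]) (use nonzero iff input_edges_deterministic G in simp_all)
qed


subsection \<open>The reduction is computable\<close>

definition rec1 :: "(nat \<Rightarrow> nat) \<Rightarrow> bool" where
  "rec1 F \<longleftrightarrow> (\<exists>f. \<forall>x. computes f [x] (F x))"

definition rec2 :: "(nat \<Rightarrow> nat \<Rightarrow> nat) \<Rightarrow> bool" where
  "rec2 F \<longleftrightarrow> (\<exists>f. \<forall>x y. computes f [x, y] (F x y))"

lemma computes_const: "\<exists>f. \<forall>xs. computes f xs c"
proof (induction c)
  case 0
  then show ?case using computes.zero by blast
next
  case (Suc c)
  then obtain f where "\<And>xs. computes f xs c" by blast
  then have "computes (Comp Succ [f]) xs (Suc c)" for xs
    by (intro computes.comp[of _ _ "[c]"] computes.succ) simp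
  then show ?case by blast
qed

lemma rec1_const: "rec1 (\<lambda>_. c)"
  using computes_const[of c] by (auto simp: rec1_def)

lemma rec1_id: "rec1 (\<lambda>x. x)"
  unfolding rec1_def using computes.proj[of 0 "[_]"] by auto

lemma rec1_Suc: "rec1 Suc"
  unfolding rec1_def using computes.succ by blast

lemma rec2_fst: "rec2 (\<lambda>x y. x)"
  unfolding rec2_def using computes.proj[of 0 "[_, _]"] by auto

lemma rec2_snd: "rec2 (\<lambda>x y. y)"
  unfolding rec2_def using computes.proj[of 1 "[_, _]"] by auto

lemma rec1_comp: "rec1 F \<Longrightarrow> rec1 G \<Longrightarrow> rec1 (\<lambda>x. F (G x))"
proof -
  assume "rec1 F" "rec1 G"
  then obtain f g where "\<And>x. computes f [x] (F x)" "\<And>x. computes g [x] (G x)"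
    unfolding rec1_def by blast
  then have "computes (Comp f [g]) [x] (F (G x))" for x
    by (intro computes.comp[of _ _ "[G x]"]) auto
  then show ?thesis unfolding rec1_def by blast
qed

lemma rec1_comp2: "rec2 F \<Longrightarrow> rec1 G \<Longrightarrow> rec1 H \<Longrightarrow> rec1 (\<lambda>x. F (G x) (H x))"
proof -
  assume "rec2 F" "rec1 G" "rec1 H"
  then obtain f g h where "\<And>x y. computes f [x, y] (F x y)" "\<And>x. computes g [x] (G x)"
    "\<And>x. computes h [x] (H x)"
    unfolding rec1_def rec2_def by blast
  then have "computes (Comp f [g, h]) [x] (F (G x) (H x))" for x
    by (intro computes.comp[of _ _ "[G x, H x]"]) auto
  then show ?thesis unfolding rec1_def by blast
qed

lemma rec2_comp: "rec1 F \<Longrightarrow> rec2 G \<Longrightarrow> rec2 (\<lambda>x y. F (G x y))"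
proof -
  assume "rec1 F" "rec2 G"
  then obtain f g where "\<And>x. computes f [x] (F x)" "\<And>x y. computes g [x, y] (G x y)"
    unfolding rec1_def rec2_def by blast
  then have "computes (Comp f [g]) [x, y] (F (G x y))" for x y
    by (intro computes.comp[of _ _ "[G x y]"]) auto
  then show ?thesis unfolding rec2_def by blast
qed

lemma rec2_comp2: "rec2 F \<Longrightarrow> rec2 G \<Longrightarrow> rec2 H \<Longrightarrow> rec2 (\<lambda>x y. F (G x y) (H x y))"
proof -
  assume "rec2 F" "rec2 G" "rec2 H"
  then obtain f g h where "\<And>x y. computes f [x, y] (F x y)" "\<And>x y. computes g [x, y] (G x y)"
    "\<And>x y. computes h [x, y] (H x y)"
    unfolding rec2_def by blast
  then have "computes (Comp f [g, h]) [x, y] (F (G x y) (H x y))" for x y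
    by (intro computes.comp[of _ _ "[G x y, H x y]"]) auto
  then show ?thesis unfolding rec2_def by blast
qed

lemma rec1_rec_nat: "rec2 G \<Longrightarrow> rec1 (rec_nat a G)"
proof -
  assume "rec2 G"
  then obtain g where g: "\<And>x y. computes g [x, y] (G x y)" unfolding rec2_def by blast
  obtain f where f: "\<And>xs. computes f xs a" using computes_const by blast
  have "computes (PrimRec f g) [n] (rec_nat a G n)" for n
  proof (induction n)
    case 0
    then show ?case using computes.primrec_0[OF f] by simp
  next
    case (Suc n)
    then show ?case using computes.primrec_Suc[OF _ g] by simp
  qed
  then show ?thesis unfolding rec1_def by blast
qed

lemma rec1_funpow: "rec1 F \<Longrightarrow> rec1 (\<lambda>n. (F ^^ n) a)"
proof -
  assume "rec1 F"
  then have "rec1 (rec_nat a (\<lambda>n y. F y))" by (intro rec1_rec_nat rec2_comp[OF _ rec2_snd])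
  moreover have "rec_nat a (\<lambda>n y. F y) = (\<lambda>n. (F ^^ n) a)"
  proof
    fix n show "rec_nat a (\<lambda>n y. F y) n = (F ^^ n) a" by (induction n) auto
  qed
  ultimately show ?thesis by simp
qed

lemma rec2_add: "rec2 (+)"
proof -
  have "computes (PrimRec (Proj 0) (Comp Succ [Proj 1])) [x, y] (x + y)" for x y
  proof (induction x)
    case 0
    then show ?case using computes.primrec_0[OF computes.proj[of 0 "[y]"]] by simp
  next
    case (Suc x)
    have "computes (Proj 1) [x, x + y, y] (x + y)" using computes.proj[of 1 "[x, x + y, y]"] by simp
    then have "computes (Comp Succ [Proj 1]) [x, x + y, y] (Suc (x + y))"
      by (intro computes.comp[of _ _ "[x + y]"] computes.succ) simp
    then show ?case using computes.primrec_Suc[OF Suc] by simp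
  qed
  then show ?thesis unfolding rec2_def by blast
qed

lemma rec1_times: "rec1 (\<lambda>x. c * x)"
proof -
  have "((\<lambda>y. c + y) ^^ n) 0 = c * n" for n by (induction n) auto
  moreover have "rec1 (\<lambda>n. ((\<lambda>y. c + y) ^^ n) 0)"
    by (intro rec1_funpow rec1_comp2[OF rec2_add] rec1_const rec1_id)
  ultimately show ?thesis by simp
qed

lemma rec1_power: "rec1 (\<lambda>n. c ^ n)"
proof -
  have "((\<lambda>y. c * y) ^^ n) 1 = c ^ n" for n by (induction n) auto
  moreover have "rec1 (\<lambda>n. ((\<lambda>y. c * y) ^^ n) 1)" by (intro rec1_funpow rec1_times)
  ultimately show ?thesis by simp
qed

lemma rec1_triangle: "rec1 triangle"
proof -
  have "rec_nat 0 (\<lambda>n y. y + Suc n) n = triangle n" for n by (induction n) auto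
  moreover have "rec1 (rec_nat 0 (\<lambda>n y. y + Suc n))"
    by (intro rec1_rec_nat rec2_comp2[OF rec2_add] rec2_snd rec2_comp[OF rec1_Suc] rec2_fst)
  ultimately show ?thesis by presburger
qed

lemma rec2_prod_encode: "rec2 (\<lambda>x y. prod_encode (x, y))"
  unfolding prod_encode_def prod.case
  by (intro rec2_comp2[OF rec2_add] rec2_comp[OF rec1_triangle] rec2_add rec2_fst)

lemma rec1_list_encode_replicate: "rec1 (\<lambda>n. list_encode (replicate n c @ l))"
proof -
  have "((\<lambda>y. Suc (prod_encode (c, y))) ^^ n) (list_encode l) = list_encode (replicate n c @ l)" for n
    by (induction n) auto
  moreover have "rec1 (\<lambda>n. ((\<lambda>y. Suc (prod_encode (c, y))) ^^ n) (list_encode l))"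
    by (intro rec1_funpow rec1_comp[OF rec1_Suc] rec1_comp2[OF rec2_prod_encode] rec1_const rec1_id)
  ultimately show ?thesis by simp
qed

text \<open>The code is \<open>2 ^ n - 1\<close>; doubling and adding 1 passes to the next
  one.\<close>

lemma rec1_set_encode_lessThan: "rec1 (\<lambda>n. set_encode {..<n})"
proof -
  have "((\<lambda>y. Suc (2 * y)) ^^ n) 0 = set_encode {..<n}" for n
  proof (induction n)
    case (Suc n)
    have "Suc (set_encode {..<n}) = 2 ^ n" by (simp add: set_encode_def lessThan_atLeast0 sum_power2)
    then show ?case using Suc by (simp add: lessThan_Suc set_encode_insert)
  qed (simp add: set_encode_def)
  moreover have "rec1 (\<lambda>n. ((\<lambda>y. Suc (2 * y)) ^^ n) 0)"
    by (intro rec1_funpow rec1_comp[OF rec1_Suc] rec1_times)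
  ultimately show ?thesis by simp
qed

definition start_code :: "nat \<Rightarrow> nat" where
  "start_code n = edge_code (0, Inl 1, start_word (reg_prime 0 ^ n), 2)"

definition start_code_inv :: "nat \<Rightarrow> nat" where
  "start_code_inv n = edge_code (2, Inr 1, inv_word (start_word (reg_prime 0 ^ n)), 0)"

lemma rec1_start_code: "rec1 start_code"
proof -
  \<comment> \<open>\<open>sum_encode\<close> sends \<open>Inl a\<close> to \<open>2 * a\<close> and
    \<open>Inr a\<close> to \<open>2 * a + 1\<close>; so \<open>c\<close>, \<open>s\<close> and the
    start marker are 0, 2, 4 and their inverses 1, 3, 5.\<close>
  have "start_code n = prod_encode (0, prod_encode (2, prod_encode
      (Suc (prod_encode (2, list_encode (replicate (reg_prime 0 ^ n) 0 @ [4]))), 2)))" for n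
    by (simp add: start_code_def edge_code_def start_word_def sum_encode_def)
  then have eq: "start_code = (\<lambda>n. prod_encode (0, prod_encode (2, prod_encode
      (Suc (prod_encode (2, list_encode (replicate (reg_prime 0 ^ n) 0 @ [4]))), 2))))" by blast
  show ?thesis
    unfolding eq
    by (intro rec1_comp2[OF rec2_prod_encode] rec1_const rec1_comp[OF rec1_Suc]
        rec1_comp[OF rec1_list_encode_replicate] rec1_power)
qed

lemma rec1_start_code_inv: "rec1 start_code_inv"
proof -
  have "start_code_inv n = prod_encode (2, prod_encode (3, prod_encode
      (Suc (prod_encode (5, list_encode (replicate (reg_prime 0 ^ n) 1 @ [3]))), 0)))" for n
    by (simp add: start_code_inv_def edge_code_def start_word_def sum_encode_def)
  then have eq: "start_code_inv = (\<lambda>n. prod_encode (2, prod_encode (3, prod_encode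
      (Suc (prod_encode (5, list_encode (replicate (reg_prime 0 ^ n) 1 @ [3]))), 0))))" by blast
  show ?thesis
    unfolding eq
    by (intro rec1_comp2[OF rec2_prod_encode] rec1_const rec1_comp[OF rec1_Suc]
        rec1_comp[OF rec1_list_encode_replicate] rec1_power)
qed

text \<open>The program with code \<open>e\<close>, that is, with base edges coded by \<open>e\<close>, is run on the input \<open>e\<close>.
  All states and letters of these edges are below \<open>e\<close>.\<close>

definition instance_code :: "nat \<Rightarrow> nat" where
  "instance_code e = prod_encode (set_encode {..<e + 3}, prod_encode (set_encode {..<e + 3},
     prod_encode (0, 2 ^ start_code e + (2 ^ start_code_inv e + e))))"

text \<open>\<open>set_encode\<close> adds up over disjoint unions and a single edge contributes a
  power of two, so \<open>e\<close> never has to be decoded.\<close>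

lemma rec1_instance_code: "rec1 instance_code"
  unfolding instance_code_def
  by (intro rec1_comp2[OF rec2_prod_encode] rec1_const rec1_comp[OF rec1_set_encode_lessThan]
      rec1_comp2[OF rec2_add] rec1_id rec1_comp[OF rec1_power] rec1_start_code rec1_start_code_inv)

section \<open>Bounds on edges in terms of their codes\<close>

lemma member_le_list_encode: "x \<in> set xs \<Longrightarrow> x \<le> list_encode xs"
proof (induction xs)
  case (Cons y xs)
  have "y \<le> prod_encode (y, list_encode xs)" "list_encode xs \<le> prod_encode (y, list_encode xs)"
    by (rule le_prod_encode_1, rule le_prod_encode_2)
  then show ?case using Cons by fastforce
qed simp

lemma member_less_set_encode:
  assumes "finite X" "x \<in> X" shows "x < set_encode X"
proof -
  have "x < 2 ^ x" by (rule less_exp)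
  also have "\<dots> \<le> set_encode X"
    unfolding set_encode_def using assms by (intro member_le_sum) auto
  finally show ?thesis .
qed

lemma letter_le_sum_encode: "sum_encode x < n \<Longrightarrow> x \<in> {..<n} <+> {..<n}"
  by (cases x) (auto simp: sum_encode_def)

text \<open>Pairing and list codes dominate their components, so the index of an edge set bounds all
  its letters and states. This allows an initial segment to be the alphabet and the state
  set.\<close>

lemma edge_code_less:
  assumes "edge_code (p, x, U, q) < n"
  shows "p < n" "q < n" "x \<in> {..<n} <+> {..<n}" "U \<in> words {..<n}"
proof -
  let ?U = "list_encode (map sum_encode U)"
  have le: "p \<le> edge_code (p, x, U, q)" "sum_encode x \<le> edge_code (p, x, U, q)"
    "?U \<le> edge_code (p, x, U, q)" "q \<le> edge_code (p, x, U, q)"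
    unfolding edge_code_def prod.case
    by (meson le_prod_encode_1 le_prod_encode_2 order_trans)+
  then show "p < n" "q < n" using assms by auto
  show "x \<in> {..<n} <+> {..<n}" using letter_le_sum_encode le(2) assms by simp
  have "y \<in> {..<n} <+> {..<n}" if "y \<in> set U" for y
  proof -
    have "sum_encode y \<le> ?U" by (rule member_le_list_encode) (use that in simp)
    then show ?thesis using letter_le_sum_encode le(3) assms by simp
  qed
  then show "U \<in> words {..<n}" by (auto simp: words_def)
qed

lemma instance_edges_Un:
  "instance_edges B n = insert (0, Inl 1, start_word (reg_prime 0 ^ n), 2)
    (insert (2, Inr 1, inv_word (start_word (reg_prime 0 ^ n)), 0) (symmetric_closure B))"
  by (auto simp: instance_edges_def symmetric_closure_def)

lemma computes_Comp_single:
  "computes (Comp f [g]) xs z \<longleftrightarrow> (\<exists>v. computes g xs v \<and> computes f [v] z)"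
proof
  assume "computes (Comp f [g]) xs z"
  then obtain ys where "list_all2 (\<lambda>g y. computes g xs y) [g] ys" "computes f ys z"
    by (rule computesE(4))
  then show "\<exists>v. computes g xs v \<and> computes f [v] z" by (auto simp: list_all2_Cons1)
next
  assume "\<exists>v. computes g xs v \<and> computes f [v] z"
  then obtain v where "computes g xs v" "computes f [v] z" by blast
  then show "computes (Comp f [g]) xs z" by (intro computes.comp[of _ _ "[v]"]) auto
qed

theorem theoremB:
  shows "\<not> decidable transducer_code inverse_transducers
    (\<lambda>(A, T). fixed_points A T \<noteq> {\<one>\<^bsub>free_group A\<^esub>})"
proof
  assume "decidable transducer_code inverse_transducers
    (\<lambda>(A, T). fixed_points A T \<noteq> {\<one>\<^bsub>free_group A\<^esub>})"
  then obtain d where d: "\<And>A T. (A, T) \<in> inverse_transducers \<Longrightarrow>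
      computes d [transducer_code (A, T)] (if fixed_points A T \<noteq> {\<one>\<^bsub>free_group A\<^esub>} then 1 else 0)"
    unfolding decidable_def by fastforce
  obtain h where h: "\<And>e. computes h [e] (instance_code e)"
    using rec1_instance_code unfolding rec1_def by blast
  \<comment> \<open>On the argument \<open>v\<close>, \<open>Mu (Proj 1)\<close> looks for an
    \<open>n\<close> at which the constant \<open>v\<close> is 0; it is defined only for
    \<open>v = 0\<close>. Thus the answer 0 of \<open>d\<close> becomes halting and a positive
    answer divergence.\<close>
  define g where "g = Comp (Mu (Proj 1)) [Comp d [h]]"
  have g: "(\<exists>y. computes g [e] y) \<longleftrightarrow> computes d [instance_code e] 0" for e
  proof
    assume "\<exists>y. computes g [e] y"
    then obtain y v u where *: "computes (Mu (Proj 1)) [v] y" "computes h [e] u" "computes d [u] v"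
      unfolding g_def computes_Comp_single by blast
    from *(1) have "computes (Proj 1) [y, v] 0" by (rule computesE(7))
    then have "v = 0" by (auto elim: computesE(3))
    then show "computes d [instance_code e] 0" using * computes_deterministic[OF h *(2)] by simp
  next
    assume "computes d [instance_code e] 0"
    moreover have "computes (Mu (Proj 1)) [0] 0"
      using computes.proj[of 1 "[0, 0]"] by (intro computes.mu) auto
    ultimately show "\<exists>y. computes g [e] y" unfolding g_def computes_Comp_single using h by blast
  qed
  obtain B where B: "finite B" "\<forall>p a U q. (p, a, U, q) \<in> B \<longrightarrow> p \<noteq> 0 \<and> q \<noteq> 0"
    "\<forall>n. deterministic_edges (instance_edges B n)"
    "\<forall>n A. (\<forall>p x U q. (p, x, U, q) \<in> instance_edges B n \<longrightarrow> x \<in> A <+> A \<and> U \<in> words A) \<longrightarrow>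
      ((\<exists>w V q. w \<in> words A \<and> reduced w \<and> w \<noteq> [] \<and> path (instance_edges B n) 0 w V q \<and> (V, w) \<in> free_eq A)
      \<longleftrightarrow> (\<exists>y. computes g [n] y))"
    by (rule recf_base_edges[of g])
  have fin: "finite (symmetric_closure B)" using B(1) by (simp add: symmetric_closure_def)
  \<comment> \<open>The diagonal point: \<open>e\<close> is the code of the edges obtained from
    \<open>g\<close> itself.\<close>
  define e where "e = set_encode (edge_code ` symmetric_closure B)"
  \<comment> \<open>The summand 3 makes room for the letters 0, 1, 2 and the states 0, 2 of the
    start edges, however small \<open>e\<close> is.\<close>
  let ?A = "{..<e + 3}" and ?G = "instance_edges B e"
  let ?T = "edge_transducer ?A 0 ?G"
  let ?s = "start_word (reg_prime 0 ^ e)"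
  have G: "p \<in> ?A \<and> x \<in> ?A <+> ?A \<and> U \<in> words ?A \<and> q \<in> ?A" if edge: "(p, x, U, q) \<in> ?G" for p x U q
  proof -
    have s: "?s \<in> words ?A" by (auto simp: start_word_def words_def)
    from edge consider "p = 0" "x = Inl 1" "U = ?s" "q = 2" | "p = 2" "x = Inr 1" "U = inv_word ?s" "q = 0"
      | "(p, x, U, q) \<in> symmetric_closure B"
      unfolding instance_edges_Un by blast
    then show ?thesis
    proof cases
      case 3
      then have "edge_code (p, x, U, q) < e"
        unfolding e_def using fin by (intro member_less_set_encode) auto
      then have "edge_code (p, x, U, q) < e + 3" by simp
      from edge_code_less[OF this] show ?thesis by simp
    qed (use s in auto)
  qed
  have T: "(?A, ?T) \<in> inverse_transducers"
    using finite_edge_transducer[OF B(3)[rule_format] _ _ G] inverse_edge_transducer[OF B(3)[rule_format]]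
    by (simp add: inverse_transducers_def instance_edges_def symmetric_symmetric_closure)
  have code: "transducer_code (?A, ?T) = instance_code e"
  proof -
    have "set_encode (edge_code ` ?G) = 2 ^ start_code e + (2 ^ start_code_inv e + e)"
    proof -
      \<comment> \<open>The start edges touch state 0, unlike those of \<open>B\<close>, and differ
        from each other; so each adds its own power of two to \<open>e\<close>.\<close>
      have "start_code_inv e \<notin> edge_code ` symmetric_closure B"
        unfolding start_code_inv_def using B(2) by (auto simp: inj_image_mem_iff[OF inj_edge_code])
      moreover have "start_code e \<notin> insert (start_code_inv e) (edge_code ` symmetric_closure B)"
        unfolding start_code_def start_code_inv_def
        using B(2) by (auto simp: inj_image_mem_iff[OF inj_edge_code] inj_eq[OF inj_edge_code])
      moreover have "edge_code ` ?G =
          insert (start_code e) (insert (start_code_inv e) (edge_code ` symmetric_closure B))"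
        by (simp add: instance_edges_Un start_code_def start_code_inv_def)
      ultimately show ?thesis using fin by (simp add: set_encode_insert e_def)
    qed
    then show ?thesis
      by (simp add: transducer_code_def instance_code_def edges_edge_transducer[OF B(3)[rule_format]])
  qed
  have "fixed_points ?A ?T \<noteq> {\<one>\<^bsub>free_group ?A\<^esub>} \<longleftrightarrow> (\<exists>y. computes g [e] y)"
  proof -
    have "V \<in> words ?A" if "path ?G p w V q" for p w V q
      using path_words[OF that, of ?A] G by blast
    then have "fixed_points ?A ?T \<noteq> {\<one>\<^bsub>free_group ?A\<^esub>} \<longleftrightarrow>
        (\<exists>w V q. w \<in> words ?A \<and> reduced w \<and> w \<noteq> [] \<and> path ?G 0 w V q \<and> (V, w) \<in> free_eq ?A)"
      by (intro nontrivial_fixed_point_iff[OF B(3)[rule_format]]) blast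
    also have "\<dots> \<longleftrightarrow> (\<exists>y. computes g [e] y)" by (rule B(4)[rule_format]) (use G in blast)
    finally show ?thesis .
  qed
  moreover have "computes d [instance_code e] (if fixed_points ?A ?T \<noteq> {\<one>\<^bsub>free_group ?A\<^esub>} then 1 else 0)"
    using d[OF T] unfolding code .
  ultimately show False
    using g[of e] computes_deterministic[of d "[instance_code e]" 0 1] by (auto split: if_splits)
qed

end
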